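(* Let $\mathbf{x}=\{x_1,\dots,x_k\}\subset X$ be a finite set of $k$ points, let $\mathbf{b}=\sum_{j=1}^{\ell} n_j\delta_{y_j}$ be an atomic probability measure on $X$ ($n_j>0$, $\sum_j n_j=1$), and let $\alpha\in[0,1)$. Then: (1) An allocation plan $q\in Plan[\mathbf{x},\mathbf{b}]$ is optimal if and only if there exists an optimal assignment map $S\in Map[\ell,k]$ such that $q=q_S$. (2) An allocation path $G\in Path[\mathbf{x},\mathbf{b}]$ is optimal if and only if there exists an optimal assignment map $S\in Map[\ell,k]$ such that $G=G_S$ for some allocation path $G_S$ associated with $S$. (3) Moreover, $$\min_{q\in Plan[\mathbf{x},\mathbf{b}]}\mathbf{T}_\alpha(q)=\min_{S\in Map[\ell,k]}\mathbf{E}_\alpha(S;\mathbf{x},\mathbf{b})=\min_{G\in Path[\mathbf{x},\mathbf{b}]}\mathbf{M}_\alpha(G).$$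
   Context: $X\subset\mathbb{R}^m$ is compact and convex. An atomic measure on $X$ is a finite sum $\mathbf{c}=\sum_i c_i\delta_{z_i}$ with $z_i\in X$ and masses $c_i>0$ (for measures written as $\sum_i m_i\delta_{x_i}$, zero masses $m_i=0$ are allowed); its mass is $\mathfrak{m}(\mathbf{c})=\sum_i c_i$. Transport paths. For atomic measures $\mathbf{a},\mathbf{b}$ on $X$ of equal mass, a transport path from $\mathbf{a}$ to $\mathbf{b}$ is a weighted directed graph $G$ with a finite vertex set $V(G)$ containing all points used to write $\mathbf{a}$ and $\mathbf{b}$, a finite set $E(G)$ of directed edges, each edge $e$ being a line segment from its starting endpoint $e^-$ to its ending endpoint $e^+$, and a weight function $w:E(G)\to(0,\infty)$ such that for every $v\in V(G)$, $\sum_{e^-=v}w(e)=\sum_{e^+=v}w(e)+\mathbf{a}(\{v\})-\mathbf{b}(\{v\})$ (i.e. $\partial G=\mathbf{b}-\mathbf{a}$ when $G$ is viewed as a one-dimensional polyhedral chain). By standing convention all transport paths contain no cycles. $Path(\mathbf{a},\mathbf{b})$ is the set of all of them. $\mathbf{M}_\alpha(G)=\sum_{e\in E(G)}w(e)^\alpha\,length(e)$, $d_\alpha(\mathbf{a},\mathbf{b})=\min\{\mathbf{M}_\alpha(G):G\in Path(\mathbf{a},\mathbf{b})\}$ (equal to $0$ for zero measures), and a minimizer is called an optimal transport path. Sums of transport paths are sums of polyhedral chains. Allocation paths. $Path[\mathbf{x},\mathbf{b}]$ is the union of $Path(\mathbf{a},\mathbf{b})$ over all atomic probability measures $\mathbf{a}=\sum_{i=1}^k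 m_i\delta_{x_i}$, $m_i\ge 0$, supported on $\mathbf{x}$. $G^*\in Path[\mathbf{x},\mathbf{b}]$ is optimal if it minimizes $\mathbf{M}_\alpha$ over $Path[\mathbf{x},\mathbf{b}]$. Allocation plans. $Plan[\mathbf{x},\mathbf{b}]$ is the set of probability measures $q=\sum_{i=1}^k\sum_{j=1}^\ell q_{ij}\delta_{(x_i,y_j)}$ on $X\times X$ with $q_{ij}\ge0$ and $\sum_i q_{ij}=n_j$ for all $j$. Put $\mathbf{a}(q)=\sum_i m_i(q)\delta_{x_i}$ with $m_i(q)=\sum_j q_{ij}$. Compatibility. Given a transport path $G$ from a measure supported on $\mathbf{x}$ to $\mathbf{b}$, for each $(i,j)$ let $g_{ij}$ be the unique directed polyhedral curve on $G$ from $x_i$ to $y_j$, i.e. the list of distinct vertices $v_1=x_i,\dots,v_h=y_j$ with each $[v_t,v_{t+1}]$ a directed edge of $G$, if one exists, and $g_{ij}=0$ (empty curve) otherwise. The pair $(G,q)$ is compatible if $q_{ij}=0$ whenever $g_{ij}=0$, and $G=\sum_{i,j}q_{ij}\cdot g_{ij}$ as polyhedral chains. Cost of a plan: $\mathbf{T}_\alpha(q)=\min\{\mathbf{M}_\alpha(G):G\in Path(\mathbf{a}(q),\mathbf{b}),\ (G,q)\text{ compatible}\}$; $q^*$ is optimal if it minimizes $\mathbf{T}_\alpha$ over $Plan[\mathbf{x},\mathbf{b}]$. Assignment maps. $Map[\ell,k]$ is the set of all functions $S:\{1,\dots,\ell\}\to\{1,\dots,k\}$. For $S\in Map[\ell,k]$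 set $\mathbf{a}_i=\big(\sum_{j\in S^{-1}(i)}n_j\big)\delta_{x_i}$, $\mathbf{b}_i=\sum_{j\in S^{-1}(i)}n_j\delta_{y_j}$, and $\mathbf{E}_\alpha(S;\mathbf{x},\mathbf{b})=\sum_{i=1}^k d_\alpha(\mathbf{a}_i,\mathbf{b}_i)$. $S$ is optimal if it minimizes $\mathbf{E}_\alpha(\cdot\,;\mathbf{x},\mathbf{b})$ over $Map[\ell,k]$. Associated with $S$ are the allocation plan $q_S=\sum_{j=1}^\ell n_j\delta_{(x_{S(j)},y_j)}$ and the allocation paths $G_S=\sum_{i=1}^kG_i$, where for each $i$, $G_i\in Path(\mathbf{a}_i,\mathbf{b}_i)$ is an (arbitrarily chosen) optimal transport path. *)

theory Defs
  imports "HOL-Analysis.Analysis"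
begin

section \<open>Atomic measures\<close>

text \<open>
  A finite sum of point masses is represented by its mass function, which sends a point \<open>p\<close>
  to the measure of \<open>{p}\<close>. Zero masses are allowed.
\<close>

definition atoms :: "'i set \<Rightarrow> ('i \<Rightarrow> real) \<Rightarrow> ('i \<Rightarrow> 'b) \<Rightarrow> 'b \<Rightarrow> real" where
  "atoms I c z = (\<lambda>p. \<Sum>i\<in>I. if z i = p then c i else 0)"

section \<open>Transport paths\<close>

text \<open>
  The vertices are points of the ambient space, and an edge \<open>(u, v)\<close> is the directed segment
  from \<open>u\<close> to \<open>v\<close>. Weights are only relevant on the edge set.
\<close>

record 'a wgraph =
  verts :: "'a set"
  edges :: "('a \<times> 'a) set"
  wt :: "'a \<times> 'a \<Rightarrow> real"

definition joined :: "'a wgraph \<Rightarrow> 'a \<Rightarrow> 'a \<Rightarrow> bool" where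
  "joined G u v \<longleftrightarrow> (u, v) \<in> edges G \<or> (v, u) \<in> edges G"

text \<open>
  Cycles are taken in the underlying undirected graph; this is what makes directed curves between
  two given vertices unique. Degenerate edges and pairs of opposite edges count as cycles
  of length one and two.
\<close>

definition no_cycles :: "'a wgraph \<Rightarrow> bool" where
  "no_cycles G \<longleftrightarrow>
     (\<forall>v. (v, v) \<notin> edges G) \<and>
     (\<forall>u v. (u, v) \<in> edges G \<longrightarrow> (v, u) \<notin> edges G) \<and>
     \<not> (\<exists>vs. length vs \<ge> 3 \<and> distinct vs \<and>
          (\<forall>t<length vs. joined G (vs ! t) (vs ! (Suc t mod length vs))))"

definition transport_paths :: "'a set \<Rightarrow> ('a \<Rightarrow> real) \<Rightarrow> ('a \<Rightarrow> real) \<Rightarrow> 'a wgraph set" where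
  "transport_paths X a b =
     {G. finite (verts G) \<and> verts G \<subseteq> X \<and>
         {p. a p \<noteq> 0} \<subseteq> verts G \<and> {p. b p \<noteq> 0} \<subseteq> verts G \<and>
         edges G \<subseteq> verts G \<times> verts G \<and>
         (\<forall>e\<in>edges G. 0 < wt G e) \<and>
         (\<forall>v\<in>verts G. (\<Sum>e | e \<in> edges G \<and> fst e = v. wt G e) =
            (\<Sum>e | e \<in> edges G \<and> snd e = v. wt G e) + a v - b v) \<and>
         no_cycles G}"

definition path_cost :: "real \<Rightarrow> 'a::real_normed_vector wgraph \<Rightarrow> real" where
  "path_cost \<alpha> G = (\<Sum>e\<in>edges G. wt G e powr \<alpha> * dist (fst e) (snd e))"

definition optimal_transport_path ::
    "'a::real_normed_vector set \<Rightarrow> real \<Rightarrow> ('a \<Rightarrow> real) \<Rightarrow> ('a \<Rightarrow> real) \<Rightarrow> 'a wgraph \<Rightarrow> bool" where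
  "optimal_transport_path X \<alpha> a b G \<longleftrightarrow>
     is_arg_min (path_cost \<alpha>) (\<lambda>G. G \<in> transport_paths X a b) G"

text \<open>
  The set of transport paths is nonempty whenever \<open>a\<close> and \<open>b\<close> are atomic measures on \<open>X\<close> of equal
  mass, so the real-valued infimum is meaningful there.
\<close>

definition transport_dist ::
    "'a::real_normed_vector set \<Rightarrow> real \<Rightarrow> ('a \<Rightarrow> real) \<Rightarrow> ('a \<Rightarrow> real) \<Rightarrow> real" where
  "transport_dist X \<alpha> a b = (INF G\<in>transport_paths X a b. path_cost \<alpha> G)"

section \<open>Polyhedral chains\<close>

text \<open>
  A chain is a formal real combination of oriented segments, where reversing a segment changes
  the sign. It is encoded as an antisymmetric coefficient function on ordered pairs of points.
  A segment is not identified with its subdivisions: \<open>path_cost\<close> is computed edge by edge and is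
  not invariant under such identifications once edges of a graph overlap. For instance, if \<open>v\<close> lies
  on the segment from \<open>u\<close> to \<open>w\<close>, the graph with unit edges \<open>(u, v)\<close> and \<open>(u, w)\<close> is
  more expensive than the one with edges \<open>(u, v)\<close> of weight 2 and \<open>(v, w)\<close> of weight 1.
\<close>

definition segment_chain :: "'a \<times> 'a \<Rightarrow> 'a \<times> 'a \<Rightarrow> real" where
  "segment_chain e = (\<lambda>p. (if p = e then 1 else 0) - (if p = prod.swap e then 1 else 0))"

definition path_chain :: "'a wgraph \<Rightarrow> 'a \<times> 'a \<Rightarrow> real" where
  "path_chain G = (\<lambda>p. \<Sum>e\<in>edges G. wt G e * segment_chain e p)"

text \<open>The list may have length one, so a vertex is joined to itself by the constant curve.\<close>

definition directed_curve :: "'a wgraph \<Rightarrow> 'a \<Rightarrow> 'a \<Rightarrow> 'a list \<Rightarrow> bool" where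
  "directed_curve G u v vs \<longleftrightarrow>
     vs \<noteq> [] \<and> hd vs = u \<and> last vs = v \<and> distinct vs \<and> set vs \<subseteq> verts G \<and>
     (\<forall>t. Suc t < length vs \<longrightarrow> (vs ! t, vs ! Suc t) \<in> edges G)"

definition curve_chain :: "'a list \<Rightarrow> 'a \<times> 'a \<Rightarrow> real" where
  "curve_chain vs = (\<lambda>p. \<Sum>t<length vs - 1. segment_chain (vs ! t, vs ! Suc t) p)"

definition joining_chain :: "'a wgraph \<Rightarrow> 'a \<Rightarrow> 'a \<Rightarrow> 'a \<times> 'a \<Rightarrow> real" where
  "joining_chain G u v =
     (if \<exists>vs. directed_curve G u v vs then curve_chain (THE vs. directed_curve G u v vs)
      else (\<lambda>p. 0))"

section \<open>Allocation paths\<close>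

definition allocation_paths ::
    "'a set \<Rightarrow> nat \<Rightarrow> (nat \<Rightarrow> 'a) \<Rightarrow> ('a \<Rightarrow> real) \<Rightarrow> 'a wgraph set" where
  "allocation_paths X k x b =
     (\<Union>m\<in>{m. (\<forall>i\<in>{1..k}. 0 \<le> m i) \<and> (\<Sum>i=1..k. m i) = 1}.
        transport_paths X (atoms {1..k} m x) b)"

definition optimal_allocation_path ::
    "'a::real_normed_vector set \<Rightarrow> real \<Rightarrow> nat \<Rightarrow> (nat \<Rightarrow> 'a) \<Rightarrow> ('a \<Rightarrow> real) \<Rightarrow> 'a wgraph \<Rightarrow> bool" where
  "optimal_allocation_path X \<alpha> k x b G \<longleftrightarrow>
     is_arg_min (path_cost \<alpha>) (\<lambda>G. G \<in> allocation_paths X k x b) G"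

section \<open>Allocation plans\<close>

text \<open>
  The points \<open>x i\<close> are distinct and so are the points \<open>y j\<close>; hence the coefficient of a plan at
  \<open>(i, j)\<close> is \<open>q (x i, y j)\<close>.
\<close>

definition allocation_plans ::
    "nat \<Rightarrow> (nat \<Rightarrow> 'a) \<Rightarrow> nat \<Rightarrow> (nat \<Rightarrow> real) \<Rightarrow> (nat \<Rightarrow> 'a) \<Rightarrow> ('a \<times> 'a \<Rightarrow> real) set" where
  "allocation_plans k x l n y =
     {atoms ({1..k} \<times> {1..l}) (\<lambda>(i, j). Q i j) (\<lambda>(i, j). (x i, y j)) | Q.
        (\<forall>i\<in>{1..k}. \<forall>j\<in>{1..l}. 0 \<le> Q i j) \<and> (\<forall>j\<in>{1..l}. (\<Sum>i=1..k. Q i j) = n j)}"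

definition plan_source ::
    "nat \<Rightarrow> (nat \<Rightarrow> 'a) \<Rightarrow> nat \<Rightarrow> (nat \<Rightarrow> 'a) \<Rightarrow> ('a \<times> 'a \<Rightarrow> real) \<Rightarrow> 'a \<Rightarrow> real" where
  "plan_source k x l y q = atoms {1..k} (\<lambda>i. \<Sum>j=1..l. q (x i, y j)) x"

definition compatible ::
    "nat \<Rightarrow> (nat \<Rightarrow> 'a) \<Rightarrow> nat \<Rightarrow> (nat \<Rightarrow> 'a) \<Rightarrow> 'a wgraph \<Rightarrow> ('a \<times> 'a \<Rightarrow> real) \<Rightarrow> bool" where
  "compatible k x l y G q \<longleftrightarrow>
     (\<forall>i\<in>{1..k}. \<forall>j\<in>{1..l}. (\<nexists>vs. directed_curve G (x i) (y j) vs) \<longrightarrow> q (x i, y j) = 0) \<and>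
     path_chain G = (\<lambda>p. \<Sum>i=1..k. \<Sum>j=1..l. q (x i, y j) * joining_chain G (x i) (y j) p)"

text \<open>
  A plan that is far from optimal need not have any compatible path without cycles: when
  \<open>x 1 = y 1\<close> and \<open>x 2 = y 2\<close>, a plan exchanging mass between these two points would need
  edges in both directions. Such plans have cost \<open>\<infinity>\<close>.
\<close>

definition plan_cost ::
    "'a::real_normed_vector set \<Rightarrow> real \<Rightarrow> nat \<Rightarrow> (nat \<Rightarrow> 'a) \<Rightarrow> nat \<Rightarrow> (nat \<Rightarrow> real) \<Rightarrow> (nat \<Rightarrow> 'a)
      \<Rightarrow> ('a \<times> 'a \<Rightarrow> real) \<Rightarrow> ereal" where
  "plan_cost X \<alpha> k x l n y q =
     (INF G\<in>{G \<in> transport_paths X (plan_source k x l y q) (atoms {1..l} n y).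
               compatible k x l y G q}. ereal (path_cost \<alpha> G))"

definition optimal_plan ::
    "'a::real_normed_vector set \<Rightarrow> real \<Rightarrow> nat \<Rightarrow> (nat \<Rightarrow> 'a) \<Rightarrow> nat \<Rightarrow> (nat \<Rightarrow> real) \<Rightarrow> (nat \<Rightarrow> 'a)
      \<Rightarrow> ('a \<times> 'a \<Rightarrow> real) \<Rightarrow> bool" where
  "optimal_plan X \<alpha> k x l n y q \<longleftrightarrow>
     is_arg_min (plan_cost X \<alpha> k x l n y) (\<lambda>q. q \<in> allocation_plans k x l n y) q"

section \<open>Assignment maps\<close>

definition assignment_maps :: "nat \<Rightarrow> nat \<Rightarrow> (nat \<Rightarrow> nat) set" where
  "assignment_maps l k = {1..l} \<rightarrow>\<^sub>E {1..k}"

definition assigned_source ::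
    "(nat \<Rightarrow> 'a) \<Rightarrow> nat \<Rightarrow> (nat \<Rightarrow> real) \<Rightarrow> (nat \<Rightarrow> nat) \<Rightarrow> nat \<Rightarrow> 'a \<Rightarrow> real" where
  "assigned_source x l n S i = atoms {i} (\<lambda>i. \<Sum>j | j \<in> {1..l} \<and> S j = i. n j) x"

definition assigned_target ::
    "nat \<Rightarrow> (nat \<Rightarrow> real) \<Rightarrow> (nat \<Rightarrow> 'a) \<Rightarrow> (nat \<Rightarrow> nat) \<Rightarrow> nat \<Rightarrow> 'a \<Rightarrow> real" where
  "assigned_target l n y S i = atoms {j \<in> {1..l}. S j = i} n y"

definition assignment_cost ::
    "'a::real_normed_vector set \<Rightarrow> real \<Rightarrow> nat \<Rightarrow> (nat \<Rightarrow> 'a) \<Rightarrow> nat \<Rightarrow> (nat \<Rightarrow> real) \<Rightarrow> (nat \<Rightarrow> 'a)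
      \<Rightarrow> (nat \<Rightarrow> nat) \<Rightarrow> real" where
  "assignment_cost X \<alpha> k x l n y S =
     (\<Sum>i=1..k. transport_dist X \<alpha> (assigned_source x l n S i) (assigned_target l n y S i))"

definition optimal_assignment ::
    "'a::real_normed_vector set \<Rightarrow> real \<Rightarrow> nat \<Rightarrow> (nat \<Rightarrow> 'a) \<Rightarrow> nat \<Rightarrow> (nat \<Rightarrow> real) \<Rightarrow> (nat \<Rightarrow> 'a)
      \<Rightarrow> (nat \<Rightarrow> nat) \<Rightarrow> bool" where
  "optimal_assignment X \<alpha> k x l n y S \<longleftrightarrow>
     is_arg_min (assignment_cost X \<alpha> k x l n y) (\<lambda>S. S \<in> assignment_maps l k) S"

definition assignment_plan ::
    "(nat \<Rightarrow> 'a) \<Rightarrow> nat \<Rightarrow> (nat \<Rightarrow> real) \<Rightarrow> (nat \<Rightarrow> 'a) \<Rightarrow> (nat \<Rightarrow> nat) \<Rightarrow> 'a \<times> 'a \<Rightarrow> real" where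
  "assignment_plan x l n y S = atoms {1..l} n (\<lambda>j. (x (S j), y j))"

text \<open>
  \<open>associated_path \<dots> S G\<close>: as a chain, \<open>G\<close> is the sum of optimal transport paths \<open>Gs i\<close>, one
  for each source.
\<close>

definition associated_path ::
    "'a::real_normed_vector set \<Rightarrow> real \<Rightarrow> nat \<Rightarrow> (nat \<Rightarrow> 'a) \<Rightarrow> nat \<Rightarrow> (nat \<Rightarrow> real) \<Rightarrow> (nat \<Rightarrow> 'a)
      \<Rightarrow> (nat \<Rightarrow> nat) \<Rightarrow> 'a wgraph \<Rightarrow> bool" where
  "associated_path X \<alpha> k x l n y S G \<longleftrightarrow>
     (\<exists>Gs. (\<forall>i\<in>{1..k}. optimal_transport_path X \<alpha>
                (assigned_source x l n S i) (assigned_target l n y S i) (Gs i)) \<and>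
           path_chain G = (\<lambda>p. \<Sum>i=1..k. path_chain (Gs i) p))"

end

theory Submission imports Defs begin

text \<open>
  Transport paths are viewed as antisymmetric chains, and paths without cycles as rigid chains: the
  support of the chain carries no nonzero circulation. Along a line \<open>\<phi> + t C\<close>
  with \<open>C\<close> supported on \<open>\<phi>\<close>, the cost is concave until an edge disappears, and strictly smaller on
  one side. Hence an optimal allocation chain contains no cycle, and none of its trees contains two
  points that supply mass: otherwise mass could be shifted from one to the other along the tree.
  So every \<open>y j\<close> receives its mass from one source along one curve, which is an assignment map.

  Minimizers exist because a system of curves in a forest can be straightened, without increasing
  the cost, until it has boundedly many vertices; there are then finitely many combinatorial types,
  and for each of them the cost depends continuously on the positions of the vertices in the compact
  set \<open>X\<close>.
\<close>

section \<open>Concavity of powers\<close>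

text \<open>Transport paths without cycles are not closed under addition, whereas chains form a
  vector space; so all minimization takes place over chains whose supply is confined to a finite set
  \<open>R\<close>. With \<open>R\<close> the set of all \<open>x i\<close> this is the allocation
  problem; with \<open>R = {x i}\<close> conservation of mass fixes the supply, and it is the
  transport problem behind \<open>transport_dist\<close>. Existence and rigidity thus serve both.
  The minimum \<open>min_cost\<close> over chains is the yardstick: every assignment costs at least
  that much by subadditivity, and one read off from a minimal chain costs exactly that. Two
  obstacles shape the rest. For \<alpha> = 0 the cost is discontinuous in the weights, so
  compactness is applied to positions only, with the masses on labelled curves held fixed. And
  positions may collide in the limit, which can create cycles and cancellation; hence costs are
  charged per labelled step, and equality with the cost of the chain excludes cancellation
  afterwards. The same device handles plans, whose cost is an infimum that is not known in advance
  to be attained.\<close>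

lemma powr_tangent:
  fixes s z \<alpha> :: real
  assumes "0 \<le> s" "0 < z" "0 \<le> \<alpha>" "\<alpha> < 1"
  shows "s powr \<alpha> \<le> z powr \<alpha> + \<alpha> * z powr (\<alpha> - 1) * (s - z)"
proof -
  have z1: "z powr (1 - \<alpha>) * z powr (\<alpha> - 1) = 1" "z * z powr (\<alpha> - 1) = z powr \<alpha>"
    using assms powr_add[of z "1 - \<alpha>" "\<alpha> - 1"] powr_add[of z 1 "\<alpha> - 1"] by simp_all
  show ?thesis
  \<comment> \<open>Since \<open>0 powr \<alpha> = 0\<close> even for \<alpha> = 0, the boundary
    point is checked by hand; the inequality below is for positive arguments.\<close>
  proof (cases "s = 0")
    case True
    have "\<alpha> * z powr (\<alpha> - 1) * (0 - z) = - \<alpha> * (z * z powr (\<alpha> - 1))"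
      by simp
    then have "\<alpha> * z powr (\<alpha> - 1) * (0 - z) = - \<alpha> * z powr \<alpha>"
      unfolding z1(2) .
    moreover have "\<alpha> * z powr \<alpha> \<le> 1 * z powr \<alpha>"
      using assms by (intro mult_right_mono) auto
    ultimately have "0 \<le> z powr \<alpha> + \<alpha> * z powr (\<alpha> - 1) * (0 - z)" by linarith
    then show ?thesis unfolding True by simp
  next
    case False
    \<comment> \<open>Weighted AM-GM with weights \<alpha> and 1 - \<alpha>; multiplied by
      \<open>z powr (\<alpha> - 1)\<close>, its right-hand side becomes the tangent line at
      \<open>z\<close>.\<close>
    have "s powr \<alpha> * z powr (1 - \<alpha>) \<le> \<alpha> * s + (1 - \<alpha>) * z"
      using assms False by (intro Youngs_inequality_0) auto
    then have "(s powr \<alpha> * z powr (1 - \<alpha>)) * z powr (\<alpha> - 1) \<le> (\<alpha> * s + (1 - \<alpha>) * z) * z powr (\<alpha> - 1)"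
      by (intro mult_right_mono) auto
    also have "(s powr \<alpha> * z powr (1 - \<alpha>)) * z powr (\<alpha> - 1) = s powr \<alpha>"
      using z1 by (simp add: mult.assoc)
    also have "(\<alpha> * s + (1 - \<alpha>) * z) * z powr (\<alpha> - 1) = z * z powr (\<alpha> - 1) + \<alpha> * z powr (\<alpha> - 1) * (s - z)"
      by (simp add: algebra_simps)
    finally show ?thesis using z1 by simp
  qed
qed

text \<open>\<open>z\<close> is the mean of the two end points with weights \<open>t2\<close> and
  \<open>t1\<close>. Adding the tangent bounds at \<open>z\<close> with these weights cancels the
  linear terms.\<close>

lemma powr_push_concave:
  fixes c z t1 t2 \<alpha> :: real
  assumes "0 \<le> z" "0 < t1" "0 < t2" "0 \<le> z - t1 * c" "0 \<le> z + t2 * c" "0 \<le> \<alpha>" "\<alpha> < 1"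
  shows "t2 * (z - t1 * c) powr \<alpha> + t1 * (z + t2 * c) powr \<alpha> \<le> (t1 + t2) * z powr \<alpha>"
proof (cases "z = 0")
  case True
  \<comment> \<open>At \<open>z = 0\<close> there is no tangent, but end points on opposite sides of
    0 can only both be nonnegative if \<open>c = 0\<close>.\<close>
  then have "c = 0"
    using assms by (simp add: mult_le_0_iff zero_le_mult_iff)
  then show ?thesis using True by simp
next
  case False
  then have z: "0 < z" using assms by simp
  have "t2 * (z - t1 * c) powr \<alpha> \<le> t2 * (z powr \<alpha> + \<alpha> * z powr (\<alpha> - 1) * ((z - t1 * c) - z))"
    using powr_tangent[of "z - t1 * c" z \<alpha>] z assms by simp
  moreover have "t1 * (z + t2 * c) powr \<alpha> \<le> t1 * (z powr \<alpha> + \<alpha> * z powr (\<alpha> - 1) * ((z + t2 * c) - z))"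
    using powr_tangent[of "z + t2 * c" z \<alpha>] z assms by simp
  ultimately show ?thesis by (simp add: algebra_simps)
qed

text \<open>When the edge dies at one end, the other end carries \<open>r * z\<close> with
  \<open>r = (t1 + t2) / t2 > 1\<close>. The strict gain is \<open>r powr \<alpha> < r\<close>; the
  dead end costs 0 also for \<alpha> = 0.\<close>

lemma powr_push_strict:
  fixes c z t1 t2 \<alpha> :: real
  assumes "0 < z" "0 < t1" "0 < t2" "z + t2 * c = 0" "0 \<le> \<alpha>" "\<alpha> < 1"
  shows "t2 * (z - t1 * c) powr \<alpha> + t1 * (z + t2 * c) powr \<alpha> < (t1 + t2) * z powr \<alpha>"
proof -
  define r where "r = (t1 + t2) / t2"
  have r: "1 < r" "t2 * r = t1 + t2" using assms by (simp_all add: r_def)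
  have c: "c = - z / t2" using assms by (simp add: field_simps)
  have "z - t1 * c = r * z" using assms by (simp add: c r_def field_simps)
  then have "(z - t1 * c) powr \<alpha> = r powr \<alpha> * z powr \<alpha>"
    using r assms by (simp add: powr_mult)
  moreover have "r powr \<alpha> < r" using powr_less_mono[of \<alpha> 1 r] r assms by simp
  then have "t2 * (r powr \<alpha> * z powr \<alpha>) < t2 * (r * z powr \<alpha>)"
    using assms by simp
  moreover have "t2 * (r * z powr \<alpha>) = (t1 + t2) * z powr \<alpha>" using r by (simp flip: mult.assoc)
  ultimately show ?thesis using assms by simp
qed

text \<open>Splits \<open>(x + y) powr \<alpha>\<close> into \<open>x\<close> and \<open>y\<close>
  times \<open>(x + y) powr (\<alpha> - 1)\<close>; the exponent being negative, replacing the base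
  \<open>x + y\<close> by the smaller \<open>x\<close> or \<open>y\<close> only increases each
  part.\<close>

lemma powr_subadditive:
  fixes x y \<alpha> :: real
  assumes "0 \<le> x" "0 \<le> y" "0 \<le> \<alpha>" "\<alpha> < 1"
  shows "(x + y) powr \<alpha> \<le> x powr \<alpha> + y powr \<alpha>"
proof (cases "x = 0 \<or> y = 0")
  case True
  then show ?thesis by auto
next
  case False
  then have *: "0 < x" "0 < y" using assms by auto
  have 1: "z * (x + y) powr (\<alpha> - 1) \<le> z powr \<alpha>" if "0 < z" "z \<le> x + y" for z
  proof -
    have "(x + y) powr (\<alpha> - 1) \<le> z powr (\<alpha> - 1)"
      using that assms by (intro powr_mono2') auto
    then have "z * (x + y) powr (\<alpha> - 1) \<le> z * z powr (\<alpha> - 1)"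
      using that by simp
    also have "\<dots> = z powr \<alpha>" using that powr_add[of z 1 "\<alpha> - 1"] by simp
    finally show ?thesis .
  qed
  have "(x + y) powr \<alpha> = (x + y) * (x + y) powr (\<alpha> - 1)"
    using * powr_add[of "x + y" 1 "\<alpha> - 1"] by simp
  also have "\<dots> \<le> x powr \<alpha> + y powr \<alpha>"
    using 1[of x] 1[of y] * by (simp add: algebra_simps)
  finally show ?thesis .
qed

lemma powr_sum_subadditive:
  fixes f :: "'b \<Rightarrow> real"
  assumes "\<And>i. i \<in> A \<Longrightarrow> 0 \<le> f i" "0 \<le> \<alpha>" "\<alpha> < 1"
  shows "(\<Sum>i\<in>A. f i) powr \<alpha> \<le> (\<Sum>i\<in>A. f i powr \<alpha>)"
  using assms(1)
proof (induction A rule: infinite_finite_induct)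
  case (insert a A)
  then have "(f a + sum f A) powr \<alpha> \<le> f a powr \<alpha> + sum f A powr \<alpha>"
    by (intro powr_subadditive sum_nonneg) (use assms in auto)
  with insert show ?case by fastforce
qed auto

section \<open>Flow chains\<close>

text \<open>Sign convention: \<open>\<phi> (u, v) > 0\<close> means that mass flows from \<open>u\<close> to \<open>v\<close>.\<close>

definition flow_chain :: "'a set \<Rightarrow> ('a \<times> 'a \<Rightarrow> real) \<Rightarrow> bool" where
  "flow_chain X \<phi> \<longleftrightarrow> finite {e. \<phi> e \<noteq> 0} \<and> {e. \<phi> e \<noteq> 0} \<subseteq> X \<times> X \<and>
     (\<forall>u v. \<phi> (v, u) = - \<phi> (u, v))"

definition outflow :: "('a \<times> 'a \<Rightarrow> real) \<Rightarrow> 'a \<Rightarrow> real" where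
  "outflow \<phi> v = (\<Sum>u | \<phi> (v, u) \<noteq> 0. \<phi> (v, u))"

text \<open>On a flow chain exactly one orientation of each segment in the support is positive, so
  every segment is charged once.\<close>

definition chain_cost :: "real \<Rightarrow> ('a::real_normed_vector \<times> 'a \<Rightarrow> real) \<Rightarrow> real" where
  "chain_cost \<alpha> \<phi> = (\<Sum>e | \<phi> e > 0. \<phi> e powr \<alpha> * dist (fst e) (snd e))"

lemma flow_chainD:
  assumes "flow_chain X \<phi>"
  shows "finite {e. \<phi> e \<noteq> 0}" "\<phi> e \<noteq> 0 \<Longrightarrow> fst e \<in> X \<and> snd e \<in> X" "\<phi> (v, u) = - \<phi> (u, v)"
    "\<phi> (u, u) = 0"
proof -
  show "finite {e. \<phi> e \<noteq> 0}"
    using assms unfolding flow_chain_def by blast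
  show "\<phi> e \<noteq> 0 \<Longrightarrow> fst e \<in> X \<and> snd e \<in> X"
    using assms unfolding flow_chain_def by (metis (mono_tags) mem_Collect_eq mem_Times_iff subsetD)
  show *: "\<phi> (v, u) = - \<phi> (u, v)" for u v
    using assms unfolding flow_chain_def by blast
  show "\<phi> (u, u) = 0" using *[of u u] by simp
qed

lemma flow_chain_mono: "flow_chain X \<phi> \<Longrightarrow> X \<subseteq> Y \<Longrightarrow> flow_chain Y \<phi>"
  unfolding flow_chain_def by blast

lemma flow_chain_zero: "flow_chain X (\<lambda>_. 0)"
  by (simp add: flow_chain_def)

lemma flow_chain_lincomb:
  assumes "flow_chain X \<phi>" "flow_chain X \<psi>"
  shows "flow_chain X (\<lambda>e. s * \<phi> e + t * \<psi> e)"
proof -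
  have sub: "{e. s * \<phi> e + t * \<psi> e \<noteq> 0} \<subseteq> {e. \<phi> e \<noteq> 0} \<union> {e. \<psi> e \<noteq> 0}" by auto
  have "finite {e. s * \<phi> e + t * \<psi> e \<noteq> 0}"
    by (rule finite_subset[OF sub]) (simp add: flow_chainD(1)[OF assms(1)] flow_chainD(1)[OF assms(2)])
  moreover have "s * \<phi> (v, u) + t * \<psi> (v, u) = - (s * \<phi> (u, v) + t * \<psi> (u, v))" for u v
    using flow_chainD(3)[OF assms(1), of v u] flow_chainD(3)[OF assms(2), of v u] by simp
  moreover have "{e. s * \<phi> e + t * \<psi> e \<noteq> 0} \<subseteq> X \<times> X"
    using sub flow_chainD(2)[OF assms(1)] flow_chainD(2)[OF assms(2)] by (force simp: mem_Times_iff)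
  ultimately show ?thesis unfolding flow_chain_def by blast
qed

lemma flow_chain_add: "flow_chain X \<phi> \<Longrightarrow> flow_chain X \<psi> \<Longrightarrow> flow_chain X (\<lambda>e. \<phi> e + \<psi> e)"
  using flow_chain_lincomb[of X \<phi> \<psi> 1 1] by simp

lemma flow_chain_scale: "flow_chain X \<phi> \<Longrightarrow> flow_chain X (\<lambda>e. c * \<phi> e)"
  using flow_chain_lincomb[OF _ flow_chain_zero, of X \<phi> c 0] by simp

lemma flow_chain_sum:
  assumes "\<And>i. i \<in> I \<Longrightarrow> flow_chain X (\<phi> i)"
  shows "flow_chain X (\<lambda>e. \<Sum>i\<in>I. c i * \<phi> i e)"
  using assms
proof (induction I rule: infinite_finite_induct)
  case (insert a I)
  have "flow_chain X (\<lambda>e. c a * \<phi> a e + 1 * (\<Sum>i\<in>I. c i * \<phi> i e))"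
    by (rule flow_chain_lincomb[OF insert.prems insert.IH[OF insert.prems]]) auto
  then show ?case using insert(1,2) by simp
qed (simp_all add: flow_chain_zero)

lemma flow_chain_finite_row:
  assumes "flow_chain X \<phi>"
  shows "finite {u. \<phi> (v, u) \<noteq> 0}"
proof -
  have "{u. \<phi> (v, u) \<noteq> 0} \<subseteq> snd ` {e. \<phi> e \<noteq> 0}" by force
  then show ?thesis using flow_chainD(1)[OF assms] finite_subset by blast
qed

lemma outflow_eq_sum:
  assumes "finite U" "\<And>u. \<phi> (v, u) \<noteq> 0 \<Longrightarrow> u \<in> U"
  shows "outflow \<phi> v = (\<Sum>u\<in>U. \<phi> (v, u))"
  unfolding outflow_def using assms by (intro sum.mono_neutral_left) auto

lemma outflow_lincomb:
  assumes "flow_chain X \<phi>" "flow_chain X \<psi>"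
  shows "outflow (\<lambda>e. s * \<phi> e + t * \<psi> e) v = s * outflow \<phi> v + t * outflow \<psi> v"
proof -
  let ?U = "{u. \<phi> (v, u) \<noteq> 0} \<union> {u. \<psi> (v, u) \<noteq> 0}"
  have f: "finite ?U"
    using flow_chain_finite_row[OF assms(1)] flow_chain_finite_row[OF assms(2)] by (rule finite_UnI)
  have "outflow (\<lambda>e. s * \<phi> e + t * \<psi> e) v = (\<Sum>u\<in>?U. s * \<phi> (v, u) + t * \<psi> (v, u))"
    "outflow \<phi> v = (\<Sum>u\<in>?U. \<phi> (v, u))" "outflow \<psi> v = (\<Sum>u\<in>?U. \<psi> (v, u))"
    by (intro outflow_eq_sum f; auto)+
  then show ?thesis by (simp add: sum.distrib sum_distrib_left)
qed

lemma outflow_zero [simp]: "outflow (\<lambda>_. 0) v = 0"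
  by (simp add: outflow_def)

lemma outflow_scale: "flow_chain X \<phi> \<Longrightarrow> outflow (\<lambda>e. c * \<phi> e) v = c * outflow \<phi> v"
  using outflow_lincomb[OF _ flow_chain_zero, of X \<phi> c 0 v] by simp

lemma outflow_sum:
  assumes "\<And>i. i \<in> I \<Longrightarrow> flow_chain X (\<phi> i)"
  shows "outflow (\<lambda>e. \<Sum>i\<in>I. c i * \<phi> i e) v = (\<Sum>i\<in>I. c i * outflow (\<phi> i) v)"
  using assms
proof (induction I rule: infinite_finite_induct)
  case (insert a I)
  have fc: "flow_chain X (\<phi> a)" "flow_chain X (\<lambda>e. \<Sum>i\<in>I. c i * \<phi> i e)"
    by (rule insert.prems, simp) (rule flow_chain_sum[OF insert.prems], simp)
  have IH: "outflow (\<lambda>e. \<Sum>i\<in>I. c i * \<phi> i e) v = (\<Sum>i\<in>I. c i * outflow (\<phi> i) v)"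
    by (rule insert.IH[OF insert.prems]) simp
  show ?case using outflow_lincomb[OF fc, of "c a" 1 v] insert(1,2) IH by simp
qed simp_all

lemma flow_chain_verts:
  assumes "flow_chain X \<phi>"
  obtains V where "finite V" "V \<subseteq> X" "\<And>e. \<phi> e \<noteq> 0 \<Longrightarrow> e \<in> V \<times> V"
proof
  let ?V = "fst ` {e. \<phi> e \<noteq> 0} \<union> snd ` {e. \<phi> e \<noteq> 0}"
  show "finite ?V" using flow_chainD(1)[OF assms] by auto
  show "?V \<subseteq> X" using flow_chainD(2)[OF assms] by auto
  show "e \<in> ?V \<times> ?V" if "\<phi> e \<noteq> 0" for e
    using that by (cases e) force
qed

lemma outflow_outside:
  assumes "\<And>u. \<phi> (v, u) = 0"
  shows "outflow \<phi> v = 0"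
  using assms by (simp add: outflow_def)

lemma sum_antisymmetric_zero:
  fixes \<phi> :: "'a \<times> 'a \<Rightarrow> real"
  assumes "\<And>u v. \<phi> (v, u) = - \<phi> (u, v)"
  shows "(\<Sum>v\<in>W. \<Sum>u\<in>W. \<phi> (v, u)) = 0"
proof -
  have "(\<Sum>v\<in>W. \<Sum>u\<in>W. \<phi> (v, u)) = (\<Sum>v\<in>W. \<Sum>u\<in>W. - \<phi> (u, v))"
    by (intro sum.cong refl) (rule assms)
  also have "\<dots> = - (\<Sum>v\<in>W. \<Sum>u\<in>W. \<phi> (u, v))"
    by (simp add: sum_negf)
  also have "(\<Sum>v\<in>W. \<Sum>u\<in>W. \<phi> (u, v)) = (\<Sum>v\<in>W. \<Sum>u\<in>W. \<phi> (v, u))"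
    by (rule sum.swap)
  finally show ?thesis by simp
qed

text \<open>Conservation of mass: each segment enters the total twice, with opposite signs at its
  two ends.\<close>

lemma sum_outflow:
  assumes "flow_chain X \<phi>" "finite W" "\<And>e. \<phi> e \<noteq> 0 \<Longrightarrow> e \<in> W \<times> W"
  shows "(\<Sum>v\<in>W. outflow \<phi> v) = 0"
proof -
  have "(\<Sum>v\<in>W. outflow \<phi> v) = (\<Sum>v\<in>W. \<Sum>u\<in>W. \<phi> (v, u))"
    by (intro sum.cong refl outflow_eq_sum) (use assms in auto)
  also have "\<dots> = 0"
    by (rule sum_antisymmetric_zero) (rule flow_chainD(3)[OF assms(1)])
  finally show ?thesis .
qed

section \<open>Costs of chains and of their sums\<close>

text \<open>Lets chains with different supports be compared term by term over one index set; the
  padding terms vanish because \<open>0 powr \<alpha> = 0\<close>.\<close>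

lemma chain_cost_eq_sum:
  assumes "finite E" "\<And>e. \<phi> e > 0 \<Longrightarrow> e \<in> E"
  shows "chain_cost \<alpha> \<phi> = (\<Sum>e\<in>E. max 0 (\<phi> e) powr \<alpha> * dist (fst e) (snd e))"
proof -
  have "chain_cost \<alpha> \<phi> = (\<Sum>e | \<phi> e > 0. max 0 (\<phi> e) powr \<alpha> * dist (fst e) (snd e))"
    unfolding chain_cost_def by (intro sum.cong) auto
  also have "\<dots> = (\<Sum>e\<in>E. max 0 (\<phi> e) powr \<alpha> * dist (fst e) (snd e))"
    using assms by (intro sum.mono_neutral_left) (auto simp: max_def)
  finally show ?thesis .
qed

lemma chain_cost_nonneg: "0 \<le> chain_cost \<alpha> \<phi>"
  unfolding chain_cost_def by (intro sum_nonneg) auto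

text \<open>Opposite flows cancel to the benefit of the sum, as the positive part is subadditive,
  and merging parallel flows is no dearer by subadditivity of the power.\<close>

lemma chain_cost_sum_le:
  assumes "finite I" "\<And>i. i \<in> I \<Longrightarrow> flow_chain X (\<phi> i)" "0 \<le> \<alpha>" "\<alpha> < 1"
  shows "chain_cost \<alpha> (\<lambda>e. \<Sum>i\<in>I. \<phi> i e) \<le> (\<Sum>i\<in>I. chain_cost \<alpha> (\<phi> i))"
proof -
  let ?E = "\<Union>i\<in>I. {e. \<phi> i e \<noteq> 0}"
  have f: "finite ?E" using assms flow_chainD(1) by blast
  have "chain_cost \<alpha> (\<lambda>e. \<Sum>i\<in>I. \<phi> i e) = (\<Sum>e\<in>?E. max 0 (\<Sum>i\<in>I. \<phi> i e) powr \<alpha> * dist (fst e) (snd e))"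
  proof (rule chain_cost_eq_sum[OF f])
    fix e assume "0 < (\<Sum>i\<in>I. \<phi> i e)"
    then obtain i where "i \<in> I" "\<phi> i e \<noteq> 0" using sum.neutral[of I "\<lambda>i. \<phi> i e"] by fastforce
    then show "e \<in> ?E" by auto
  qed
  also have "\<dots> \<le> (\<Sum>e\<in>?E. (\<Sum>i\<in>I. max 0 (\<phi> i e) powr \<alpha>) * dist (fst e) (snd e))"
  proof (intro sum_mono mult_right_mono)
    fix e
    have "(\<Sum>i\<in>I. \<phi> i e) \<le> (\<Sum>i\<in>I. max 0 (\<phi> i e))" by (intro sum_mono) auto
    then have "max 0 (\<Sum>i\<in>I. \<phi> i e) \<le> (\<Sum>i\<in>I. max 0 (\<phi> i e))" by (simp add: sum_nonneg)
    then have "max 0 (\<Sum>i\<in>I. \<phi> i e) powr \<alpha> \<le> (\<Sum>i\<in>I. max 0 (\<phi> i e)) powr \<alpha>"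
      using assms by (intro powr_mono2) auto
    also have "\<dots> \<le> (\<Sum>i\<in>I. max 0 (\<phi> i e) powr \<alpha>)"
      using assms by (intro powr_sum_subadditive) auto
    finally show "max 0 (\<Sum>i\<in>I. \<phi> i e) powr \<alpha> \<le> (\<Sum>i\<in>I. max 0 (\<phi> i e) powr \<alpha>)" .
  qed auto
  also have "\<dots> = (\<Sum>i\<in>I. \<Sum>e\<in>?E. max 0 (\<phi> i e) powr \<alpha> * dist (fst e) (snd e))"
    by (simp add: sum_distrib_right sum.swap[of _ _ I])
  also have "\<dots> = (\<Sum>i\<in>I. chain_cost \<alpha> (\<phi> i))"
    by (intro sum.cong refl chain_cost_eq_sum[symmetric] f) (force simp: less_le)
  finally show ?thesis .
qed

section \<open>Pushing along a chain\<close>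

text \<open>
  With Isabelle's convention \<open>0 powr \<alpha> = 0\<close>, the function \<open>t \<mapsto> t powr \<alpha>\<close> is concave on the
  closed half-line also for \<open>\<alpha> = 0\<close>, so the cost is concave in \<open>t\<close> along \<open>\<phi> + t C\<close> as long as no
  edge of \<open>\<phi>\<close> is reversed.
\<close>

lemma chain_cost_push_expand:
  assumes "flow_chain X \<phi>" "flow_chain X C" "\<And>e. C e \<noteq> 0 \<Longrightarrow> \<phi> e \<noteq> 0"
    and "\<And>e. 0 < \<phi> e \<Longrightarrow> 0 \<le> \<phi> e + t * C e"
  shows "chain_cost \<alpha> (\<lambda>e. \<phi> e + t * C e) = (\<Sum>e | \<phi> e > 0. (\<phi> e + t * C e) powr \<alpha> * dist (fst e) (snd e))"
proof -
  have fin: "finite {e. \<phi> e > 0}" by (rule finite_subset[OF _ flow_chainD(1)[OF assms(1)]]) auto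
  have "chain_cost \<alpha> (\<lambda>e. \<phi> e + t * C e) =
      (\<Sum>e | \<phi> e > 0. max 0 (\<phi> e + t * C e) powr \<alpha> * dist (fst e) (snd e))"
  proof (rule chain_cost_eq_sum[OF fin])
    fix e assume e: "0 < \<phi> e + t * C e"
    obtain u v where uv: "e = (u, v)" by force
    have "\<phi> e \<noteq> 0"
    proof
      assume "\<phi> e = 0"
      moreover from this have "C e = 0" using assms(3)[of e] by blast
      ultimately show False using e by simp
    qed
    \<comment> \<open>A negative coefficient means that the reversed edge is positive, and that one
      is assumed not to change sign.\<close>
    moreover have "\<not> \<phi> e < 0"
    proof
      assume "\<phi> e < 0"
      then have "0 \<le> \<phi> (v, u) + t * C (v, u)"
        using assms(4)[of "(v, u)"] flow_chainD(3)[OF assms(1), of v u] uv by simp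
      with e show False
        using flow_chainD(3)[OF assms(1), of v u] flow_chainD(3)[OF assms(2), of v u] uv by simp
    qed
    ultimately show "e \<in> {e. \<phi> e > 0}" by simp
  qed
  also have "\<dots> = (\<Sum>e | \<phi> e > 0. (\<phi> e + t * C e) powr \<alpha> * dist (fst e) (snd e))"
    using assms(4) by (intro sum.cong) (auto simp: max_def)
  finally show ?thesis .
qed

lemma chain_cost_push_concave:
  assumes "flow_chain X \<phi>" "flow_chain X C" "\<And>e. C e \<noteq> 0 \<Longrightarrow> \<phi> e \<noteq> 0"
    and "0 < t1" "0 < t2" "0 \<le> \<alpha>" "\<alpha> < 1"
    and "\<And>e. 0 < \<phi> e \<Longrightarrow> 0 \<le> \<phi> e - t1 * C e" "\<And>e. 0 < \<phi> e \<Longrightarrow> 0 \<le> \<phi> e + t2 * C e"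
  shows "t2 * chain_cost \<alpha> (\<lambda>e. \<phi> e - t1 * C e) + t1 * chain_cost \<alpha> (\<lambda>e. \<phi> e + t2 * C e)
           \<le> (t1 + t2) * chain_cost \<alpha> \<phi>"
    and "0 < \<phi> e0 \<Longrightarrow> \<phi> e0 + t2 * C e0 = 0 \<Longrightarrow>
      t2 * chain_cost \<alpha> (\<lambda>e. \<phi> e - t1 * C e) + t1 * chain_cost \<alpha> (\<lambda>e. \<phi> e + t2 * C e)
           < (t1 + t2) * chain_cost \<alpha> \<phi>"
proof -
  have fin: "finite {e. \<phi> e > 0}" by (rule finite_subset[OF _ flow_chainD(1)[OF assms(1)]]) auto
  have a: "chain_cost \<alpha> (\<lambda>e. \<phi> e - t1 * C e) = (\<Sum>e | \<phi> e > 0. (\<phi> e - t1 * C e) powr \<alpha> * dist (fst e) (snd e))"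
    using chain_cost_push_expand[of X \<phi> C "- t1" \<alpha>] assms by simp
  have b: "chain_cost \<alpha> (\<lambda>e. \<phi> e + t2 * C e) = (\<Sum>e | \<phi> e > 0. (\<phi> e + t2 * C e) powr \<alpha> * dist (fst e) (snd e))"
    using chain_cost_push_expand[of X \<phi> C t2 \<alpha>] assms by simp
  have eq: "t2 * chain_cost \<alpha> (\<lambda>e. \<phi> e - t1 * C e) + t1 * chain_cost \<alpha> (\<lambda>e. \<phi> e + t2 * C e)
     = (\<Sum>e | \<phi> e > 0. (t2 * (\<phi> e - t1 * C e) powr \<alpha> + t1 * (\<phi> e + t2 * C e) powr \<alpha>) * dist (fst e) (snd e))"
    unfolding a b by (simp add: sum_distrib_left sum.distrib algebra_simps)
  have eq2: "(t1 + t2) * chain_cost \<alpha> \<phi> = (\<Sum>e | \<phi> e > 0. ((t1 + t2) * \<phi> e powr \<alpha>) * dist (fst e) (snd e))"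
    by (simp add: chain_cost_def sum_distrib_left mult.assoc)
  have le: "(t2 * (\<phi> e - t1 * C e) powr \<alpha> + t1 * (\<phi> e + t2 * C e) powr \<alpha>) * dist (fst e) (snd e)
      \<le> ((t1 + t2) * \<phi> e powr \<alpha>) * dist (fst e) (snd e)" if "\<phi> e > 0" for e
    using that assms by (intro mult_right_mono powr_push_concave) auto
  show "t2 * chain_cost \<alpha> (\<lambda>e. \<phi> e - t1 * C e) + t1 * chain_cost \<alpha> (\<lambda>e. \<phi> e + t2 * C e)
           \<le> (t1 + t2) * chain_cost \<alpha> \<phi>"
    unfolding eq eq2 using le by (intro sum_mono) auto
  assume e0: "0 < \<phi> e0" "\<phi> e0 + t2 * C e0 = 0"
  \<comment> \<open>A flow chain vanishes on the diagonal, so the dying edge has positive length and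
    the strict inequality survives the factor \<open>dist\<close>.\<close>
  have "fst e0 \<noteq> snd e0"
    using e0 flow_chainD(4)[OF assms(1), of "fst e0"] by (cases e0) auto
  then have "(t2 * (\<phi> e0 - t1 * C e0) powr \<alpha> + t1 * (\<phi> e0 + t2 * C e0) powr \<alpha>) * dist (fst e0) (snd e0)
      < ((t1 + t2) * \<phi> e0 powr \<alpha>) * dist (fst e0) (snd e0)"
    using e0 assms by (intro mult_strict_right_mono powr_push_strict) auto
  then show "t2 * chain_cost \<alpha> (\<lambda>e. \<phi> e - t1 * C e) + t1 * chain_cost \<alpha> (\<lambda>e. \<phi> e + t2 * C e)
           < (t1 + t2) * chain_cost \<alpha> \<phi>"
    unfolding eq eq2 using le e0 by (intro sum_strict_mono_ex1[OF fin] ballI bexI[of _ e0]) auto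
qed

section \<open>Admissible step lengths\<close>

text \<open>The ratio test of the simplex method: the step is the least of the quotients at which a
  decreasing coordinate reaches 0.\<close>

lemma maximal_step:
  fixes p c :: "'i \<Rightarrow> real"
  assumes "finite I" "\<And>i. i \<in> I \<Longrightarrow> 0 < p i" "i0 \<in> I" "c i0 < 0"
  shows "\<exists>t>0. (\<forall>i\<in>I. 0 \<le> p i + t * c i) \<and> (\<exists>i\<in>I. p i + t * c i = 0)"
proof -
  let ?J = "{i \<in> I. c i < 0}"
  define t where "t = Min ((\<lambda>i. p i / (- c i)) ` ?J)"
  have J: "finite ?J" "?J \<noteq> {}" using assms by auto
  have "t \<in> (\<lambda>i. p i / (- c i)) ` ?J" unfolding t_def using J by (intro Min_in) auto
  then obtain i where i: "i \<in> ?J" "t = p i / (- c i)" by auto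
  then have t: "0 < t" using assms by (simp add: divide_pos_neg)
  have "\<exists>i\<in>I. p i + t * c i = 0" using i by (intro bexI[of _ i]) auto
  moreover have "0 \<le> p j + t * c j" if "j \<in> I" for j
  proof (cases "c j < 0")
    case True
    then have "t \<le> p j / (- c j)" unfolding t_def using J that by (intro Min_le) auto
    then show ?thesis using True by (simp add: field_simps)
  next
    case False
    then show ?thesis using t assms(2)[OF that] by simp
  qed
  ultimately show ?thesis using t by blast
qed

lemma small_step:
  fixes p c :: "'i \<Rightarrow> real"
  assumes "finite I" "\<And>i. i \<in> I \<Longrightarrow> 0 < p i"
  shows "\<exists>t>0. \<forall>i\<in>I. 0 \<le> p i - t * c i"
proof (cases "\<exists>i\<in>I. 0 < c i")
  case True
  then obtain i0 where "i0 \<in> I" "- c i0 < 0" by auto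
  from maximal_step[of I p i0 "\<lambda>i. - c i", OF assms this] show ?thesis by auto
next
  case False
  have "0 \<le> p i - 1 * c i" if "i \<in> I" for i
    using False that assms(2)[OF that] by (smt (verit, best))
  then show ?thesis by (intro exI[of _ 1]) auto
qed

section \<open>Chains with free sources\<close>

text \<open>
  \<open>outflow \<phi> v + b v\<close> is the mass that \<open>\<phi>\<close> has to be supplied with at \<open>v\<close> in order to transport
  it to \<open>b\<close>.
\<close>

definition allocation_chains :: "'a set \<Rightarrow> 'a set \<Rightarrow> ('a \<Rightarrow> real) \<Rightarrow> ('a \<times> 'a \<Rightarrow> real) set" where
  "allocation_chains X R b = {\<phi>. flow_chain X \<phi> \<and> (\<forall>v. 0 \<le> outflow \<phi> v + b v) \<and>
     (\<forall>v. v \<notin> R \<longrightarrow> outflow \<phi> v + b v = 0)}"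

definition sources :: "('a \<Rightarrow> real) \<Rightarrow> ('a \<times> 'a \<Rightarrow> real) \<Rightarrow> 'a set" where
  "sources b \<phi> = {v. 0 < outflow \<phi> v + b v}"

definition minimal_chain ::
    "real \<Rightarrow> 'a::real_normed_vector set \<Rightarrow> 'a set \<Rightarrow> ('a \<Rightarrow> real) \<Rightarrow> ('a \<times> 'a \<Rightarrow> real) \<Rightarrow> bool" where
  "minimal_chain \<alpha> X R b \<phi> \<longleftrightarrow> \<phi> \<in> allocation_chains X R b \<and>
     (\<forall>\<psi>\<in>allocation_chains X R b. chain_cost \<alpha> \<phi> \<le> chain_cost \<alpha> \<psi>)"

text \<open>
  \<open>rigid_on {} \<phi>\<close> means that the support of \<open>\<phi>\<close> is a forest, and \<open>rigid_on Z \<phi>\<close> that moreover every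
  tree of it contains at most one point of \<open>Z\<close>.
\<close>

definition rigid_on :: "'a set \<Rightarrow> ('a \<times> 'a \<Rightarrow> real) \<Rightarrow> bool" where
  "rigid_on Z \<phi> \<longleftrightarrow> (\<forall>C. flow_chain UNIV C \<longrightarrow> (\<forall>e. C e \<noteq> 0 \<longrightarrow> \<phi> e \<noteq> 0) \<longrightarrow>
     (\<forall>v. v \<notin> Z \<longrightarrow> outflow C v = 0) \<longrightarrow> (\<forall>e. C e = 0))"

lemma rigid_onD:
  "rigid_on Z \<phi> \<Longrightarrow> flow_chain UNIV C \<Longrightarrow> (\<And>e. C e \<noteq> 0 \<Longrightarrow> \<phi> e \<noteq> 0) \<Longrightarrow>
    (\<And>v. v \<notin> Z \<Longrightarrow> outflow C v = 0) \<Longrightarrow> C e = 0"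
  unfolding rigid_on_def by blast

lemma rigid_on_mono: "rigid_on Z \<phi> \<Longrightarrow> Z' \<subseteq> Z \<Longrightarrow> rigid_on Z' \<phi>"
  unfolding rigid_on_def by blast

lemma allocation_chainsD:
  assumes "\<phi> \<in> allocation_chains X R b"
  shows "flow_chain X \<phi>" "0 \<le> outflow \<phi> v + b v" "v \<notin> R \<Longrightarrow> outflow \<phi> v + b v = 0"
    "sources b \<phi> \<subseteq> R"
  using assms unfolding allocation_chains_def sources_def
  by (blast, blast, blast, force)

lemma flow_chain_support:
  assumes "flow_chain X \<phi>" "flow_chain UNIV C" "\<And>e. C e \<noteq> 0 \<Longrightarrow> \<phi> e \<noteq> 0"
  shows "flow_chain X C"
proof -
  have "{e. C e \<noteq> 0} \<subseteq> X \<times> X"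
    using assms(3) flow_chainD(2)[OF assms(1)] by (force simp: mem_Times_iff)
  then show ?thesis
    using assms(2) unfolding flow_chain_def by blast
qed

lemma push_in_allocation_chains:
  assumes "\<phi> \<in> allocation_chains X R b" "flow_chain UNIV C" "\<And>e. C e \<noteq> 0 \<Longrightarrow> \<phi> e \<noteq> 0"
    and "\<And>v. v \<notin> R \<Longrightarrow> outflow C v = 0"
    and "\<And>v. 0 \<le> outflow \<phi> v + b v + t * outflow C v"
  shows "(\<lambda>e. \<phi> e + t * C e) \<in> allocation_chains X R b"
    and "outflow (\<lambda>e. \<phi> e + t * C e) v = outflow \<phi> v + t * outflow C v"
proof -
  have C: "flow_chain X C"
    by (rule flow_chain_support[OF allocation_chainsD(1)[OF assms(1)] assms(2,3)])
  have out: "outflow (\<lambda>e. \<phi> e + t * C e) v = outflow \<phi> v + t * outflow C v" for v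
    using outflow_lincomb[OF allocation_chainsD(1)[OF assms(1)] C, of 1 t v] by simp
  then show "outflow (\<lambda>e. \<phi> e + t * C e) v = outflow \<phi> v + t * outflow C v" .
  have "flow_chain X (\<lambda>e. \<phi> e + t * C e)"
    using flow_chain_lincomb[OF allocation_chainsD(1)[OF assms(1)] C, of 1 t] by simp
  moreover have "0 \<le> outflow (\<lambda>e. \<phi> e + t * C e) v + b v" for v
    using assms(5)[of v] by (simp add: out)
  moreover have "outflow (\<lambda>e. \<phi> e + t * C e) v + b v = 0" if "v \<notin> R" for v
    using assms(4)[OF that] allocation_chainsD(3)[OF assms(1) that] by (simp add: out)
  ultimately show "(\<lambda>e. \<phi> e + t * C e) \<in> allocation_chains X R b"
    unfolding allocation_chains_def by blast
qed

text \<open>Normalizes the witness of nonrigidity: antisymmetry moves it to a positively oriented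
  edge, and a change of sign makes that edge shrink, which is what \<open>maximal_step\<close> asks
  for.\<close>

lemma nonrigid_has_shrinking_chain:
  assumes "flow_chain X \<phi>" "\<not> rigid_on Z \<phi>"
  obtains C e where "flow_chain UNIV C" "\<And>e. C e \<noteq> 0 \<Longrightarrow> \<phi> e \<noteq> 0"
    "\<And>v. v \<notin> Z \<Longrightarrow> outflow C v = 0" "0 < \<phi> e" "C e < 0"
proof -
  obtain C e where C: "flow_chain UNIV C" "\<And>e. C e \<noteq> 0 \<Longrightarrow> \<phi> e \<noteq> 0"
    "\<And>v. v \<notin> Z \<Longrightarrow> outflow C v = 0" "C e \<noteq> 0"
    using assms(2) unfolding rigid_on_def by blast
  obtain u v where e: "e = (u, v)" by force
  have "\<exists>e. 0 < \<phi> e \<and> C e \<noteq> 0"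
  proof (cases "0 < \<phi> e")
    case False
    then have "0 < \<phi> (v, u)" "C (v, u) \<noteq> 0"
      using C(2)[OF C(4)] C(4) flow_chainD(3)[OF assms(1), of v u] flow_chainD(3)[OF C(1), of v u] e
      by auto
    then show ?thesis by blast
  qed (use C in blast)
  then obtain e where e: "0 < \<phi> e" "C e \<noteq> 0" by blast
  show thesis
  proof (cases "C e < 0")
    case True
    then show ?thesis using that C e by blast
  next
    case False
    show ?thesis
    proof (rule that[of "\<lambda>e. - 1 * C e" e])
      show "flow_chain UNIV (\<lambda>e. - 1 * C e)" by (rule flow_chain_scale[OF C(1)])
      show "\<phi> e \<noteq> 0" if "- 1 * C e \<noteq> 0" for e using that C(2)[of e] by simp
      show "outflow (\<lambda>e. - 1 * C e) v = 0" if "v \<notin> Z" for v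
        using C(3)[OF that] outflow_scale[OF C(1), of "- 1" v] by simp
    qed (use e False in auto)
  qed
qed

text \<open>
  Pushing until an edge or a source disappears terminates in a rigid chain; one of the two
  directions does not increase the cost.
\<close>

lemma reduction_step:
  assumes "\<phi> \<in> allocation_chains X R b" "finite R" "\<not> rigid_on (sources b \<phi>) \<phi>" "0 \<le> \<alpha>" "\<alpha> < 1"
  obtains \<psi> where "\<psi> \<in> allocation_chains X R b" "chain_cost \<alpha> \<psi> \<le> chain_cost \<alpha> \<phi>"
    "card {e. \<psi> e \<noteq> 0} + card (sources b \<psi>) < card {e. \<phi> e \<noteq> 0} + card (sources b \<phi>)"
proof -
  have \<phi>: "flow_chain X \<phi>" using allocation_chainsD(1)[OF assms(1)] .
  obtain C e0 where C: "flow_chain UNIV C" "\<And>e. C e \<noteq> 0 \<Longrightarrow> \<phi> e \<noteq> 0"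
    "\<And>v. v \<notin> sources b \<phi> \<Longrightarrow> outflow C v = 0" "0 < \<phi> e0" "C e0 < 0"
    using nonrigid_has_shrinking_chain[OF \<phi> assms(3)] by blast
  have CX: "flow_chain X C" by (rule flow_chain_support[OF \<phi> C(1,2)])
  \<comment> \<open>Edge flows and source supplies are the coordinates that must stay nonnegative;
    one ratio test treats both kinds.\<close>
  define I where "I = Inl ` {e. 0 < \<phi> e} \<union> Inr ` sources b \<phi>"
  define p where "p = case_sum \<phi> (\<lambda>v. outflow \<phi> v + b v)"
  define c where "c = case_sum C (outflow C)"
  have finE: "finite {e. \<phi> e \<noteq> 0}" by (rule flow_chainD(1)[OF \<phi>])
  have finS: "finite (sources b \<phi>)"
    by (rule finite_subset[OF allocation_chainsD(4)[OF assms(1)] assms(2)])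
  have I: "finite I" "\<And>i. i \<in> I \<Longrightarrow> 0 < p i"
  proof -
    have "finite {e. 0 < \<phi> e}" by (rule finite_subset[OF _ finE]) auto
    then show "finite I" using finS by (simp add: I_def)
    show "\<And>i. i \<in> I \<Longrightarrow> 0 < p i" by (auto simp: I_def p_def sources_def)
  qed
  have i0: "Inl e0 \<in> I" "c (Inl e0) < 0" using C by (auto simp: I_def c_def)
  have shrink: "(\<lambda>e. \<phi> e + t * C e) \<in> allocation_chains X R b \<and>
      card {e. \<phi> e + t * C e \<noteq> 0} + card (sources b (\<lambda>e. \<phi> e + t * C e)) < card {e. \<phi> e \<noteq> 0} + card (sources b \<phi>)"
    if t: "\<And>i. i \<in> I \<Longrightarrow> 0 \<le> p i + t * c i" "\<exists>i\<in>I. p i + t * c i = 0" for t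
  proof -
    have nn: "0 \<le> outflow \<phi> v + b v + t * outflow C v" for v
    proof (cases "v \<in> sources b \<phi>")
      case True
      then show ?thesis using t(1)[of "Inr v"] by (simp add: I_def p_def c_def)
    next
      case False
      then show ?thesis using C(3)[OF False] allocation_chainsD(2)[OF assms(1), of v] by simp
    qed
    have offR: "outflow C v = 0" if "v \<notin> R" for v
      using C(3)[of v] that allocation_chainsD(4)[OF assms(1)] by blast
    note push = push_in_allocation_chains[OF assms(1) C(1,2) offR nn]
    \<comment> \<open>Neither support can grow because \<open>C\<close> lives on the edges of \<phi>
      and has outflow only at its sources; the coordinate that reaches 0 makes one of the two
      strictly smaller.\<close>
    have subE: "{e. \<phi> e + t * C e \<noteq> 0} \<subseteq> {e. \<phi> e \<noteq> 0}" using C(2) by fastforce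
    have subS: "sources b (\<lambda>e. \<phi> e + t * C e) \<subseteq> sources b \<phi>"
    proof
      fix v assume v: "v \<in> sources b (\<lambda>e. \<phi> e + t * C e)"
      show "v \<in> sources b \<phi>"
        using v C(3)[of v] push(2)[of v] by (cases "v \<in> sources b \<phi>") (auto simp: sources_def)
    qed
    obtain i where i: "i \<in> I" "p i + t * c i = 0" using t(2) by blast
    have "{e. \<phi> e + t * C e \<noteq> 0} \<subset> {e. \<phi> e \<noteq> 0} \<or> sources b (\<lambda>e. \<phi> e + t * C e) \<subset> sources b \<phi>"
    proof (cases i)
      case (Inl e)
      then have "e \<in> {e. \<phi> e \<noteq> 0} - {e. \<phi> e + t * C e \<noteq> 0}"
        using i by (auto simp: I_def p_def c_def)
      then show ?thesis using subE by blast
    next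
      case (Inr v)
      then have "v \<in> sources b \<phi>" "v \<notin> sources b (\<lambda>e. \<phi> e + t * C e)"
        using i push(2)[of v] by (auto simp: I_def p_def c_def sources_def)
      then show ?thesis using subS by blast
    qed
    then have "card {e. \<phi> e + t * C e \<noteq> 0} < card {e. \<phi> e \<noteq> 0} \<or>
        card (sources b (\<lambda>e. \<phi> e + t * C e)) < card (sources b \<phi>)"
      using psubset_card_mono[OF finE] psubset_card_mono[OF finS] by blast
    then show ?thesis
      using push(1) card_mono[OF finE subE] card_mono[OF finS subS] by linarith
  qed
  obtain t2 where t2: "0 < t2" "\<forall>i\<in>I. 0 \<le> p i + t2 * c i" "\<exists>i\<in>I. p i + t2 * c i = 0"
    using maximal_step[of I p "Inl e0" c, OF I i0] by blast
  have e2: "0 \<le> \<phi> e + t2 * C e" if "0 < \<phi> e" for e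
    using bspec[OF t2(2), of "Inl e"] that by (simp add: I_def p_def c_def)
  show thesis
  \<comment> \<open>The opposite push is limited only if some coordinate is increased by
    \<open>C\<close>. Otherwise \<open>C\<close> raises no edge flow, and monotonicity alone bounds
    the cost.\<close>
  proof (cases "\<exists>i\<in>I. 0 < c i")
    case True
    then obtain i1 where i1: "i1 \<in> I" "- c i1 < 0" by auto
    obtain t1 where t1: "0 < t1" "\<forall>i\<in>I. 0 \<le> p i + t1 * - c i" "\<exists>i\<in>I. p i + t1 * - c i = 0"
      using maximal_step[of I p i1 "\<lambda>i. - c i", OF I i1] by blast
    have e1: "0 \<le> \<phi> e - t1 * C e" if "0 < \<phi> e" for e
      using bspec[OF t1(2), of "Inl e"] that by (simp add: I_def p_def c_def)
    have *: "t2 * chain_cost \<alpha> (\<lambda>e. \<phi> e - t1 * C e) + t1 * chain_cost \<alpha> (\<lambda>e. \<phi> e + t2 * C e)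
           \<le> (t1 + t2) * chain_cost \<alpha> \<phi>"
      by (rule chain_cost_push_concave(1)[OF \<phi> CX C(2) t1(1) t2(1) assms(4,5) e1 e2])
    \<comment> \<open>A weighted mean of the two end costs is at most the old cost, so they cannot
      both exceed it.\<close>
    have "chain_cost \<alpha> (\<lambda>e. \<phi> e - t1 * C e) \<le> chain_cost \<alpha> \<phi> \<or> chain_cost \<alpha> (\<lambda>e. \<phi> e + t2 * C e) \<le> chain_cost \<alpha> \<phi>"
    proof (rule ccontr)
      assume "\<not> ?thesis"
      then have "t2 * chain_cost \<alpha> \<phi> < t2 * chain_cost \<alpha> (\<lambda>e. \<phi> e - t1 * C e)"
        "t1 * chain_cost \<alpha> \<phi> < t1 * chain_cost \<alpha> (\<lambda>e. \<phi> e + t2 * C e)"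
        using t1 t2 by auto
      with * show False by (simp add: algebra_simps)
    qed
    then show thesis
    proof
      assume "chain_cost \<alpha> (\<lambda>e. \<phi> e - t1 * C e) \<le> chain_cost \<alpha> \<phi>"
      with that[of "\<lambda>e. \<phi> e + - t1 * C e"] shrink[of "- t1"] t1 show thesis by simp
    next
      assume "chain_cost \<alpha> (\<lambda>e. \<phi> e + t2 * C e) \<le> chain_cost \<alpha> \<phi>"
      with that[of "\<lambda>e. \<phi> e + t2 * C e"] shrink[of t2] t2 show thesis by simp
    qed
  next
    case False
    have expand: "chain_cost \<alpha> (\<lambda>e. \<phi> e + t2 * C e) =
        (\<Sum>e | 0 < \<phi> e. (\<phi> e + t2 * C e) powr \<alpha> * dist (fst e) (snd e))"
      by (rule chain_cost_push_expand[OF \<phi> CX C(2) e2])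
    have "chain_cost \<alpha> (\<lambda>e. \<phi> e + t2 * C e) \<le> chain_cost \<alpha> \<phi>"
      unfolding expand chain_cost_def[of \<alpha> \<phi>]
    proof (intro sum_mono mult_right_mono powr_mono2)
      fix e assume "e \<in> {e. 0 < \<phi> e}"
      then have e: "0 < \<phi> e" by simp
      then have "\<not> 0 < c (Inl e)" using False by (auto simp: I_def)
      then have "C e \<le> 0" by (simp add: c_def)
      then show "0 \<le> \<phi> e + t2 * C e" "\<phi> e + t2 * C e \<le> \<phi> e"
        using e2[OF e] t2(1) by (auto simp: mult_le_0_iff)
    qed (use assms in auto)
    with that[of "\<lambda>e. \<phi> e + t2 * C e"] shrink[of t2] t2 show thesis by simp
  qed
qed

lemma reduce_to_rigid:
  assumes "\<phi> \<in> allocation_chains X R b" "finite R" "0 \<le> \<alpha>" "\<alpha> < 1"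
  shows "\<exists>\<psi> \<in> allocation_chains X R b. chain_cost \<alpha> \<psi> \<le> chain_cost \<alpha> \<phi> \<and> rigid_on (sources b \<psi>) \<psi>"
  using assms(1)
proof (induction "card {e. \<phi> e \<noteq> 0} + card (sources b \<phi>)" arbitrary: \<phi> rule: less_induct)
  case less
  show ?case
  proof (cases "rigid_on (sources b \<phi>) \<phi>")
    case True
    then show ?thesis using less.prems by blast
  next
    case False
    obtain \<psi> where "\<psi> \<in> allocation_chains X R b" "chain_cost \<alpha> \<psi> \<le> chain_cost \<alpha> \<phi>"
      "card {e. \<psi> e \<noteq> 0} + card (sources b \<psi>) < card {e. \<phi> e \<noteq> 0} + card (sources b \<phi>)"
      using reduction_step[OF less.prems assms(2) False assms(3,4)] by blast
    with less.hyps[of \<psi>] show ?thesis by (meson order_trans)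
  qed
qed

text \<open>
  A minimal chain cannot be pushed in both directions if on one side an edge disappears: that
  is where concavity is strict, for \<open>\<alpha> = 0\<close> as well.
\<close>

lemma minimal_chain_no_push:
  assumes "minimal_chain \<alpha> X R b \<phi>" "finite R" "0 \<le> \<alpha>" "\<alpha> < 1"
    and "flow_chain UNIV C" "\<And>e. C e \<noteq> 0 \<Longrightarrow> \<phi> e \<noteq> 0" "0 < \<phi> e0" "C e0 < 0"
    and "\<And>v. v \<notin> R \<Longrightarrow> outflow C v = 0"
    and "\<And>v. 0 < outflow C v \<Longrightarrow> v \<in> sources b \<phi>"
    and "\<And>t v. 0 < t \<Longrightarrow> (\<And>e. 0 < \<phi> e \<Longrightarrow> 0 \<le> \<phi> e + t * C e) \<Longrightarrow> 0 \<le> outflow \<phi> v + b v + t * outflow C v"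
  shows False
proof -
  have mem: "\<phi> \<in> allocation_chains X R b"
    and min: "\<And>\<psi>. \<psi> \<in> allocation_chains X R b \<Longrightarrow> chain_cost \<alpha> \<phi> \<le> chain_cost \<alpha> \<psi>"
    using assms(1) by (auto simp: minimal_chain_def)
  have \<phi>: "flow_chain X \<phi>" using allocation_chainsD(1)[OF mem] .
  have CX: "flow_chain X C" by (rule flow_chain_support[OF \<phi> assms(5,6)])
  have finE: "finite {e. 0 < \<phi> e}" by (rule finite_subset[OF _ flow_chainD(1)[OF \<phi>]]) auto
  have finS: "finite (sources b \<phi>)"
    by (rule finite_subset[OF allocation_chainsD(4)[OF mem] assms(2)])
  have e0: "e0 \<in> {e. 0 < \<phi> e}" using assms by simp
  \<comment> \<open>The forward step is dictated by the edges alone; the last hypothesis guarantees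
    that supplies stay nonnegative as long as edge flows do.\<close>
  obtain t2 where t2: "0 < t2" "\<And>e. 0 < \<phi> e \<Longrightarrow> 0 \<le> \<phi> e + t2 * C e"
    "\<exists>e. 0 < \<phi> e \<and> \<phi> e + t2 * C e = 0"
    using maximal_step[of "{e. 0 < \<phi> e}" \<phi> e0 C, OF finE _ e0 assms(8)] by auto
  obtain e1 where e1: "0 < \<phi> e1" "\<phi> e1 + t2 * C e1 = 0" using t2(3) by blast
  obtain s1 where s1: "0 < s1" "\<And>e. 0 < \<phi> e \<Longrightarrow> 0 \<le> \<phi> e - s1 * C e"
    using small_step[of "{e. 0 < \<phi> e}" \<phi> C, OF finE] by auto
  \<comment> \<open>Pushing backwards lowers the supply only where \<open>outflow C\<close> is
    positive, and those vertices are sources, whose supply has some slack.\<close>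
  obtain s2 where s2: "0 < s2" "\<And>v. v \<in> sources b \<phi> \<Longrightarrow> 0 \<le> (outflow \<phi> v + b v) - s2 * outflow C v"
    using small_step[of "sources b \<phi>" "\<lambda>v. outflow \<phi> v + b v" "outflow C", OF finS]
    by (auto simp: sources_def)
  define t1 where "t1 = min s1 s2"
  have t1: "0 < t1" using s1 s2 by (simp add: t1_def)
  have shorter: "0 \<le> p - t1 * c" if "0 \<le> p" "0 \<le> p - s * c" "t1 \<le> s" for p c s :: real
  proof (cases "0 \<le> c")
    case True
    then have "t1 * c \<le> s * c" using that by (intro mult_right_mono) auto
    then show ?thesis using that by linarith
  next
    case False
    then have "t1 * c \<le> 0" using t1 by (simp add: mult_le_0_iff)
    then show ?thesis using that by linarith
  qed
  have t1e: "0 \<le> \<phi> e - t1 * C e" if "0 < \<phi> e" for e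
    using s1(2)[of e] that by (intro shorter[of _ s1]) (auto simp: t1_def)
  have t1v: "0 \<le> outflow \<phi> v + b v + (- t1) * outflow C v" for v
  proof (cases "0 < outflow C v")
    case True
    then show ?thesis
      using s2(2)[OF assms(10)[OF True]] allocation_chainsD(2)[OF mem, of v]
        shorter[of "outflow \<phi> v + b v" s2 "outflow C v"] by (simp add: t1_def)
  next
    case False
    then have "0 \<le> - t1 * outflow C v" using t1 by (simp add: mult_le_0_iff)
    then show ?thesis using allocation_chainsD(2)[OF mem, of v] by linarith
  qed
  have "(\<lambda>e. \<phi> e + (- t1) * C e) \<in> allocation_chains X R b"
    by (rule push_in_allocation_chains(1)[OF mem assms(5,6,9) t1v])
  then have k1: "chain_cost \<alpha> \<phi> \<le> chain_cost \<alpha> (\<lambda>e. \<phi> e - t1 * C e)" using min by simp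
  have "(\<lambda>e. \<phi> e + t2 * C e) \<in> allocation_chains X R b"
  proof (rule push_in_allocation_chains(1)[OF mem assms(5,6,9)])
    show "0 \<le> outflow \<phi> v + b v + t2 * outflow C v" for v
      by (rule assms(11)[OF t2(1)]) (rule t2(2))
  qed
  then have k2: "chain_cost \<alpha> \<phi> \<le> chain_cost \<alpha> (\<lambda>e. \<phi> e + t2 * C e)" using min by simp
  have "t2 * chain_cost \<alpha> (\<lambda>e. \<phi> e - t1 * C e) + t1 * chain_cost \<alpha> (\<lambda>e. \<phi> e + t2 * C e)
           < (t1 + t2) * chain_cost \<alpha> \<phi>"
    by (rule chain_cost_push_concave(2)[OF \<phi> CX assms(6) t1 t2(1) assms(3,4) t1e t2(2) e1])
  moreover have "t2 * chain_cost \<alpha> \<phi> \<le> t2 * chain_cost \<alpha> (\<lambda>e. \<phi> e - t1 * C e)"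
    "t1 * chain_cost \<alpha> \<phi> \<le> t1 * chain_cost \<alpha> (\<lambda>e. \<phi> e + t2 * C e)"
    using k1 k2 t1 t2 by auto
  ultimately show False by (simp add: algebra_simps)
qed

text \<open>A circulation has zero outflow, so pushing along it leaves all supplies alone and only
  edges limit the step.\<close>

lemma minimal_chain_rigid:
  assumes "minimal_chain \<alpha> X R b \<phi>" "finite R" "0 \<le> \<alpha>" "\<alpha> < 1"
  shows "rigid_on {} \<phi>"
proof (rule ccontr)
  assume nr: "\<not> rigid_on {} \<phi>"
  have mem: "\<phi> \<in> allocation_chains X R b" using assms(1) by (auto simp: minimal_chain_def)
  obtain C e0 where C: "flow_chain UNIV C" "\<And>e. C e \<noteq> 0 \<Longrightarrow> \<phi> e \<noteq> 0"
    "\<And>v. v \<notin> {} \<Longrightarrow> outflow C v = 0" "0 < \<phi> e0" "C e0 < 0"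
    using nonrigid_has_shrinking_chain[OF allocation_chainsD(1)[OF mem] nr] by blast
  show False
    by (rule minimal_chain_no_push[OF assms C(1,2,4,5)]) (use C(3) allocation_chainsD(2)[OF mem] in auto)
qed

section \<open>Walks\<close>

definition flow_rel :: "('a \<times> 'a \<Rightarrow> real) \<Rightarrow> ('a \<times> 'a) set" where
  "flow_rel \<phi> = {e. 0 < \<phi> e}"

definition steps :: "'a list \<Rightarrow> ('a \<times> 'a) set" where
  "steps p = set (zip p (tl p))"

lemma steps_simps [simp]:
  "steps [] = {}" "steps [u] = {}" "steps (u # v # p) = insert (u, v) (steps (v # p))"
  by (auto simp: steps_def)

lemma finite_steps [simp]: "finite (steps p)"
  by (simp add: steps_def)

lemma steps_subset: "steps p \<subseteq> set p \<times> set p"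
  by (induction p rule: induct_list012) auto

lemma steps_append:
  "steps (p @ u # q) = steps (p @ [u]) \<union> steps (u # q)"
  by (induction p rule: induct_list012) auto

section \<open>Chains carried by lists of vertices\<close>

lemma segment_chain_support: "segment_chain e p \<noteq> 0 \<Longrightarrow> p = e \<or> p = prod.swap e"
  by (simp add: segment_chain_def split: if_split_asm)

lemma segment_chain_swap: "segment_chain e (prod.swap p) = - segment_chain e p"
proof -
  have "prod.swap p = e \<longleftrightarrow> p = prod.swap e" "prod.swap p = prod.swap e \<longleftrightarrow> p = e"
    by (metis swap_swap)+
  then show ?thesis by (simp only: segment_chain_def minus_diff_eq)
qed

lemma segment_chain_of_bool:
  assumes "prod.swap p \<noteq> e"
  shows "segment_chain e p = of_bool (p = e)"
proof -
  have "p \<noteq> prod.swap e" using assms by (metis swap_swap)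
  then show ?thesis by (simp add: segment_chain_def)
qed

lemma segment_chain_flow_chain: "u \<in> X \<Longrightarrow> v \<in> X \<Longrightarrow> flow_chain X (segment_chain (u, v))"
proof -
  assume X: "u \<in> X" "v \<in> X"
  have sub: "{e. segment_chain (u, v) e \<noteq> 0} \<subseteq> {(u, v), (v, u)}"
    using segment_chain_support[of "(u, v)"] by auto
  have "segment_chain (u, v) (b, a) = - segment_chain (u, v) (a, b)" for a b
    using segment_chain_swap[of "(u, v)" "(a, b)"] by simp
  moreover have "finite {e. segment_chain (u, v) e \<noteq> 0}" by (rule finite_subset[OF sub]) simp
  moreover have "{e. segment_chain (u, v) e \<noteq> 0} \<subseteq> X \<times> X" using sub X by auto
  ultimately show ?thesis unfolding flow_chain_def by blast
qed

lemma outflow_segment_chain: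
  "outflow (segment_chain (u, v)) w = of_bool (w = u) - of_bool (w = v)"
proof -
  have "outflow (segment_chain (u, v)) w = (\<Sum>z\<in>{u, v}. segment_chain (u, v) (w, z))"
    by (rule outflow_eq_sum) (auto simp: segment_chain_def split: if_splits)
  also have "\<dots> = of_bool (w = u) - of_bool (w = v)"
  proof (cases "u = v")
    case True
    then show ?thesis by (simp add: segment_chain_def)
  next
    case False
    then show ?thesis by (cases "w = u"; cases "w = v") (auto simp: segment_chain_def)
  qed
  finally show ?thesis .
qed

lemma curve_chain_simps [simp]:
  "curve_chain [] = (\<lambda>e. 0)" "curve_chain [u] = (\<lambda>e. 0)"
  "curve_chain (u # v # p) = (\<lambda>e. segment_chain (u, v) e + curve_chain (v # p) e)"
  by (auto simp: curve_chain_def sum.lessThan_Suc_shift simp del: sum.lessThan_Suc)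

lemma curve_chain_flow_chain: "set p \<subseteq> X \<Longrightarrow> flow_chain X (curve_chain p)"
proof (induction p rule: induct_list012)
  case (3 u v p)
  then have "flow_chain X (segment_chain (u, v))" "flow_chain X (curve_chain (v # p))"
    by (auto intro: segment_chain_flow_chain)
  then show ?case by (simp add: flow_chain_add)
qed (simp_all add: flow_chain_zero)

lemma outflow_curve_chain:
  "p \<noteq> [] \<Longrightarrow> outflow (curve_chain p) w = of_bool (w = hd p) - of_bool (w = last p)"
proof (induction p rule: induct_list012)
  case (3 u v p)
  have "flow_chain UNIV (segment_chain (u, v))" "flow_chain UNIV (curve_chain (v # p))"
    by (auto intro: segment_chain_flow_chain curve_chain_flow_chain)
  from outflow_lincomb[OF this, of 1 1 w] show ?case
    using 3 by (simp add: outflow_segment_chain)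
qed simp_all

lemma curve_chain_support: "curve_chain p e \<noteq> 0 \<Longrightarrow> e \<in> steps p \<or> prod.swap e \<in> steps p"
  by (induction p rule: induct_list012) (auto simp: segment_chain_def split: if_splits)

lemma steps_head_notin: "distinct (u # p) \<Longrightarrow> (u, w) \<notin> steps p \<and> (w, u) \<notin> steps p"
  using steps_subset[of p] by auto

lemma curve_chain_distinct:
  "distinct p \<Longrightarrow> curve_chain p e = of_bool (e \<in> steps p) - of_bool (prod.swap e \<in> steps p)"
proof (induction p rule: induct_list012)
  case (3 u v p)
  have "(u, v) \<notin> steps (v # p)" "(v, u) \<notin> steps (v # p)" "u \<noteq> v"
    using steps_head_notin[OF 3(3)] 3(3) by auto
  then show ?case using 3 by (cases e) (auto simp: segment_chain_def)
qed simp_all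

lemma successively_steps: "successively P p \<longleftrightarrow> (\<forall>(u, v)\<in>steps p. P u v)"
  by (induction p rule: induct_list012) auto

section \<open>Walks along the flow\<close>

definition walk :: "('a \<times> 'a) set \<Rightarrow> 'a list \<Rightarrow> bool" where
  "walk D p \<longleftrightarrow> p \<noteq> [] \<and> steps p \<subseteq> D"

lemma rtrancl_walk:
  assumes "(u, v) \<in> D\<^sup>*"
  shows "\<exists>p. walk D p \<and> hd p = u \<and> last p = v"
  using assms
proof (induction rule: converse_rtrancl_induct)
  case base
  show ?case by (intro exI[of _ "[v]"]) (simp add: walk_def)
next
  case (step u w)
  then obtain p where "walk D p" "hd p = w" "last p = v" by blast
  then show ?case using step(1)
    by (intro exI[of _ "u # p"]) (cases p; auto simp: walk_def)
qed

lemma walk_rtrancl: "walk D p \<Longrightarrow> w \<in> set p \<Longrightarrow> (hd p, w) \<in> D\<^sup>* \<and> (w, last p) \<in> D\<^sup>*"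
proof (induction p arbitrary: w rule: induct_list012)
  case (3 u v p)
  then have uv: "(u, v) \<in> D" and w: "walk D (v # p)" by (auto simp: walk_def)
  have "(v, last (v # p)) \<in> D\<^sup>*" using 3(2)[OF w, of v] by simp
  then show ?case
    using 3(2)[OF w] 3(4) uv by (auto intro: converse_rtrancl_into_rtrancl)
qed (auto simp: walk_def)

lemma walk_distinct:
  assumes "acyclic D" "walk D p"
  shows "distinct p"
  using assms(2)
proof (induction p rule: induct_list012)
  case (3 u v p)
  then have uv: "(u, v) \<in> D" and w: "walk D (v # p)" by (auto simp: walk_def)
  have "u \<noteq> z" if "z \<in> set (v # p)" for z
  proof
    assume "u = z"
    then have "(v, u) \<in> D\<^sup>*" using walk_rtrancl[OF w that] by simp
    then have "(u, u) \<in> D\<^sup>+" using uv by (rule rtrancl_into_trancl2[rotated])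
    then show False using assms(1) by (auto simp: acyclic_def)
  qed
  then show ?case using 3(2)[OF w] by auto
qed simp_all

text \<open>A walk along the flow never traverses the reverse of a positive edge, so its steps
  cannot cancel even if the walk repeats vertices.\<close>

lemma walk_curve_chain_pos:
  assumes "flow_chain X \<phi>" "walk (flow_rel \<phi>) p" "e \<in> flow_rel \<phi>"
  shows "of_bool (e \<in> steps p) \<le> curve_chain p e"
  using assms(2)
proof (induction p rule: induct_list012)
  case (3 u v p)
  have "prod.swap e \<noteq> (u, v)"
  proof
    assume "prod.swap e = (u, v)"
    then have "e = (v, u)" by (cases e) simp
    moreover have "0 < \<phi> (u, v)" using 3(3) by (simp add: walk_def flow_rel_def)
    ultimately show False
      using assms(3) flow_chainD(3)[OF assms(1), of v u] by (simp add: flow_rel_def)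
  qed
  then have "segment_chain (u, v) e = of_bool (e = (u, v))" by (rule segment_chain_of_bool)
  moreover have "of_bool (e \<in> steps (v # p)) \<le> curve_chain (v # p) e"
    using 3 by (auto simp: walk_def)
  ultimately show ?case by (auto simp: of_bool_def split: if_splits)
qed (auto simp: walk_def)

lemma walk_curve_chain_support:
  assumes "flow_chain X \<phi>" "walk (flow_rel \<phi>) p" "curve_chain p e \<noteq> 0"
  shows "\<phi> e \<noteq> 0"
proof -
  have "\<phi> e > 0 \<or> \<phi> (prod.swap e) > 0"
    using curve_chain_support[OF assms(3)] assms(2) by (auto simp: walk_def flow_rel_def)
  then show ?thesis using flow_chainD(3)[OF assms(1), of "fst e" "snd e"] by (cases e) auto
qed

text \<open>The chain of a closed walk is a circulation on the support of \<phi>, hence zero by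
  rigidity, while any step would contribute at least 1.\<close>

lemma closed_walk_trivial:
  assumes "flow_chain X \<phi>" "rigid_on {} \<phi>" "walk (flow_rel \<phi>) p" "hd p = last p"
  shows "steps p = {}"
proof (rule ccontr)
  assume "steps p \<noteq> {}"
  then obtain e where e: "e \<in> steps p" by blast
  then have "e \<in> flow_rel \<phi>" using assms(3) by (auto simp: walk_def)
  with walk_curve_chain_pos[OF assms(1,3) this] e have "1 \<le> curve_chain p e" by simp
  moreover have "curve_chain p e = 0"
  proof (rule rigid_onD[OF assms(2)])
    show "flow_chain UNIV (curve_chain p)" by (simp add: curve_chain_flow_chain)
    show "outflow (curve_chain p) v = 0" for v
      using assms(3,4) outflow_curve_chain[of p v] by (simp add: walk_def)
  qed (rule walk_curve_chain_support[OF assms(1,3)])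
  ultimately show False by simp
qed

lemma rigid_acyclic:
  assumes "flow_chain X \<phi>" "rigid_on {} \<phi>"
  shows "acyclic (flow_rel \<phi>)"
proof (rule acyclicI, rule allI, rule notI)
  fix u assume "(u, u) \<in> (flow_rel \<phi>)\<^sup>+"
  then obtain v where uv: "(u, v) \<in> flow_rel \<phi>" "(v, u) \<in> (flow_rel \<phi>)\<^sup>*"
    using tranclD by metis
  then obtain p where p: "walk (flow_rel \<phi>) p" "hd p = v" "last p = u"
    using rtrancl_walk[OF uv(2)] by blast
  have "p = v # tl p" using p(1,2) by (simp add: walk_def flip: p(2))
  then have "steps (u # p) = insert (u, v) (steps p)" by (metis steps_simps(3))
  then have "walk (flow_rel \<phi>) (u # p)" "hd (u # p) = last (u # p)" "steps (u # p) \<noteq> {}"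
    using p uv by (simp_all add: walk_def)
  with closed_walk_trivial[OF assms] show False by blast
qed

text \<open>The head of a duplicate-free list has just one outgoing step, which determines the next
  vertex.\<close>

lemma distinct_eq_by_steps:
  assumes "distinct (u # p)" "distinct (u # q)" "steps (u # p) = steps (u # q)"
  shows "p = q"
  using assms
proof (induction p arbitrary: u q)
  case Nil
  then show ?case by (cases q) auto
next
  case (Cons v p)
  then obtain w q' where q: "q = w # q'" by (cases q) auto
  have "(u, v) \<notin> steps (w # q')" "(u, w) \<notin> steps (v # p)"
    using steps_head_notin[of u "w # q'"] steps_head_notin[of u "v # p"] Cons.prems q by auto
  with Cons.prems q have vw: "v = w" by auto
  then have "steps (v # p) = steps (v # q')"
    using Cons.prems(3) q \<open>(u, v) \<notin> steps (w # q')\<close> \<open>(u, w) \<notin> steps (v # p)\<close> by auto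
  then have "p = q'" using Cons q vw by auto
  then show ?case using q vw by simp
qed

text \<open>Two walks with common ends differ by a circulation, which rigidity kills; equal chains
  of walks along the flow have equal sets of steps.\<close>

lemma rigid_walk_unique:
  assumes "flow_chain X \<phi>" "rigid_on {} \<phi>"
    and "walk (flow_rel \<phi>) p" "walk (flow_rel \<phi>) q" "hd p = hd q" "last p = last q"
  shows "p = q"
proof -
  have d: "distinct p" "distinct q"
    using walk_distinct[OF rigid_acyclic[OF assms(1,2)]] assms by auto
  have fc: "flow_chain UNIV (curve_chain p)" "flow_chain UNIV (curve_chain q)"
    by (simp_all add: curve_chain_flow_chain)
  have "1 * curve_chain p e + (- 1) * curve_chain q e = 0" for e
  proof (rule rigid_onD[OF assms(2) flow_chain_lincomb[OF fc]])
    show "outflow (\<lambda>e. 1 * curve_chain p e + (- 1) * curve_chain q e) v = 0" for v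
      unfolding outflow_lincomb[OF fc] using assms by (simp add: outflow_curve_chain walk_def)
    show "\<phi> e \<noteq> 0" if "1 * curve_chain p e + (- 1) * curve_chain q e \<noteq> 0" for e
    proof -
      have "curve_chain p e \<noteq> 0 \<or> curve_chain q e \<noteq> 0" using that by auto
      then show ?thesis
        using walk_curve_chain_support[OF assms(1,3)] walk_curve_chain_support[OF assms(1,4)] by blast
    qed
  qed
  then have eq: "curve_chain p e = curve_chain q e" for e by (simp add: algebra_simps)
  have "steps p' \<subseteq> steps q'" if "walk (flow_rel \<phi>) p'" "distinct p'" "distinct q'"
      "\<And>e. curve_chain p' e = curve_chain q' e" for p' q'
  proof
    fix e assume e: "e \<in> steps p'"
    then have "e \<in> flow_rel \<phi>" using that by (auto simp: walk_def)
    then have "1 \<le> curve_chain q' e"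
      using walk_curve_chain_pos[OF assms(1) that(1), of e] e that(4)[of e] by simp
    then show "e \<in> steps q'" using curve_chain_distinct[OF that(3), of e] by (auto split: if_splits simp: of_bool_def)
  qed
  from this[OF assms(3) d eq] this[OF assms(4) d(2,1) eq[symmetric]]
  have "steps p = steps q" by blast
  moreover obtain u p' q' where "p = u # p'" "q = u # q'"
    using assms by (cases p; cases q) (auto simp: walk_def)
  ultimately show ?thesis using distinct_eq_by_steps d by metis
qed

section \<open>Sources of rigid chains\<close>

lemma flow_rel_finite: "flow_chain X \<phi> \<Longrightarrow> finite (flow_rel \<phi>)"
  unfolding flow_rel_def by (rule finite_subset[OF _ flow_chainD(1)]) auto

lemma flow_rel_swap: "flow_chain X \<phi> \<Longrightarrow> e \<in> flow_rel \<phi> \<Longrightarrow> prod.swap e \<notin> flow_rel \<phi>"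
  using flow_chainD(3)[of X \<phi> "snd e" "fst e"] by (cases e) (simp add: flow_rel_def)

text \<open>Going upstream comes to an end, because the flow relation is finite and acyclic.\<close>

lemma root_exists:
  assumes "flow_chain X \<phi>" "rigid_on {} \<phi>"
  shows "\<exists>r. (r, v) \<in> (flow_rel \<phi>)\<^sup>* \<and> (\<forall>u. \<phi> (u, r) \<le> 0)"
proof -
  have "wf (flow_rel \<phi>)"
    by (rule finite_acyclic_wf[OF flow_rel_finite[OF assms(1)] rigid_acyclic[OF assms]])
  then show ?thesis
  proof (induction v rule: wf_induct_rule)
    case (less v)
    show ?case
    proof (cases "\<exists>u. 0 < \<phi> (u, v)")
      case True
      then obtain u where u: "(u, v) \<in> flow_rel \<phi>" by (auto simp: flow_rel_def)
      then show ?thesis using less[OF u] by (meson rtrancl.rtrancl_into_rtrancl)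
    next
      case False
      then show ?thesis by (intro exI[of _ v]) (auto simp: not_less)
    qed
  qed
qed

text \<open>A vertex without inflow must itself supply everything it sends out, and its own
  demand.\<close>

lemma root_is_source:
  assumes "flow_chain X \<phi>" "\<And>u. \<phi> (u, r) \<le> 0" "0 \<le> b r" "\<phi> (r, w) \<noteq> 0 \<or> 0 < b r"
  shows "r \<in> sources b \<phi>"
proof -
  have nn: "0 \<le> \<phi> (r, u)" for u
    using assms(2)[of u] flow_chainD(3)[OF assms(1), of r u] by simp
  have "0 \<le> outflow \<phi> r" unfolding outflow_def by (intro sum_nonneg nn)
  moreover have "0 < outflow \<phi> r" if "\<phi> (r, w) \<noteq> 0"
    unfolding outflow_def using that nn
    by (intro sum_pos2[OF flow_chain_finite_row[OF assms(1)], of w]) (auto simp: less_le)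
  ultimately show ?thesis using assms(3,4) by (auto simp: sources_def)
qed

text \<open>The alternatives express that \<open>v\<close> takes part in the transport: it supplies,
  demands or touches an edge. The root upstream either is \<open>v\<close> itself or sends flow
  out.\<close>

lemma root_source_exists:
  assumes "flow_chain X \<phi>" "rigid_on {} \<phi>" "\<And>v. 0 \<le> b v"
    and "v \<in> sources b \<phi> \<or> 0 < b v \<or> \<phi> (v, w) \<noteq> 0"
  shows "\<exists>r. r \<in> sources b \<phi> \<and> (r, v) \<in> (flow_rel \<phi>)\<^sup>* \<and> (\<forall>u. \<phi> (u, r) \<le> 0)"
proof -
  obtain r where r: "(r, v) \<in> (flow_rel \<phi>)\<^sup>*" "\<And>u. \<phi> (u, r) \<le> 0"
    using root_exists[OF assms(1,2), of v] by blast
  have "r \<in> sources b \<phi>"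
  proof (cases "r = v")
    case True
    show ?thesis
    proof (cases "v \<in> sources b \<phi>")
      case False
      show ?thesis
        by (rule root_is_source[OF assms(1) r(2) assms(3), where w = w]) (use assms(4) False True in auto)
    qed (use True in simp)
  next
    case False
    then obtain z where "(r, z) \<in> flow_rel \<phi>" using r(1) by (meson converse_rtranclE)
    then have "\<phi> (r, z) \<noteq> 0" by (simp add: flow_rel_def)
    then show ?thesis using root_is_source[where b = b and w = z, OF assms(1) r(2) assms(3)] by blast
  qed
  with r show ?thesis by blast
qed

definition unique_sources :: "('a \<Rightarrow> real) \<Rightarrow> ('a \<times> 'a \<Rightarrow> real) \<Rightarrow> bool" where
  "unique_sources b \<phi> \<longleftrightarrow> (\<forall>r\<in>sources b \<phi>. \<forall>s\<in>sources b \<phi>. \<forall>v.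
     (r, v) \<in> (flow_rel \<phi>)\<^sup>* \<longrightarrow> (s, v) \<in> (flow_rel \<phi>)\<^sup>* \<longrightarrow> r = s)"

lemma unique_sourcesD:
  "unique_sources b \<phi> \<Longrightarrow> r \<in> sources b \<phi> \<Longrightarrow> s \<in> sources b \<phi> \<Longrightarrow> (r, v) \<in> (flow_rel \<phi>)\<^sup>* \<Longrightarrow>
    (s, v) \<in> (flow_rel \<phi>)\<^sup>* \<Longrightarrow> r = s"
  unfolding unique_sources_def by blast

section \<open>Moving supply between sources\<close>

lemma rtrancl_chain:
  assumes "flow_chain X \<phi>" "(r, v) \<in> (flow_rel \<phi>)\<^sup>*"
  shows "\<exists>C. flow_chain UNIV C \<and> (\<forall>e. C e \<noteq> 0 \<longrightarrow> \<phi> e \<noteq> 0) \<and>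
    (\<forall>w. outflow C w = of_bool (w = r) - of_bool (w = v))"
proof -
  obtain p where p: "walk (flow_rel \<phi>) p" "hd p = r" "last p = v"
    using rtrancl_walk[OF assms(2)] by blast
  show ?thesis
  proof (intro exI[of _ "curve_chain p"] conjI allI impI)
    show "flow_chain UNIV (curve_chain p)" by (simp add: curve_chain_flow_chain)
    show "outflow (curve_chain p) w = of_bool (w = r) - of_bool (w = v)" for w
      using p outflow_curve_chain[of p w] by (simp add: walk_def)
  qed (rule walk_curve_chain_support[OF assms(1) p(1)])
qed

text \<open>Follows the walk from \<open>s\<close> to the meeting point and the one from
  \<open>r\<close> backwards; pushing along this chain moves supply from \<open>r\<close> to
  \<open>s\<close>.\<close>

lemma two_walks_chain:
  assumes "flow_chain X \<phi>" "(r, v) \<in> (flow_rel \<phi>)\<^sup>*" "(s, v) \<in> (flow_rel \<phi>)\<^sup>*"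
  shows "\<exists>C. flow_chain UNIV C \<and> (\<forall>e. C e \<noteq> 0 \<longrightarrow> \<phi> e \<noteq> 0) \<and>
    (\<forall>w. outflow C w = of_bool (w = s) - of_bool (w = r))"
proof -
  obtain A where A: "flow_chain UNIV A" "\<And>e. A e \<noteq> 0 \<Longrightarrow> \<phi> e \<noteq> 0"
    "\<And>w. outflow A w = of_bool (w = r) - of_bool (w = v)"
    using rtrancl_chain[OF assms(1,2)] by blast
  obtain B where B: "flow_chain UNIV B" "\<And>e. B e \<noteq> 0 \<Longrightarrow> \<phi> e \<noteq> 0"
    "\<And>w. outflow B w = of_bool (w = s) - of_bool (w = v)"
    using rtrancl_chain[OF assms(1,3)] by blast
  show ?thesis
  proof (intro exI conjI allI impI)
    show "flow_chain UNIV (\<lambda>e. (- 1) * A e + 1 * B e)" by (rule flow_chain_lincomb[OF A(1) B(1)])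
    show "\<phi> e \<noteq> 0" if "(- 1) * A e + 1 * B e \<noteq> 0" for e
    proof -
      have "A e \<noteq> 0 \<or> B e \<noteq> 0" using that by auto
      then show ?thesis using A(2) B(2) by blast
    qed
    show "outflow (\<lambda>e. (- 1) * A e + 1 * B e) w = of_bool (w = s) - of_bool (w = r)" for w
      unfolding outflow_lincomb[OF A(1) B(1)] by (simp add: A(3) B(3))
  qed
qed

text \<open>
  Mass is moved away from a root: the supply of a root is at least the flow on any edge leaving it,
  so an edge disappears before the supply becomes negative.
\<close>

lemma minimal_chain_no_root_transfer:
  assumes "minimal_chain \<alpha> X R b \<phi>" "finite R" "0 \<le> \<alpha>" "\<alpha> < 1" "\<And>v. 0 \<le> b v"
    and "r \<in> sources b \<phi>" "\<And>u. \<phi> (u, r) \<le> 0" "z \<in> sources b \<phi>" "z \<noteq> r"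
    and "flow_chain UNIV C" "\<And>e. C e \<noteq> 0 \<Longrightarrow> \<phi> e \<noteq> 0"
    and "\<And>w. outflow C w = of_bool (w = z) - of_bool (w = r)"
  shows False
proof -
  have mem: "\<phi> \<in> allocation_chains X R b" using assms(1) by (auto simp: minimal_chain_def)
  have \<phi>: "flow_chain X \<phi>" using allocation_chainsD(1)[OF mem] .
  have nn: "0 \<le> \<phi> (r, u)" for u
    using assms(7)[of u] flow_chainD(3)[OF \<phi>, of r u] by simp
  have "outflow C r = - 1" using assms(9,12) by simp
  \<comment> \<open>Outflow -1 forces a negative coefficient at \<open>r\<close>; as no flow enters
    the root, it belongs to an edge leaving the root, which is the one that shrinks.\<close>
  then have "\<not> (\<forall>u. 0 \<le> C (r, u))"
    unfolding outflow_def by (smt (verit) sum_nonneg)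
  then obtain u where u: "C (r, u) < 0" by (auto simp: not_le)
  then have u': "0 < \<phi> (r, u)" using nn[of u] assms(11)[of "(r, u)"] by simp
  show False
  proof (rule minimal_chain_no_push[OF assms(1-4) assms(10,11) u' u])
    show "outflow C v = 0" if "v \<notin> R" for v
      using that assms(6,8,12) allocation_chainsD(4)[OF mem] by auto
    show "v \<in> sources b \<phi>" if "0 < outflow C v" for v
      using that assms(8,12) by (auto simp: of_bool_def split: if_splits)
    fix t v assume t: "0 < t" "\<And>e. 0 < \<phi> e \<Longrightarrow> 0 \<le> \<phi> e + t * C e"
    show "0 \<le> outflow \<phi> v + b v + t * outflow C v"
    proof (cases "v = r")
      case True
      let ?U = "{u. \<phi> (r, u) \<noteq> 0}"
      have fin: "finite ?U" by (rule flow_chain_finite_row[OF \<phi>])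
      have "outflow \<phi> r = (\<Sum>u\<in>?U. \<phi> (r, u))" "outflow C r = (\<Sum>u\<in>?U. C (r, u))"
        using assms(11) by (intro outflow_eq_sum[OF fin]; auto)+
      \<comment> \<open>The new outflow of the root is the sum of what is left on its outgoing
        edges, none of which has become negative.\<close>
      then have "outflow \<phi> r + t * outflow C r = (\<Sum>u\<in>?U. \<phi> (r, u) + t * C (r, u))"
        by (simp add: sum.distrib sum_distrib_left)
      also have "\<dots> \<ge> 0"
        using t(2) nn by (intro sum_nonneg) (auto simp: less_le)
      finally show ?thesis using True assms(5)[of r] by simp
    next
      case False
      then show ?thesis
        using assms(12)[of v] t(1) allocation_chainsD(2)[OF mem, of v] by simp
    qed
  qed
qed

text \<open>A supplying vertex need not be a root, so both sources are first replaced by roots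
  upstream. Distinct roots exchange mass through the common vertex; if the roots coincide, mass goes
  from the root to whichever source differs from it.\<close>

lemma minimal_chain_unique_sources:
  assumes "minimal_chain \<alpha> X R b \<phi>" "finite R" "0 \<le> \<alpha>" "\<alpha> < 1" "\<And>v. 0 \<le> b v"
  shows "unique_sources b \<phi>"
  unfolding unique_sources_def
proof (intro ballI allI impI, rule ccontr)
  fix r s v assume rs: "r \<in> sources b \<phi>" "s \<in> sources b \<phi>" "r \<noteq> s"
    "(r, v) \<in> (flow_rel \<phi>)\<^sup>*" "(s, v) \<in> (flow_rel \<phi>)\<^sup>*"
  have \<phi>: "flow_chain X \<phi>" "rigid_on {} \<phi>"
    using assms(1) minimal_chain_rigid[OF assms(1-4)] allocation_chainsD(1) by (auto simp: minimal_chain_def)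
  note contra = minimal_chain_no_root_transfer[OF assms]
  obtain r0 where r0: "r0 \<in> sources b \<phi>" "(r0, r) \<in> (flow_rel \<phi>)\<^sup>*" "\<And>u. \<phi> (u, r0) \<le> 0"
    using root_source_exists[where b = b and v = r, OF \<phi> assms(5)] rs(1) by blast
  obtain s0 where s0: "s0 \<in> sources b \<phi>" "(s0, s) \<in> (flow_rel \<phi>)\<^sup>*" "\<And>u. \<phi> (u, s0) \<le> 0"
    using root_source_exists[where b = b and v = s, OF \<phi> assms(5)] rs(2) by blast
  show False
  proof (cases "r0 = s0")
    case False
    have "(r0, v) \<in> (flow_rel \<phi>)\<^sup>*" "(s0, v) \<in> (flow_rel \<phi>)\<^sup>*"
      using r0 s0 rs by (meson rtrancl_trans)+
    from two_walks_chain[OF \<phi>(1) this] obtain C where "flow_chain UNIV C"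
      "\<And>e. C e \<noteq> 0 \<Longrightarrow> \<phi> e \<noteq> 0" "\<And>w. outflow C w = of_bool (w = s0) - of_bool (w = r0)" by blast
    with contra[OF r0(1,3) s0(1)] False show False by blast
  next
    case True
    obtain z where z: "z \<in> sources b \<phi>" "z \<noteq> r0" "(r0, z) \<in> (flow_rel \<phi>)\<^sup>*"
      using rs(1-3) r0 s0 True by metis
    from two_walks_chain[OF \<phi>(1) z(3) rtrancl_refl] obtain C where "flow_chain UNIV C"
      "\<And>e. C e \<noteq> 0 \<Longrightarrow> \<phi> e \<noteq> 0" "\<And>w. outflow C w = of_bool (w = z) - of_bool (w = r0)" by blast
    with contra[OF r0(1,3) z(1,2)] show False by blast
  qed
qed

text \<open>The danger is a chain running from one source to another. Uniqueness makes the vertices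
  downstream of one source a union of components of the support, and conservation of mass there
  forces the outflow at that source to vanish.\<close>

lemma unique_sources_rigid:
  assumes "\<phi> \<in> allocation_chains X R b" "rigid_on {} \<phi>" "unique_sources b \<phi>" "\<And>v. 0 \<le> b v"
  shows "rigid_on (sources b \<phi>) \<phi>"
  unfolding rigid_on_def
proof (intro allI impI)
  fix C e
  assume C: "flow_chain UNIV C" "\<forall>e. C e \<noteq> 0 \<longrightarrow> \<phi> e \<noteq> 0" "\<forall>v. v \<notin> sources b \<phi> \<longrightarrow> outflow C v = 0"
  have \<phi>: "flow_chain X \<phi>" using allocation_chainsD(1)[OF assms(1)] .
  have "outflow C r = 0" if r: "r \<in> sources b \<phi>" for r
  proof -
    define V where "V = {v. (r, v) \<in> (flow_rel \<phi>)\<^sup>*}"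
    have closed: "u \<in> V \<longleftrightarrow> v \<in> V" if "0 < \<phi> (u, v)" for u v
    proof
      assume "u \<in> V"
      then show "v \<in> V" using that by (auto simp: V_def flow_rel_def intro: rtrancl.rtrancl_into_rtrancl)
    next
      \<comment> \<open>Some source lies upstream of \<open>u\<close>, hence of \<open>v\<close>,
        and by uniqueness it is \<open>r\<close>; this gives closure against the flow.\<close>
      assume v: "v \<in> V"
      have "\<phi> (u, v) \<noteq> 0" using that by simp
      then obtain s where s: "s \<in> sources b \<phi>" "(s, u) \<in> (flow_rel \<phi>)\<^sup>*"
        using root_source_exists[where b = b and v = u and w = v, OF \<phi> assms(2,4)] by blast
      have "(s, v) \<in> (flow_rel \<phi>)\<^sup>*"
        using s(2) that by (auto simp: flow_rel_def intro: rtrancl.rtrancl_into_rtrancl)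
      then have "s = r" using unique_sourcesD[OF assms(3) s(1) r] v by (auto simp: V_def)
      then show "u \<in> V" using s by (simp add: V_def)
    qed
    have closed': "u \<in> V \<longleftrightarrow> v \<in> V" if "C (u, v) \<noteq> 0" for u v
    proof -
      have "\<phi> (u, v) \<noteq> 0" using C(2) that by blast
      then have "0 < \<phi> (u, v) \<or> 0 < \<phi> (v, u)"
        using flow_chainD(3)[OF \<phi>, of v u] by linarith
      then show ?thesis using closed by blast
    qed
    \<comment> \<open>The part of \<open>C\<close> on \<open>V\<close> is again antisymmetric
      because no edge of \<open>C\<close> leaves \<open>V\<close>; its only vertex with possible
      outflow is \<open>r\<close>.\<close>
    define B where "B = (\<lambda>(u, v). if u \<in> V then C (u, v) else 0)"
    have Bz: "B e \<noteq> 0 \<Longrightarrow> C e \<noteq> 0" for e by (cases e) (auto simp: B_def split: if_splits)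
    have B: "flow_chain UNIV B"
      unfolding flow_chain_def
    proof (intro conjI allI)
      show "finite {e. B e \<noteq> 0}"
        by (rule finite_subset[OF _ flow_chainD(1)[OF C(1)]]) (use Bz in blast)
      show "B (v, u) = - B (u, v)" for u v
      proof (cases "C (u, v) = 0")
        case True
        then show ?thesis using flow_chainD(3)[OF C(1), of v u] by (simp add: B_def)
      next
        case False
        then show ?thesis using closed'[OF False] flow_chainD(3)[OF C(1), of v u] by (simp add: B_def)
      qed
    qed simp
    have outB: "outflow B v = (if v \<in> V then outflow C v else 0)" for v
      by (simp add: outflow_def B_def)
    obtain W where W: "finite W" "\<And>e. B e \<noteq> 0 \<Longrightarrow> e \<in> W \<times> W" using flow_chain_verts[OF B] by metis
    have "0 = (\<Sum>v\<in>insert r W. outflow B v)"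
      using sum_outflow[OF B, of "insert r W"] W by fastforce
    also have "\<dots> = (\<Sum>v\<in>insert r W. if v = r then outflow C r else 0)"
    proof (intro sum.cong refl)
      fix v
      have "outflow C v = 0" if "v \<in> V" "v \<noteq> r"
      proof -
        have "v \<notin> sources b \<phi>"
          using unique_sourcesD[OF assms(3) r _ _ rtrancl_refl, of v] that by (auto simp: V_def)
        then show ?thesis using C(3) by blast
      qed
      then show "outflow B v = (if v = r then outflow C r else 0)"
        by (auto simp: outB V_def)
    qed
    also have "\<dots> = outflow C r" using W(1) by (subst sum.delta) auto
    finally show ?thesis by simp
  qed
  then show "C e = 0"
    using C by (intro rigid_onD[OF assms(2) C(1)]) blast+
qed

section \<open>Systems of curves\<close>

definition system_chain :: "'i set \<Rightarrow> ('i \<Rightarrow> real) \<Rightarrow> ('i \<Rightarrow> 'a list) \<Rightarrow> 'a \<times> 'a \<Rightarrow> real" where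
  "system_chain I c P = (\<lambda>e. \<Sum>i\<in>I. c i * curve_chain (P i) e)"

lemma system_chain_flow_chain:
  assumes "\<And>i. i \<in> I \<Longrightarrow> set (P i) \<subseteq> X"
  shows "flow_chain X (system_chain I c P)"
  unfolding system_chain_def using assms by (intro flow_chain_sum curve_chain_flow_chain)

lemma system_chain_nonzero: "system_chain I c P e \<noteq> 0 \<Longrightarrow> \<exists>i\<in>I. curve_chain (P i) e \<noteq> 0"
  unfolding system_chain_def by (metis (no_types, lifting) mult_zero_right sum.neutral)

lemma outflow_system_chain:
  assumes "\<And>i. i \<in> I \<Longrightarrow> P i \<noteq> []"
  shows "outflow (system_chain I c P) v = atoms I c (\<lambda>i. hd (P i)) v - atoms I c (\<lambda>i. last (P i)) v"
proof -
  have "outflow (system_chain I c P) v = (\<Sum>i\<in>I. c i * outflow (curve_chain (P i)) v)"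
    unfolding system_chain_def by (rule outflow_sum) (rule curve_chain_flow_chain[OF subset_UNIV])
  also have "\<dots> = (\<Sum>i\<in>I. (if hd (P i) = v then c i else 0) - (if last (P i) = v then c i else 0))"
    using assms by (intro sum.cong refl) (auto simp: outflow_curve_chain)
  finally show ?thesis by (simp add: sum_subtractf atoms_def)
qed

lemma atoms_nonneg: "(\<And>i. i \<in> I \<Longrightarrow> 0 \<le> c i) \<Longrightarrow> 0 \<le> atoms I c z v"
  unfolding atoms_def by (intro sum_nonneg) auto

lemma atoms_pos:
  assumes "finite I" "\<And>i. i \<in> I \<Longrightarrow> 0 \<le> c i" "i \<in> I" "0 < c i"
  shows "0 < atoms I c z (z i)"
  unfolding atoms_def using assms by (intro sum_pos2[of I i]) auto

lemma atoms_outside: "v \<notin> z ` I \<Longrightarrow> atoms I c z v = 0"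
  unfolding atoms_def by (intro sum.neutral) auto

lemma atoms_support: "{v. atoms I c z v \<noteq> 0} \<subseteq> z ` I"
  using atoms_outside[of _ z I c] by auto

lemma atoms_cong: "(\<And>i. i \<in> I \<Longrightarrow> c i = c' i \<and> z i = z' i) \<Longrightarrow> atoms I c z = atoms I c' z'"
  unfolding atoms_def by (intro ext sum.cong) auto

text \<open>
  Every point of the target is reached from exactly one source, by one curve; the difference of
  \<open>\<phi>\<close> and the system of these curves has no outflow away from the sources, hence vanishes.
\<close>

lemma rigid_decomposition:
  assumes "\<phi> \<in> allocation_chains X R (atoms J n y)" "rigid_on (sources (atoms J n y) \<phi>) \<phi>"
    and "finite J" "\<And>j. j \<in> J \<Longrightarrow> 0 < n j"
  obtains P where "\<And>j. j \<in> J \<Longrightarrow> walk (flow_rel \<phi>) (P j)"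
    "\<And>j. j \<in> J \<Longrightarrow> hd (P j) \<in> sources (atoms J n y) \<phi>" "\<And>j. j \<in> J \<Longrightarrow> last (P j) = y j"
    "\<phi> = system_chain J n P"
proof -
  let ?b = "atoms J n y"
  have \<phi>: "flow_chain X \<phi>" using allocation_chainsD(1)[OF assms(1)] .
  have rigid: "rigid_on {} \<phi>" by (rule rigid_on_mono[OF assms(2)]) simp
  have n: "\<And>j. j \<in> J \<Longrightarrow> 0 \<le> n j" using assms(4) less_imp_le by blast
  have b: "0 \<le> ?b v" for v by (rule atoms_nonneg[OF n])
  have "\<exists>p. walk (flow_rel \<phi>) p \<and> hd p \<in> sources ?b \<phi> \<and> last p = y j" if j: "j \<in> J" for j
  proof -
    have "0 < ?b (y j)" using atoms_pos[of J n j y] assms(3) n j assms(4)[OF j] by blast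
    then obtain r where r: "r \<in> sources ?b \<phi>" "(r, y j) \<in> (flow_rel \<phi>)\<^sup>*"
      using root_source_exists[where b = ?b and v = "y j", OF \<phi> rigid b] by blast
    then show ?thesis using rtrancl_walk[OF r(2)] by blast
  qed
  then obtain P where P: "\<And>j. j \<in> J \<Longrightarrow> walk (flow_rel \<phi>) (P j)"
    "\<And>j. j \<in> J \<Longrightarrow> hd (P j) \<in> sources ?b \<phi>" "\<And>j. j \<in> J \<Longrightarrow> last (P j) = y j" by metis
  have Pne: "\<And>j. j \<in> J \<Longrightarrow> P j \<noteq> []" using P(1) by (auto simp: walk_def)
  have fc: "flow_chain UNIV \<phi>" "flow_chain UNIV (system_chain J n P)"
    using flow_chain_mono[OF \<phi>] by (auto intro: system_chain_flow_chain)
  have "1 * \<phi> e + (- 1) * system_chain J n P e = 0" for e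
  proof (rule rigid_onD[OF assms(2) flow_chain_lincomb[OF fc]])
    fix e assume "1 * \<phi> e + (- 1) * system_chain J n P e \<noteq> 0"
    then consider "\<phi> e \<noteq> 0" | "system_chain J n P e \<noteq> 0" by force
    then show "\<phi> e \<noteq> 0"
    proof cases
      case 2
      then obtain j where "j \<in> J" "curve_chain (P j) e \<noteq> 0"
        using system_chain_nonzero by blast
      then show ?thesis using walk_curve_chain_support[OF \<phi> P(1)] by blast
    qed
  next
    fix v assume v: "v \<notin> sources ?b \<phi>"
    have "outflow \<phi> v = - ?b v"
      using v allocation_chainsD(2)[OF assms(1), of v] by (auto simp: sources_def)
    moreover have "atoms J n (\<lambda>j. hd (P j)) v = 0" using P(2) v by (intro atoms_outside) auto
    moreover have "atoms J n (\<lambda>j. last (P j)) = ?b" using P(3) by (intro atoms_cong) auto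
    ultimately show "outflow (\<lambda>e. 1 * \<phi> e + (- 1) * system_chain J n P e) v = 0"
      using outflow_system_chain[of J P n v] Pne unfolding outflow_lincomb[OF fc] by simp
  qed
  then have "\<phi> = system_chain J n P" by (auto simp: fun_eq_iff)
  with that P show thesis by blast
qed

section \<open>Loads of labelled curves and the cost of placing them\<close>

definition load :: "'i set \<Rightarrow> ('i \<Rightarrow> real) \<Rightarrow> ('i \<Rightarrow> 'v list) \<Rightarrow> 'v \<times> 'v \<Rightarrow> real" where
  "load I c P e = (\<Sum>i\<in>I. if e \<in> steps (P i) then c i else 0)"

text \<open>
  The vertices of the curves are labels, placed in space by \<open>pos\<close>; steps with different labels are
  paid for separately even if they are placed on top of each other.
\<close>

definition system_cost ::
    "real \<Rightarrow> 'i set \<Rightarrow> ('i \<Rightarrow> real) \<Rightarrow> ('i \<Rightarrow> 'v list) \<Rightarrow> ('v \<Rightarrow> 'a::real_normed_vector) \<Rightarrow> real" where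
  "system_cost \<alpha> I c P pos =
     (\<Sum>e\<in>(\<Union>i\<in>I. steps (P i)). load I c P e powr \<alpha> * dist (pos (fst e)) (pos (snd e)))"

lemma load_outside: "e \<notin> (\<Union>i\<in>I. steps (P i)) \<Longrightarrow> load I c P e = 0"
  unfolding load_def by (intro sum.neutral) auto

lemma load_nonneg: "(\<And>i. i \<in> I \<Longrightarrow> 0 \<le> c i) \<Longrightarrow> 0 \<le> load I c P e"
  unfolding load_def by (intro sum_nonneg) auto

lemma load_pos:
  assumes "finite I" "\<And>i. i \<in> I \<Longrightarrow> 0 < c i" "i \<in> I" "e \<in> steps (P i)"
  shows "0 < load I c P e"
  unfolding load_def using assms by (intro sum_pos2[of I i]) (auto intro: less_imp_le)

lemma system_cost_eq_sum:
  assumes "finite E" "(\<Union>i\<in>I. steps (P i)) \<subseteq> E"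
  shows "system_cost \<alpha> I c P pos = (\<Sum>e\<in>E. load I c P e powr \<alpha> * dist (pos (fst e)) (pos (snd e)))"
  unfolding system_cost_def using assms by (intro sum.mono_neutral_left) (auto simp: load_outside)

text \<open>All curves follow the flow, so no edge is used in both directions and the coefficients
  of the curves simply add up.\<close>

lemma load_walks:
  assumes "flow_chain X \<phi>" "\<phi> = system_chain I c P"
    and "\<And>i. i \<in> I \<Longrightarrow> walk (flow_rel \<phi>) (P i)" "\<And>i. i \<in> I \<Longrightarrow> distinct (P i)"
  shows "load I c P e = max 0 (\<phi> e)"
proof (cases "e \<in> flow_rel \<phi>")
  case True
  have "\<phi> e = (\<Sum>i\<in>I. c i * curve_chain (P i) e)"
    unfolding assms(2) system_chain_def by (rule refl)
  also have "\<dots> = load I c P e"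
    unfolding load_def
  proof (intro sum.cong refl)
    fix i assume i: "i \<in> I"
    have "prod.swap e \<notin> steps (P i)"
      using flow_rel_swap[OF assms(1) True] assms(3)[OF i] by (auto simp: walk_def)
    then show "c i * curve_chain (P i) e = (if e \<in> steps (P i) then c i else 0)"
      by (simp add: curve_chain_distinct[OF assms(4)[OF i]])
  qed
  finally show ?thesis using True by (simp add: flow_rel_def)
next
  case False
  have "e \<notin> (\<Union>i\<in>I. steps (P i))"
    using False assms(3) by (auto simp: walk_def)
  then show ?thesis using False by (simp add: load_outside flow_rel_def)
qed

lemma system_cost_walks:
  assumes "flow_chain X \<phi>" "\<phi> = system_chain I c P" "finite I"
    and "\<And>i. i \<in> I \<Longrightarrow> walk (flow_rel \<phi>) (P i)" "\<And>i. i \<in> I \<Longrightarrow> distinct (P i)"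
  shows "system_cost \<alpha> I c P (\<lambda>v. v) = chain_cost \<alpha> \<phi>"
proof -
  have sub: "(\<Union>i\<in>I. steps (P i)) \<subseteq> flow_rel \<phi>" using assms(4) by (auto simp: walk_def)
  have "system_cost \<alpha> I c P (\<lambda>v. v) = (\<Sum>e\<in>flow_rel \<phi>. load I c P e powr \<alpha> * dist (fst e) (snd e))"
    by (rule system_cost_eq_sum[OF flow_rel_finite[OF assms(1)] sub])
  also have "\<dots> = (\<Sum>e\<in>flow_rel \<phi>. max 0 (\<phi> e) powr \<alpha> * dist (fst e) (snd e))"
    by (simp only: load_walks[OF assms(1,2,4,5)])
  also have "\<dots> = chain_cost \<alpha> \<phi>"
    by (rule chain_cost_eq_sum[symmetric, OF flow_rel_finite[OF assms(1)]]) (simp add: flow_rel_def)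
  finally show ?thesis .
qed

lemma map_steps: "steps (map f p) = map_prod f f ` steps p"
  by (induction p rule: induct_list012) auto

text \<open>The labels are distinct, so a sum over the set of labelled steps loses nothing, although
  \<open>f\<close> may place several steps on one segment, even in opposite directions.\<close>

lemma curve_chain_map_distinct:
  assumes "distinct p"
  shows "curve_chain (map f p) q = (\<Sum>e\<in>steps p. segment_chain (map_prod f f e) q)"
  using assms
proof (induction p rule: induct_list012)
  case (3 u v p)
  have "(u, v) \<notin> steps (v # p)" using steps_head_notin[OF 3(3)] by blast
  then show ?case using 3 by simp
qed simp_all

text \<open>The gap between the two costs comes from merging steps placed on one segment and from
  cancelling opposite ones. If there is no gap, no step of positive length is cancelled out, so the
  placed curves follow the resulting flow; this recovers directed curves after labels have
  collided.\<close>

lemma placed_system_cost: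
  fixes pos :: "'v \<Rightarrow> 'a::real_normed_vector"
  assumes "finite I" "\<And>i. i \<in> I \<Longrightarrow> 0 < c i" "\<And>i. i \<in> I \<Longrightarrow> distinct (P i)" "0 \<le> \<alpha>" "\<alpha> < 1"
  defines "\<phi> \<equiv> system_chain I c (\<lambda>i. map pos (P i))"
  shows "chain_cost \<alpha> \<phi> \<le> system_cost \<alpha> I c P pos"
    and "system_cost \<alpha> I c P pos \<le> chain_cost \<alpha> \<phi> \<Longrightarrow> i \<in> I \<Longrightarrow> (u, v) \<in> steps (map pos (P i)) \<Longrightarrow>
           u \<noteq> v \<Longrightarrow> 0 < \<phi> (u, v)"
proof -
  define E where "E = (\<Union>i\<in>I. steps (P i))"
  define g where "g = map_prod pos pos"
  \<comment> \<open>\<open>H q\<close> is the total load placed on \<open>q\<close> before the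
    opposite orientation is subtracted.\<close>
  define H where "H q = (\<Sum>e\<in>{e \<in> E. g e = q}. load I c P e)" for q
  have finE: "finite E" using assms(1) by (simp add: E_def)
  have loadp: "0 < load I c P e" if "e \<in> E" for e
    using that load_pos[of I c] assms(1,2) unfolding E_def by blast
  have Hn: "0 \<le> H q" for q
    unfolding H_def by (intro sum_nonneg) (auto intro: less_imp_le[OF loadp])
  have \<phi>_load: "\<phi> q = (\<Sum>e\<in>E. load I c P e * segment_chain (g e) q)" for q
  proof -
    have "\<phi> q = (\<Sum>i\<in>I. \<Sum>e\<in>E. (if e \<in> steps (P i) then c i else 0) * segment_chain (g e) q)"
      unfolding \<phi>_def system_chain_def
    proof (intro sum.cong refl)
      fix i assume i: "i \<in> I"
      have "c i * curve_chain (map pos (P i)) q = (\<Sum>e\<in>steps (P i). c i * segment_chain (g e) q)"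
        unfolding curve_chain_map_distinct[OF assms(3)[OF i]] g_def by (rule sum_distrib_left)
      also have "\<dots> = (\<Sum>e\<in>E. (if e \<in> steps (P i) then c i else 0) * segment_chain (g e) q)"
        by (rule sum.mono_neutral_cong_left[OF finE]) (use i in \<open>auto simp: E_def\<close>)
      finally show "c i * curve_chain (map pos (P i)) q = \<dots>" .
    qed
    also have "\<dots> = (\<Sum>e\<in>E. \<Sum>i\<in>I. (if e \<in> steps (P i) then c i else 0) * segment_chain (g e) q)"
      by (rule sum.swap)
    also have "\<dots> = (\<Sum>e\<in>E. load I c P e * segment_chain (g e) q)"
      by (simp only: load_def sum_distrib_right)
    finally show ?thesis .
  qed
  have \<phi>_H: "\<phi> q = H q - H (prod.swap q)" for q
  proof -
    have "\<phi> q = (\<Sum>e\<in>E. (if g e = q then load I c P e else 0) - (if g e = prod.swap q then load I c P e else 0))"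
      unfolding \<phi>_load
    proof (intro sum.cong refl)
      fix e
      have "q = prod.swap (g e) \<longleftrightarrow> g e = prod.swap q" by (metis swap_swap)
      moreover have "q = g e \<longleftrightarrow> g e = q" by blast
      ultimately show "load I c P e * segment_chain (g e) q =
          (if g e = q then load I c P e else 0) - (if g e = prod.swap q then load I c P e else 0)"
        by (simp only: segment_chain_def) simp
    qed
    then show ?thesis
      unfolding H_def using finE by (simp add: sum_subtractf sum.inter_filter)
  qed
  have supp: "q \<in> g ` E" if "0 < \<phi> q" for q
  proof (rule ccontr)
    assume "q \<notin> g ` E"
    then have none: "{e \<in> E. g e = q} = {}" by auto
    have "H q = 0" unfolding H_def none by simp
    with \<phi>_H[of q] Hn[of "prod.swap q"] that show False by simp
  qed
  have fingE: "finite (g ` E)" using finE by simp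
  have cost1: "chain_cost \<alpha> \<phi> = (\<Sum>q\<in>g ` E. max 0 (\<phi> q) powr \<alpha> * dist (fst q) (snd q))"
    by (rule chain_cost_eq_sum[OF fingE supp])
  have "system_cost \<alpha> I c P pos = (\<Sum>e\<in>E. load I c P e powr \<alpha> * dist (fst (g e)) (snd (g e)))"
    unfolding system_cost_def E_def[symmetric] g_def by simp
  also have "\<dots> = (\<Sum>q\<in>g ` E. \<Sum>e\<in>{e \<in> E. g e = q}. load I c P e powr \<alpha> * dist (fst (g e)) (snd (g e)))"
    by (rule sum.image_gen[OF finE])
  also have "\<dots> = (\<Sum>q\<in>g ` E. (\<Sum>e\<in>{e \<in> E. g e = q}. load I c P e powr \<alpha>) * dist (fst q) (snd q))"
    by (simp add: sum_distrib_right)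
  finally have cost2: "system_cost \<alpha> I c P pos =
    (\<Sum>q\<in>g ` E. (\<Sum>e\<in>{e \<in> E. g e = q}. load I c P e powr \<alpha>) * dist (fst q) (snd q))" .
  have H_le: "H q powr \<alpha> \<le> (\<Sum>e\<in>{e \<in> E. g e = q}. load I c P e powr \<alpha>)" for q
    unfolding H_def using loadp assms(4,5) by (intro powr_sum_subadditive) (auto intro: less_imp_le)
  have \<phi>_le: "max 0 (\<phi> q) powr \<alpha> \<le> H q powr \<alpha>" for q
    using \<phi>_H[of q] Hn[of q] Hn[of "prod.swap q"] assms(4) by (intro powr_mono2) auto
  have le: "max 0 (\<phi> q) powr \<alpha> * dist (fst q) (snd q)
      \<le> (\<Sum>e\<in>{e \<in> E. g e = q}. load I c P e powr \<alpha>) * dist (fst q) (snd q)" for q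
    using H_le[of q] \<phi>_le[of q] by (intro mult_right_mono) auto
  show "chain_cost \<alpha> \<phi> \<le> system_cost \<alpha> I c P pos"
    unfolding cost1 cost2 by (intro sum_mono le)
  assume ge: "system_cost \<alpha> I c P pos \<le> chain_cost \<alpha> \<phi>"
  assume i: "i \<in> I" "(u, v) \<in> steps (map pos (P i))" "u \<noteq> v"
  from i(2) obtain e where "e \<in> steps (P i)" "(u, v) = g e"
    unfolding map_steps g_def by (rule imageE)
  then have e: "e \<in> E" "g e = (u, v)" using i(1) by (auto simp: E_def)
  then have uv: "(u, v) \<in> g ` E" by (metis image_eqI)
  \<comment> \<open>Every term of the cost of the chain is at most the corresponding term of the
    cost of the system, so equal totals leave no gap at \<open>(u, v)\<close>.\<close>
  have "max 0 (\<phi> (u, v)) powr \<alpha> * dist u v = (\<Sum>e\<in>{e \<in> E. g e = (u, v)}. load I c P e powr \<alpha>) * dist u v"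
  proof (rule ccontr)
    assume "\<not> ?thesis"
    then have "max 0 (\<phi> (u, v)) powr \<alpha> * dist u v < (\<Sum>e\<in>{e \<in> E. g e = (u, v)}. load I c P e powr \<alpha>) * dist u v"
      using le[of "(u, v)"] by simp
    then have "chain_cost \<alpha> \<phi> < system_cost \<alpha> I c P pos"
      unfolding cost1 cost2 by (intro sum_strict_mono_ex1[OF fingE] ballI le bexI[OF _ uv]) simp
    with ge show False by simp
  qed
  then have eq: "max 0 (\<phi> (u, v)) powr \<alpha> = (\<Sum>e\<in>{e \<in> E. g e = (u, v)}. load I c P e powr \<alpha>)"
    using i by simp
  have "0 < (\<Sum>e\<in>{e \<in> E. g e = (u, v)}. load I c P e powr \<alpha>)"
    using e loadp finE by (intro sum_pos2[of _ e]) (auto simp: less_imp_neq[symmetric])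
  \<comment> \<open>Since \<open>0 powr \<alpha> = 0\<close>, a nonzero power shows a nonzero base,
    for \<alpha> = 0 too.\<close>
  then have "max 0 (\<phi> (u, v)) powr \<alpha> \<noteq> 0" using eq by simp
  then show "0 < \<phi> (u, v)" by (auto simp: max_def split: if_splits)
qed

section \<open>Systems of curves meeting in segments\<close>

text \<open>Directed curves in a forest share one contiguous stretch, possibly empty.
  \<open>K\<close> collects the vertices that straightening must keep; \<open>UNIV\<close> stands
  for no restriction on the ends of the stretches.\<close>

definition meeting_in_segments :: "'a set \<Rightarrow> 'i set \<Rightarrow> ('i \<Rightarrow> 'a list) \<Rightarrow> bool" where
  "meeting_in_segments K I P \<longleftrightarrow> (\<forall>i\<in>I. \<forall>j\<in>I. \<exists>a s b a' b'. P i = a @ s @ b \<and> P j = a' @ s @ b' \<and>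
     set (P i) \<inter> set (P j) \<subseteq> set s \<and> (s \<noteq> [] \<longrightarrow> hd s \<in> K \<and> last s \<in> K))"

definition curve_system :: "'a set \<Rightarrow> 'i set \<Rightarrow> ('i \<Rightarrow> 'a) \<Rightarrow> ('i \<Rightarrow> 'a) \<Rightarrow> ('i \<Rightarrow> 'a list) \<Rightarrow> bool" where
  "curve_system X I s t P \<longleftrightarrow> meeting_in_segments UNIV I P \<and>
     (\<forall>i\<in>I. P i \<noteq> [] \<and> distinct (P i) \<and> set (P i) \<subseteq> X \<and> hd (P i) = s i \<and> last (P i) = t i)"

lemma steps_infix: "steps s \<subseteq> steps (a @ s @ b)"
proof -
  have 1: "steps s \<subseteq> steps (s @ b)" by (induction s rule: induct_list012) auto
  have "steps q \<subseteq> steps (a @ q)" for q :: "'a list"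
  proof (induction a)
    case (Cons x a)
    have "steps (a @ q) \<subseteq> steps (x # a @ q)" by (cases "a @ q") auto
    then show ?case using Cons by simp
  qed simp
  then show ?thesis using 1 by blast
qed

lemma walk_infix: "walk D (a @ s @ b) \<Longrightarrow> s \<noteq> [] \<Longrightarrow> walk D s"
  using steps_infix[of s a b] by (auto simp: walk_def)

text \<open>The stretch runs from the first to the last vertex of \<open>p\<close> that lies on
  \<open>q\<close>. Uniqueness of walks forces \<open>q\<close> to take the same route between
  them.\<close>

lemma rigid_walks_meet:
  assumes "flow_chain X \<phi>" "rigid_on {} \<phi>" "walk (flow_rel \<phi>) p" "walk (flow_rel \<phi>) q"
  shows "\<exists>a s b a' b'. p = a @ s @ b \<and> q = a' @ s @ b' \<and> set p \<inter> set q \<subseteq> set s"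
proof (cases "set p \<inter> set q = {}")
  case True
  then show ?thesis
    by (intro exI[of _ p] exI[of _ "[]"] exI[of _ "[]"] exI[of _ q]) auto
next
  case False
  let ?D = "flow_rel \<phi>"
  from False have "\<exists>x\<in>set p. x \<in> set q" by blast
  then obtain a u p1 where p1: "p = a @ u # p1" "u \<in> set q" "\<forall>x\<in>set a. x \<notin> set q"
    using split_list_first_prop[of p "\<lambda>x. x \<in> set q"] by blast
  have "\<exists>x\<in>set (u # p1). x \<in> set q" using p1 by auto
  then obtain m v b where p2: "u # p1 = m @ v # b" "v \<in> set q" "\<forall>x\<in>set b. x \<notin> set q"
    using split_list_last_prop[of "u # p1" "\<lambda>x. x \<in> set q"] by blast
  define s where "s = m @ [v]"
  have s: "hd s = u" "last s = v" "s \<noteq> []" using p2(1) by (cases m; simp add: s_def)+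
  have p: "p = a @ s @ b" using p1(1) p2(1) by (simp add: s_def)
  have sub: "set p \<inter> set q \<subseteq> set s" using p p1(3) p2(3) by auto
  have ws: "walk ?D s" using walk_infix[of ?D a s b] assms(3) p s by simp
  obtain a' q1 where q1: "q = a' @ u # q1" using p1(2) by (meson split_list)
  show ?thesis
  proof (cases "v \<in> set (u # q1)")
    case True
    then obtain m' b' where q2: "u # q1 = m' @ v # b'" by (meson split_list)
    define s' where "s' = m' @ [v]"
    have s': "hd s' = u" "last s' = v" "s' \<noteq> []" using q2(1) by (cases m'; simp add: s'_def)+
    have q: "q = a' @ s' @ b'" using q1 q2 by (simp add: s'_def)
    then have "walk ?D s'" using walk_infix[of ?D a' s' b'] assms(4) s' by simp
    then have "s = s'" using rigid_walk_unique[OF assms(1,2) ws] s s' by simp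
    then show ?thesis using p q sub by blast
  next
    case False
    \<comment> \<open>If \<open>q\<close> met \<open>v\<close> before \<open>u\<close>, going along
      \<open>p\<close> from \<open>u\<close> to \<open>v\<close> and on along \<open>q\<close> to
      \<open>u\<close> would be a closed walk.\<close>
    then have "v \<in> set a'" using p2(2) q1 by auto
    then obtain c d where a': "a' = c @ v # d" by (meson split_list)
    define r where "r = v # d @ [u]"
    have "q = c @ r @ q1" using q1 a' by (simp add: r_def)
    then have wr: "walk ?D r" using walk_infix[of ?D c r q1] assms(4) by (simp add: r_def)
    have "steps (m @ r) = steps (m @ [v]) \<union> steps r"
      using steps_append[of m v "d @ [u]"] by (simp add: r_def)
    then have st: "steps (m @ r) = steps s \<union> steps r" by (simp add: s_def)
    then have "walk ?D (m @ r)" using ws wr by (auto simp: walk_def)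
    moreover have "hd (m @ r) = last (m @ r)"
      using s by (cases m) (auto simp: s_def r_def)
    ultimately have "steps (m @ r) = {}" using closed_walk_trivial[OF assms(1,2)] by blast
    moreover have "steps r \<noteq> {}" by (cases d) (auto simp: r_def)
    ultimately show ?thesis using st by blast
  qed
qed

lemma walks_curve_system:
  assumes "flow_chain X \<phi>" "rigid_on {} \<phi>"
    and "\<And>i. i \<in> I \<Longrightarrow> walk (flow_rel \<phi>) (P i)" "\<And>i. i \<in> I \<Longrightarrow> set (P i) \<subseteq> X"
    and "\<And>i. i \<in> I \<Longrightarrow> hd (P i) = s i" "\<And>i. i \<in> I \<Longrightarrow> last (P i) = t i"
  shows "curve_system X I s t P"
  unfolding curve_system_def meeting_in_segments_def
  using rigid_walks_meet[OF assms(1,2,3,3)] walk_distinct[OF rigid_acyclic[OF assms(1,2)] assms(3)]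
    assms(4-6) assms(3) by (simp add: walk_def)

text \<open>Each ordered pair of curves contributes the two ends of its common stretch, and each
  curve its own two ends. The count depends on the number of curves only, which later bounds the
  number of labels.\<close>

lemma meeting_in_segments_anchors:
  assumes "finite I" "meeting_in_segments UNIV I P"
  obtains K where "finite K" "card K \<le> 2 * (card I)\<^sup>2 + 2 * card I" "meeting_in_segments K I P"
    "\<And>i. i \<in> I \<Longrightarrow> hd (P i) \<in> K \<and> last (P i) \<in> K"
proof -
  define seg where "seg i j s \<longleftrightarrow> (\<exists>a b a' b'. P i = a @ s @ b \<and> P j = a' @ s @ b' \<and>
     set (P i) \<inter> set (P j) \<subseteq> set s)" for i j s
  have "\<forall>i j. \<exists>s. i \<in> I \<longrightarrow> j \<in> I \<longrightarrow> seg i j s"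
  proof (intro allI)
    fix i j
    show "\<exists>s. i \<in> I \<longrightarrow> j \<in> I \<longrightarrow> seg i j s"
    proof (cases "i \<in> I \<and> j \<in> I")
      case True
      then obtain a s b a' b' where "P i = a @ s @ b" "P j = a' @ s @ b'" "set (P i) \<inter> set (P j) \<subseteq> set s"
        using assms(2) unfolding meeting_in_segments_def by metis
      then have "seg i j s" unfolding seg_def by (intro exI conjI)
      then show ?thesis by blast
    qed blast
  qed
  then obtain S where S: "\<And>i j. i \<in> I \<Longrightarrow> j \<in> I \<Longrightarrow> seg i j (S i j)" by metis
  \<comment> \<open>For an empty stretch this picks up the unspecified value \<open>hd []\<close>, a
    harmless extra element that the count already covers.\<close>
  define A where "A = (\<lambda>ij. hd (S (fst ij) (snd ij))) ` (I \<times> I)"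
  define B where "B = (\<lambda>ij. last (S (fst ij) (snd ij))) ` (I \<times> I)"
  define C where "C = (\<lambda>i. hd (P i)) ` I"
  define D where "D = (\<lambda>i. last (P i)) ` I"
  have fin: "finite (I \<times> I)" using assms(1) by simp
  show thesis
  proof (rule that[of "(A \<union> B) \<union> (C \<union> D)"])
    show "finite ((A \<union> B) \<union> (C \<union> D))" using assms(1) by (simp add: A_def B_def C_def D_def)
    have "card A \<le> card (I \<times> I)" "card B \<le> card (I \<times> I)" "card C \<le> card I" "card D \<le> card I"
      unfolding A_def B_def C_def D_def by (rule card_image_le[OF fin] card_image_le[OF assms(1)])+
    then show "card ((A \<union> B) \<union> (C \<union> D)) \<le> 2 * (card I)\<^sup>2 + 2 * card I"
      using card_Un_le[of "A \<union> B" "C \<union> D"] card_Un_le[of A B] card_Un_le[of C D]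
      by (simp add: card_cartesian_product power2_eq_square)
    show "meeting_in_segments ((A \<union> B) \<union> (C \<union> D)) I P"
      unfolding meeting_in_segments_def
    proof (intro ballI)
      fix i j assume ij: "i \<in> I" "j \<in> I"
      have "hd (S i j) \<in> A" "last (S i j) \<in> B" using ij unfolding A_def B_def by force+
      then have "S i j \<noteq> [] \<longrightarrow> hd (S i j) \<in> (A \<union> B) \<union> (C \<union> D) \<and> last (S i j) \<in> (A \<union> B) \<union> (C \<union> D)"
        by blast
      moreover obtain a b a' b' where "P i = a @ S i j @ b" "P j = a' @ S i j @ b'"
        "set (P i) \<inter> set (P j) \<subseteq> set (S i j)"
        using S[OF ij] unfolding seg_def by (elim exE conjE)
      ultimately show "\<exists>a s b a' b'. P i = a @ s @ b \<and> P j = a' @ s @ b' \<and>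
         set (P i) \<inter> set (P j) \<subseteq> set s \<and> (s \<noteq> [] \<longrightarrow> hd s \<in> (A \<union> B) \<union> (C \<union> D) \<and> last s \<in> (A \<union> B) \<union> (C \<union> D))"
        by (intro exI conjI)
    qed
    show "hd (P i) \<in> (A \<union> B) \<union> (C \<union> D) \<and> last (P i) \<in> (A \<union> B) \<union> (C \<union> D)" if "i \<in> I" for i
      using that by (simp add: C_def D_def)
  qed
qed

section \<open>Shortcutting the vertices that are not anchors\<close>

lemma interior_point:
  assumes "v \<in> set s" "hd s \<noteq> v" "last s \<noteq> v"
  obtains a u w b where "s = a @ [u, v, w] @ b"
proof -
  obtain x y where xy: "s = x @ v # y" using assms(1) by (meson split_list)
  have "x \<noteq> []" "y \<noteq> []" using assms xy by auto
  then have "s = butlast x @ [last x, v, hd y] @ tl y" using xy by simp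
  with that show thesis by blast
qed

lemma filter_hd_last:
  assumes "s \<noteq> []" "Q (hd s)" "Q (last s)"
  shows "filter Q s \<noteq> []" "hd (filter Q s) = hd s" "last (filter Q s) = last s"
proof -
  show "filter Q s \<noteq> []" "hd (filter Q s) = hd s" using assms by (cases s; simp)+
  have "s = butlast s @ [last s]" using assms(1) by simp
  then have "filter Q s = filter Q (butlast s) @ [last s]"
    using assms(3) by (metis filter.simps filter_append)
  then show "last (filter Q s) = last s" by simp
qed

text \<open>Deleting \<open>v\<close> from all curves at once keeps the common stretches aligned,
  and their ends survive because they are anchors.\<close>

lemma meeting_in_segments_filter:
  assumes "meeting_in_segments K I P" "v \<notin> K"
  shows "meeting_in_segments K I (\<lambda>i. filter (\<lambda>z. z \<noteq> v) (P i))"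
  unfolding meeting_in_segments_def
proof (intro ballI)
  fix i j assume "i \<in> I" "j \<in> I"
  then obtain a s b a' b' where s: "P i = a @ s @ b" "P j = a' @ s @ b'"
    "set (P i) \<inter> set (P j) \<subseteq> set s" "s \<noteq> [] \<longrightarrow> hd s \<in> K \<and> last s \<in> K"
    using assms(1) unfolding meeting_in_segments_def by metis
  let ?f = "filter (\<lambda>z. z \<noteq> v)"
  have "?f s \<noteq> [] \<longrightarrow> hd (?f s) \<in> K \<and> last (?f s) \<in> K"
  proof
    assume "?f s \<noteq> []"
    then have "s \<noteq> []" by auto
    then have "hd s \<in> K" "last s \<in> K" using s(4) by auto
    moreover from this have "hd s \<noteq> v" "last s \<noteq> v" using assms(2) by blast+
    ultimately show "hd (?f s) \<in> K \<and> last (?f s) \<in> K"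
      using filter_hd_last[of s "\<lambda>z. z \<noteq> v"] \<open>s \<noteq> []\<close> by simp
  qed
  moreover have "?f (P i) = ?f a @ ?f s @ ?f b" "?f (P j) = ?f a' @ ?f s @ ?f b'"
    using s by simp_all
  moreover have "set (?f (P i)) \<inter> set (?f (P j)) \<subseteq> set (?f s)" using s(3) by auto
  ultimately show "\<exists>a s b a' b'. ?f (P i) = a @ s @ b \<and> ?f (P j) = a' @ s @ b' \<and>
      set (?f (P i)) \<inter> set (?f (P j)) \<subseteq> set s \<and> (s \<noteq> [] \<longrightarrow> hd s \<in> K \<and> last s \<in> K)"
    by blast
qed

lemma steps_triple:
  assumes "distinct (a @ [u, v, w] @ b)"
  shows "steps (a @ [u, v, w] @ b) = (steps (a @ [u]) \<union> steps (w # b)) \<union> {(u, v), (v, w)}"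
    and "steps (a @ [u, w] @ b) = (steps (a @ [u]) \<union> steps (w # b)) \<union> {(u, w)}"
    and "e \<in> steps (a @ [u]) \<union> steps (w # b) \<Longrightarrow> e \<noteq> (u, v) \<and> e \<noteq> (v, w) \<and> e \<noteq> (u, w)"
proof -
  show "steps (a @ [u, v, w] @ b) = (steps (a @ [u]) \<union> steps (w # b)) \<union> {(u, v), (v, w)}"
    using steps_append[of a u "v # w # b"] by auto
  show "steps (a @ [u, w] @ b) = (steps (a @ [u]) \<union> steps (w # b)) \<union> {(u, w)}"
    using steps_append[of a u "w # b"] by auto
  show "e \<noteq> (u, v) \<and> e \<noteq> (v, w) \<and> e \<noteq> (u, w)" if "e \<in> steps (a @ [u]) \<union> steps (w # b)"
    using that steps_subset[of "a @ [u]"] steps_subset[of "w # b"] assms by auto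
qed

text \<open>
  Away from the ends of the common segments, all curves through \<open>v\<close> use the same two steps
  \<open>(u, v)\<close> and \<open>(v, w)\<close>, and the triangle inequality and subadditivity allow the shortcut \<open>(u, w)\<close>.
\<close>

lemma shortcut_cost:
  fixes P :: "'i \<Rightarrow> 'a::real_normed_vector list"
  assumes "finite I" "\<And>i. i \<in> I \<Longrightarrow> 0 < c i" "\<And>i. i \<in> I \<Longrightarrow> distinct (P i)"
    and "meeting_in_segments K I P" "v \<notin> K" "0 \<le> \<alpha>" "\<alpha> < 1"
  shows "system_cost \<alpha> I c (\<lambda>i. filter (\<lambda>z. z \<noteq> v) (P i)) (\<lambda>z. z) \<le> system_cost \<alpha> I c P (\<lambda>z. z)"
proof (cases "\<exists>i\<in>I. v \<in> set (P i)")
  case False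
  then have eq: "filter (\<lambda>z. z \<noteq> v) (P i) = P i" if "i \<in> I" for i
    using that by (intro filter_True) auto
  have "load I c (\<lambda>i. filter (\<lambda>z. z \<noteq> v) (P i)) e = load I c P e" for e
    unfolding load_def by (intro sum.cong) (simp_all add: eq)
  then show ?thesis unfolding system_cost_def by (simp add: eq)
next
  case True
  then obtain i0 where i0: "i0 \<in> I" "v \<in> set (P i0)" by blast
  \<comment> \<open>One curve through \<open>v\<close> serves as reference: every curve through
    \<open>v\<close> shares with it a stretch that has \<open>v\<close> in its interior.\<close>
  have common: "\<exists>s a b a' b'. P i0 = a @ s @ b \<and> P j = a' @ s @ b' \<and> v \<in> set s \<and> hd s \<noteq> v \<and> last s \<noteq> v"
    if j: "j \<in> I" "v \<in> set (P j)" for j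
  proof -
    obtain a s b a' b' where s: "P i0 = a @ s @ b" "P j = a' @ s @ b'"
      "set (P i0) \<inter> set (P j) \<subseteq> set s" "s \<noteq> [] \<longrightarrow> hd s \<in> K \<and> last s \<in> K"
      using assms(4) i0(1) j(1) unfolding meeting_in_segments_def by metis
    have "v \<in> set s" using s(3) i0 j by blast
    moreover from this have "s \<noteq> []" by auto
    ultimately show ?thesis using s assms(5) by metis
  qed
  obtain u w where uw: "\<And>j. j \<in> I \<Longrightarrow> v \<in> set (P j) \<Longrightarrow> \<exists>a b. P j = a @ [u, v, w] @ b"
  proof -
    obtain s a b where s: "P i0 = a @ s @ b" "v \<in> set s" "hd s \<noteq> v" "last s \<noteq> v"
      using common[OF i0] by blast
    obtain a0 u w b0 where "s = a0 @ [u, v, w] @ b0" by (rule interior_point[OF s(2-4)])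
    then have P0: "P i0 = (a @ a0 @ [u]) @ v # (w # b0 @ b)" using s(1) by simp
    have "\<exists>a b. P j = a @ [u, v, w] @ b" if j: "j \<in> I" "v \<in> set (P j)" for j
    proof -
      obtain s a1 b1 a' b' where s: "P i0 = a1 @ s @ b1" "P j = a' @ s @ b'"
        "v \<in> set s" "hd s \<noteq> v" "last s \<noteq> v"
        using common[OF j] by blast
      obtain a2 u' w' b2 where s2: "s = a2 @ [u', v, w'] @ b2" by (rule interior_point[OF s(3-5)])
      then have P1: "P i0 = (a1 @ a2 @ [u']) @ v # (w' # b2 @ b1)" using s(1) by simp
      have d: "distinct (P i0)" using assms(3) i0 by blast
      have "(a1 @ a2 @ [u']) @ v # (w' # b2 @ b1) = (a @ a0 @ [u]) @ v # (w # b0 @ b)"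
        using P0 P1 by simp
      moreover have "v \<notin> set (a1 @ a2 @ [u'])" "v \<notin> set (w' # b2 @ b1)"
        using d unfolding P1 by auto
      \<comment> \<open>\<open>v\<close> occurs once in the reference curve, so its two neighbours
        there do not depend on the other curve.\<close>
      ultimately have eq: "a1 @ a2 @ [u'] = a @ a0 @ [u] \<and> w' # b2 @ b1 = w # b0 @ b"
        using append_Cons_eq_iff[of v "a1 @ a2 @ [u']" "w' # b2 @ b1" "a @ a0 @ [u]" "w # b0 @ b"] by blast
      then have "last (a1 @ a2 @ [u']) = last (a @ a0 @ [u])" by (rule arg_cong[OF conjunct1])
      then have "u' = u" "w' = w" using eq by simp_all
      then have "P j = (a' @ a2) @ [u, v, w] @ (b2 @ b')" using s(2) s2 by simp
      then show ?thesis by blast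
    qed
    with that show thesis by blast
  qed
  let ?P = "\<lambda>i. filter (\<lambda>z. z \<noteq> v) (P i)"
  \<comment> \<open>All the load through \<open>v\<close>: it is what \<open>(u, v)\<close> and
    \<open>(v, w)\<close> carry, and it moves to \<open>(u, w)\<close>, which may already carry load
    of curves avoiding \<open>v\<close>.\<close>
  define W where "W = (\<Sum>i\<in>I. if v \<in> set (P i) then c i else 0)"
  have W: "0 \<le> W" unfolding W_def using assms(2) by (intro sum_nonneg) (auto intro: less_imp_le)
  have on: "e \<in> steps (?P i) \<longleftrightarrow> e = (u, w) \<or> (e \<in> steps (P i) \<and> e \<noteq> (u, v) \<and> e \<noteq> (v, w))"
    "(u, v) \<in> steps (P i)" "(v, w) \<in> steps (P i)" "(u, w) \<notin> steps (P i)"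
    "u \<noteq> v" "v \<noteq> w" "u \<noteq> w" "u \<in> set (P i)" "w \<in> set (P i)"
    if i: "i \<in> I" "v \<in> set (P i)" for e i
  proof -
    obtain a b where P: "P i = a @ [u, v, w] @ b" using uw[OF i] by blast
    have d: "distinct (a @ [u, v, w] @ b)" using assms(3)[OF i(1)] P by simp
    have uvw: "u \<noteq> v" "v \<noteq> w" using d by auto
    have "v \<notin> set a" "v \<notin> set b" using d by auto
    moreover from this have "filter (\<lambda>z. z \<noteq> v) a = a" "filter (\<lambda>z. z \<noteq> v) b = b"
      by (auto intro!: filter_True)
    ultimately have P': "?P i = a @ [u, w] @ b" unfolding P using uvw by simp
    show "u \<noteq> v" "v \<noteq> w" "u \<noteq> w" using d by auto
    show "u \<in> set (P i)" "w \<in> set (P i)" using P by auto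
    show "(u, v) \<in> steps (P i)" "(v, w) \<in> steps (P i)"
      unfolding P steps_triple(1)[OF d] by auto
    show "(u, w) \<notin> steps (P i)"
      using steps_triple(3)[OF d, of "(u, w)"] uvw unfolding P steps_triple(1)[OF d] by auto
    show "e \<in> steps (?P i) \<longleftrightarrow> e = (u, w) \<or> (e \<in> steps (P i) \<and> e \<noteq> (u, v) \<and> e \<noteq> (v, w))"
      unfolding P' unfolding P unfolding steps_triple(1,2)[OF d] using steps_triple(3)[OF d, of e] by blast
  qed
  have off: "?P i = P i" "(u, v) \<notin> steps (P i)" "(v, w) \<notin> steps (P i)"
    if i: "i \<in> I" "v \<notin> set (P i)" for i
    using i steps_subset[of "P i"] by (auto intro!: filter_True)
  note on0 = on[OF i0]
  have L1: "load I c P (u, v) = W" "load I c P (v, w) = W"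
    unfolding load_def W_def using on off by (intro sum.cong refl; meson)+
  have L2: "load I c ?P (u, v) = 0" "load I c ?P (v, w) = 0"
    unfolding load_def
  proof (rule_tac [!] sum.neutral, rule_tac [!] ballI)
    fix i assume i: "i \<in> I"
    show "(if (u, v) \<in> steps (?P i) then c i else 0) = 0" "(if (v, w) \<in> steps (?P i) then c i else 0) = 0"
      using on(1)[OF i, of "(u, v)"] on(1)[OF i, of "(v, w)"] off[OF i] on0(5-7)
      by (cases "v \<in> set (P i)"; simp)+
  qed
  have L3: "load I c ?P (u, w) = load I c P (u, w) + W"
    unfolding load_def W_def sum.distrib[symmetric]
  proof (intro sum.cong refl)
    fix i assume i: "i \<in> I"
    show "(if (u, w) \<in> steps (?P i) then c i else 0) =
        (if (u, w) \<in> steps (P i) then c i else 0) + (if v \<in> set (P i) then c i else 0)"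
      using on(1)[OF i, of "(u, w)"] on(4)[OF i] off[OF i]
      by (cases "v \<in> set (P i)"; simp)
  qed
  have L4: "load I c ?P e = load I c P e" if "e \<noteq> (u, v)" "e \<noteq> (v, w)" "e \<noteq> (u, w)" for e
    unfolding load_def
  proof (intro sum.cong refl)
    fix i assume i: "i \<in> I"
    show "(if e \<in> steps (?P i) then c i else 0) = (if e \<in> steps (P i) then c i else 0)"
      using on(1)[OF i, of e] off[OF i] that by (cases "v \<in> set (P i)"; simp)
  qed
  define V where "V = (\<Union>i\<in>I. set (P i))"
  have finV: "finite (V \<times> V)" using assms(1) by (simp add: V_def)
  have subV: "(\<Union>i\<in>I. steps (P i)) \<subseteq> V \<times> V"
  proof (rule UN_least)
    fix i assume "i \<in> I"
    then have "set (P i) \<subseteq> V" by (auto simp: V_def)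
    then show "steps (P i) \<subseteq> V \<times> V" using steps_subset[of "P i"] by blast
  qed
  have subV': "(\<Union>i\<in>I. steps (?P i)) \<subseteq> V \<times> V"
  proof (rule UN_least)
    fix i assume "i \<in> I"
    then have "set (?P i) \<subseteq> V" by (auto simp: V_def)
    then show "steps (?P i) \<subseteq> V \<times> V" using steps_subset[of "?P i"] by blast
  qed
  let ?F = "\<lambda>Q e. load I c Q e powr \<alpha> * dist (fst e) (snd e)"
  let ?T = "{(u, v), (v, w), (u, w)}"
  have inV: "?T \<subseteq> V \<times> V" using on0(8,9) i0 by (auto simp: V_def)
  have split: "(\<Sum>e\<in>V \<times> V. ?F Q e) = (\<Sum>e\<in>V \<times> V - ?T. ?F Q e) + (?F Q (u, v) + ?F Q (v, w) + ?F Q (u, w))"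
    for Q :: "'i \<Rightarrow> 'a list"
  proof -
    have "(\<Sum>e\<in>?T. ?F Q e) = ?F Q (u, v) + ?F Q (v, w) + ?F Q (u, w)" using on0(5-7) by simp
    then show ?thesis using sum.subset_diff[OF inV finV, of "?F Q"] by simp
  qed
  have "system_cost \<alpha> I c ?P (\<lambda>z. z) = (\<Sum>e\<in>V \<times> V. ?F ?P e)"
    by (rule system_cost_eq_sum[OF finV subV'])
  also have "\<dots> = (\<Sum>e\<in>V \<times> V - ?T. ?F P e) + (load I c P (u, w) + W) powr \<alpha> * dist u w"
  proof -
    have "(\<Sum>e\<in>V \<times> V - ?T. ?F ?P e) = (\<Sum>e\<in>V \<times> V - ?T. ?F P e)"
      by (intro sum.cong refl) (use L4 in auto)
    then show ?thesis unfolding split L2 L3 by simp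
  qed
  also have "\<dots> \<le> (\<Sum>e\<in>V \<times> V - ?T. ?F P e) + (W powr \<alpha> * dist u v + W powr \<alpha> * dist v w + load I c P (u, w) powr \<alpha> * dist u w)"
  proof -
    have "0 \<le> load I c P (u, w)" using assms(2) by (intro load_nonneg) (auto intro: less_imp_le)
    then have "(load I c P (u, w) + W) powr \<alpha> * dist u w \<le> (load I c P (u, w) powr \<alpha> + W powr \<alpha>) * dist u w"
      using W assms(6,7) by (intro mult_right_mono powr_subadditive) auto
    moreover have "W powr \<alpha> * dist u w \<le> W powr \<alpha> * (dist u v + dist v w)"
      by (intro mult_left_mono dist_triangle) auto
    ultimately show ?thesis by (simp add: algebra_simps)
  qed
  also have "\<dots> = (\<Sum>e\<in>V \<times> V. ?F P e)"
    unfolding split L1 by simp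
  also have "\<dots> = system_cost \<alpha> I c P (\<lambda>z. z)"
    by (rule system_cost_eq_sum[symmetric, OF finV subV])
  finally show ?thesis .
qed

lemma compress_to_anchors:
  fixes P :: "'i \<Rightarrow> 'a::real_normed_vector list"
  assumes "finite I" "\<And>i. i \<in> I \<Longrightarrow> 0 < c i" "0 \<le> \<alpha>" "\<alpha> < 1"
    and "\<And>i. i \<in> I \<Longrightarrow> P i \<noteq> [] \<and> distinct (P i) \<and> hd (P i) \<in> K \<and> last (P i) \<in> K"
    and "meeting_in_segments K I P"
  shows "\<exists>Q. (\<forall>i\<in>I. Q i \<noteq> [] \<and> distinct (Q i) \<and> hd (Q i) = hd (P i) \<and> last (Q i) = last (P i) \<and>
      set (Q i) \<subseteq> K \<inter> set (P i)) \<and> system_cost \<alpha> I c Q (\<lambda>z. z) \<le> system_cost \<alpha> I c P (\<lambda>z. z)"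
  using assms(5,6)
proof (induction "card ((\<Union>i\<in>I. set (P i)) - K)" arbitrary: P rule: less_induct)
  case less
  show ?case
  proof (cases "(\<Union>i\<in>I. set (P i)) \<subseteq> K")
    case True
    then show ?thesis using less.prems(1) by (intro exI[of _ P]) blast
  next
    case False
    then obtain v where v: "v \<in> (\<Union>i\<in>I. set (P i)) - K" by blast
    let ?P = "\<lambda>i. filter (\<lambda>z. z \<noteq> v) (P i)"
    have fin: "finite ((\<Union>i\<in>I. set (P i)) - K)" using assms(1) by simp
    have "(\<Union>i\<in>I. set (?P i)) - K \<subset> (\<Union>i\<in>I. set (P i)) - K" using v by auto
    then have card: "card ((\<Union>i\<in>I. set (?P i)) - K) < card ((\<Union>i\<in>I. set (P i)) - K)"
      by (rule psubset_card_mono[OF fin])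
    have ends: "?P i \<noteq> [] \<and> hd (?P i) = hd (P i) \<and> last (?P i) = last (P i)" if "i \<in> I" for i
    proof -
      have "P i \<noteq> []" "hd (P i) \<noteq> v" "last (P i) \<noteq> v" using less.prems(1)[OF that] v by auto
      then show ?thesis using filter_hd_last[of "P i" "\<lambda>z. z \<noteq> v"] by simp
    qed
    have prems: "?P i \<noteq> [] \<and> distinct (?P i) \<and> hd (?P i) \<in> K \<and> last (?P i) \<in> K" if "i \<in> I" for i
      using ends[OF that] less.prems(1)[OF that] by simp
    have meet: "meeting_in_segments K I ?P"
      using meeting_in_segments_filter[OF less.prems(2)] v by blast
    obtain Q where Q: "\<forall>i\<in>I. Q i \<noteq> [] \<and> distinct (Q i) \<and> hd (Q i) = hd (?P i) \<and> last (Q i) = last (?P i) \<and>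
        set (Q i) \<subseteq> K \<inter> set (?P i)" "system_cost \<alpha> I c Q (\<lambda>z. z) \<le> system_cost \<alpha> I c ?P (\<lambda>z. z)"
      using less.hyps[OF card prems meet] by blast
    have "system_cost \<alpha> I c ?P (\<lambda>z. z) \<le> system_cost \<alpha> I c P (\<lambda>z. z)"
      using shortcut_cost[where P = P and v = v and c = c, OF assms(1,2) _ less.prems(2) _ assms(3,4)]
        less.prems(1) v by blast
    with Q(2) have "system_cost \<alpha> I c Q (\<lambda>z. z) \<le> system_cost \<alpha> I c P (\<lambda>z. z)" by simp
    moreover have "\<forall>i\<in>I. Q i \<noteq> [] \<and> distinct (Q i) \<and> hd (Q i) = hd (P i) \<and> last (Q i) = last (P i) \<and>
        set (Q i) \<subseteq> K \<inter> set (P i)"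
      using Q(1) ends by auto
    ultimately show ?thesis by blast
  qed
qed

lemma system_cost_relabel:
  fixes P :: "'i \<Rightarrow> 'a::real_normed_vector list"
  assumes "inj_on h V" "\<And>i. i \<in> I \<Longrightarrow> set (P i) \<subseteq> V" "\<And>v. v \<in> V \<Longrightarrow> pos (h v) = v"
  shows "system_cost \<alpha> I c (\<lambda>i. map h (P i)) pos = system_cost \<alpha> I c P (\<lambda>z. z)"
proof -
  have st: "steps (P i) \<subseteq> V \<times> V" if "i \<in> I" for i
    using steps_subset[of "P i"] assms(2)[OF that] by blast
  have inj: "inj_on (map_prod h h) (V \<times> V)" using assms(1) by (rule map_prod_inj_on[OF _ assms(1)])
  have ld: "load I c (\<lambda>i. map h (P i)) (map_prod h h e) = load I c P e" if "e \<in> V \<times> V" for e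
    unfolding load_def
  proof (intro sum.cong refl)
    fix i assume i: "i \<in> I"
    have "map_prod h h e \<in> steps (map h (P i)) \<longleftrightarrow> e \<in> steps (P i)"
      unfolding map_steps using inj_on_image_mem_iff[OF inj that st[OF i]] .
    then show "(if map_prod h h e \<in> steps (map h (P i)) then c i else 0) = (if e \<in> steps (P i) then c i else 0)"
      by simp
  qed
  let ?E = "\<Union>i\<in>I. steps (P i)"
  have E: "?E \<subseteq> V \<times> V" using st by blast
  have "(\<Union>i\<in>I. steps (map h (P i))) = map_prod h h ` ?E" unfolding map_steps by blast
  then have "system_cost \<alpha> I c (\<lambda>i. map h (P i)) pos = (\<Sum>e\<in>map_prod h h ` ?E.
      load I c (\<lambda>i. map h (P i)) e powr \<alpha> * dist (pos (fst e)) (pos (snd e)))"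
    unfolding system_cost_def by simp
  also have "\<dots> = (\<Sum>e\<in>?E. load I c (\<lambda>i. map h (P i)) (map_prod h h e) powr \<alpha> *
      dist (pos (fst (map_prod h h e))) (pos (snd (map_prod h h e))))"
    by (rule sum.reindex[OF inj_on_subset[OF inj E], unfolded o_def])
  also have "\<dots> = system_cost \<alpha> I c P (\<lambda>z. z)"
    unfolding system_cost_def
  proof (rule sum.cong[OF refl])
    fix e assume "e \<in> ?E"
    then have e: "e \<in> V \<times> V" using E by blast
    have "pos (h (fst e)) = fst e" "pos (h (snd e)) = snd e" using e assms(3) by auto
    then show "load I c (\<lambda>i. map h (P i)) (map_prod h h e) powr \<alpha> *
      dist (pos (fst (map_prod h h e))) (pos (snd (map_prod h h e))) =
      load I c P e powr \<alpha> * dist (fst e) (snd e)"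
      using ld[OF e] by simp
  qed
  finally show ?thesis .
qed

section \<open>Existence of optimal placements\<close>

text \<open>Labels are distinct but their positions may coincide, for otherwise the set of
  placements would not be closed. All values of \<open>pos\<close> lie in \<open>X\<close>, so that
  the set is also compact.\<close>

definition placed_system ::
    "'a set \<Rightarrow> 'i set \<Rightarrow> ('i \<Rightarrow> 'a) \<Rightarrow> ('i \<Rightarrow> 'a) \<Rightarrow> ('i \<Rightarrow> nat list) \<Rightarrow> (nat \<Rightarrow> 'a) \<Rightarrow> bool" where
  "placed_system X I s t \<tau> pos \<longleftrightarrow> (\<forall>m. pos m \<in> X) \<and>
     (\<forall>i\<in>I. \<tau> i \<noteq> [] \<and> distinct (\<tau> i) \<and> pos (hd (\<tau> i)) = s i \<and> pos (last (\<tau> i)) = t i)"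

text \<open>Tychonoff for maps into \<open>X\<close>, cut down by closed conditions on
  coordinates.\<close>

lemma compact_placements:
  fixes X :: "'a::real_normed_vector set"
  assumes "compact X" "finite I"
  shows "compact {pos :: nat \<Rightarrow> 'a. (\<forall>m. pos m \<in> X) \<and> (\<forall>i\<in>I. pos (f i) = s i \<and> pos (g i) = t i)}"
proof -
  have "compactin (product_topology (\<lambda>m. euclidean) UNIV) (PiE UNIV (\<lambda>m::nat. X))"
    using assms(1) by (simp add: compactin_PiE)
  then have 1: "compact {pos :: nat \<Rightarrow> 'a. \<forall>m. pos m \<in> X}"
    unfolding euclidean_product_topology by (simp add: PiE_UNIV_domain Pi_def)
  have cont: "continuous_on UNIV (\<lambda>pos :: nat \<Rightarrow> 'a. pos m)" for m
    by (rule continuous_on_product_coordinates)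
  have "closed (\<Inter>i\<in>I. {pos :: nat \<Rightarrow> 'a. pos (f i) = s i} \<inter> {pos. pos (g i) = t i})"
    by (intro closed_INT ballI closed_Int closed_Collect_eq cont continuous_on_const)
  from compact_Int_closed[OF 1 this] show ?thesis
    by (rule back_subst[of compact]) auto
qed

text \<open>The loads depend on the labels only, so positions enter through distances alone; this
  makes the cost continuous even for \<alpha> = 0.\<close>

lemma continuous_on_system_cost:
  fixes S :: "(nat \<Rightarrow> 'a::real_normed_vector) set"
  shows "continuous_on S (system_cost \<alpha> I c \<tau>)"
  unfolding system_cost_def
  by (intro continuous_intros continuous_on_subset[OF continuous_on_product_coordinates]) auto

text \<open>
  Only finitely many labelled systems have to be considered, and for each of them the cost is a
  continuous function of the positions.
\<close>

lemma optimal_placement_exists: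
  fixes X :: "'a::real_normed_vector set"
  assumes "compact X" "finite I" "\<And>i. i \<in> I \<Longrightarrow> 0 < c i" "0 \<le> \<alpha>" "\<alpha> < 1" "X \<noteq> {}"
    and "curve_system X I s t P0"
  shows "\<exists>\<tau> pos. placed_system X I s t \<tau> pos \<and>
    (\<forall>P. curve_system X I s t P \<longrightarrow> system_cost \<alpha> I c \<tau> pos \<le> system_cost \<alpha> I c P (\<lambda>z. z))"
proof -
  \<comment> \<open>The bound from \<open>meeting_in_segments_anchors\<close>; that many labels
    suffice.\<close>
  define L where "L = 2 * (card I)\<^sup>2 + 2 * card I"
  define T where "T = PiE I (\<lambda>_. {p. set p \<subseteq> {..<L} \<and> distinct p})"
  define F where "F \<tau> = {pos. placed_system X I s t \<tau> pos}" for \<tau>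
  have finT: "finite T"
    unfolding T_def by (intro finite_PiE assms(2) finite_subset_distinct) simp
  have reach: "\<exists>\<tau>\<in>T. \<exists>pos\<in>F \<tau>. system_cost \<alpha> I c \<tau> pos \<le> system_cost \<alpha> I c P (\<lambda>z. z)"
    if P: "curve_system X I s t P" for P
  proof -
    obtain K where K: "finite K" "card K \<le> L" "meeting_in_segments K I P"
      "\<And>i. i \<in> I \<Longrightarrow> hd (P i) \<in> K \<and> last (P i) \<in> K"
      using meeting_in_segments_anchors[OF assms(2), of P] P unfolding L_def curve_system_def by metis
    have Pd: "P i \<noteq> [] \<and> distinct (P i) \<and> hd (P i) \<in> K \<and> last (P i) \<in> K" if "i \<in> I" for i
      using P K(4) that unfolding curve_system_def by blast
    have "\<exists>Q. (\<forall>i\<in>I. Q i \<noteq> [] \<and> distinct (Q i) \<and> hd (Q i) = hd (P i) \<and> last (Q i) = last (P i) \<and>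
      set (Q i) \<subseteq> K \<inter> set (P i)) \<and> system_cost \<alpha> I c Q (\<lambda>z. z) \<le> system_cost \<alpha> I c P (\<lambda>z. z)"
      by (rule compress_to_anchors[OF assms(2-5) Pd K(3)])
    then obtain Q where Q: "\<forall>i\<in>I. Q i \<noteq> [] \<and> distinct (Q i) \<and> hd (Q i) = hd (P i) \<and> last (Q i) = last (P i) \<and>
      set (Q i) \<subseteq> K \<inter> set (P i)" "system_cost \<alpha> I c Q (\<lambda>z. z) \<le> system_cost \<alpha> I c P (\<lambda>z. z)"
      by (elim exE conjE)
    \<comment> \<open>The anchor set may contain an unspecified value outside \<open>X\<close>; the
      curves stay inside \<open>X\<close>.\<close>
    define V where "V = K \<inter> X"
    have finV: "finite V" "card V \<le> L" using K card_mono[of K V] by (auto simp: V_def)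
    obtain h :: "'a \<Rightarrow> nat" where h: "inj_on h V" "h ` V \<subseteq> {..<L}"
      using card_le_inj[OF finV(1), of "{..<L}"] finV(2) by auto
    obtain x0 where x0: "x0 \<in> X" using assms(6) by blast
    \<comment> \<open>Labels without a vertex are parked at an arbitrary point of
      \<open>X\<close>.\<close>
    define pos where "pos m = (if m \<in> h ` V then inv_into V h m else x0)" for m
    have pos: "pos (h v) = v" if "v \<in> V" for v using that h(1) by (simp add: pos_def)
    have posX: "pos m \<in> X" for m
      using x0 inv_into_into[of m h V] by (auto simp: pos_def V_def)
    have QV: "set (Q i) \<subseteq> V" if "i \<in> I" for i
      using Q(1) P that unfolding curve_system_def V_def by blast
    define \<tau> where "\<tau> = restrict (\<lambda>i. map h (Q i)) I"
    have "load I c \<tau> e = load I c (\<lambda>i. map h (Q i)) e" for e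
      unfolding load_def \<tau>_def by (intro sum.cong) auto
    then have "system_cost \<alpha> I c \<tau> pos = system_cost \<alpha> I c (\<lambda>i. map h (Q i)) pos"
      unfolding system_cost_def by (simp add: \<tau>_def)
    also have "\<dots> = system_cost \<alpha> I c Q (\<lambda>z. z)"
      by (rule system_cost_relabel[OF h(1) QV pos])
    finally have cost: "system_cost \<alpha> I c \<tau> pos \<le> system_cost \<alpha> I c P (\<lambda>z. z)" using Q(2) by simp
    have d: "distinct (map h (Q i))" if "i \<in> I" for i
      using Q(1) that inj_on_subset[OF h(1) QV[OF that]] by (simp add: distinct_map)
    have "\<tau> \<in> T"
      unfolding T_def
    proof (rule PiE_I)
      show "\<tau> i \<in> {p. set p \<subseteq> {..<L} \<and> distinct p}" if "i \<in> I" for i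
        using d[OF that] QV[OF that] h(2) that by (auto simp: \<tau>_def)
    qed (simp add: \<tau>_def)
    moreover have "pos \<in> F \<tau>"
      unfolding F_def placed_system_def mem_Collect_eq
    proof (intro conjI allI ballI)
      fix i assume i: "i \<in> I"
      have ne: "Q i \<noteq> []" using Q(1) i by blast
      show "\<tau> i \<noteq> []" "distinct (\<tau> i)" using ne d[OF i] i by (auto simp: \<tau>_def)
      have "hd (Q i) \<in> V" "last (Q i) \<in> V" using ne QV[OF i] by auto
      moreover have "hd (Q i) = s i" "last (Q i) = t i" using Q(1) P i unfolding curve_system_def by auto
      ultimately show "pos (hd (\<tau> i)) = s i" "pos (last (\<tau> i)) = t i"
        using ne i pos by (auto simp: \<tau>_def hd_map last_map)
    qed (rule posX)
    ultimately show ?thesis using cost by blast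
  qed
  have attained: "\<exists>pos\<in>F \<tau>. \<forall>pos'\<in>F \<tau>. system_cost \<alpha> I c \<tau> pos \<le> system_cost \<alpha> I c \<tau> pos'"
    if ne: "F \<tau> \<noteq> {}" for \<tau>
  proof (rule continuous_attains_inf[OF _ ne continuous_on_system_cost])
    have "F \<tau> = {pos. (\<forall>m. pos m \<in> X) \<and> (\<forall>i\<in>I. pos (hd (\<tau> i)) = s i \<and> pos (last (\<tau> i)) = t i)}"
      using ne unfolding F_def placed_system_def by blast
    then show "compact (F \<tau>)" using compact_placements[OF assms(1,2)] by simp
  qed
  define best where "best \<tau> = (SOME pos. pos \<in> F \<tau> \<and> (\<forall>pos'\<in>F \<tau>. system_cost \<alpha> I c \<tau> pos \<le> system_cost \<alpha> I c \<tau> pos'))" for \<tau>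
  have best: "best \<tau> \<in> F \<tau>" "\<And>pos'. pos' \<in> F \<tau> \<Longrightarrow> system_cost \<alpha> I c \<tau> (best \<tau>) \<le> system_cost \<alpha> I c \<tau> pos'"
    if "F \<tau> \<noteq> {}" for \<tau>
    using someI_ex[of "\<lambda>pos. pos \<in> F \<tau> \<and> (\<forall>pos'\<in>F \<tau>. system_cost \<alpha> I c \<tau> pos \<le> system_cost \<alpha> I c \<tau> pos')"]
      attained[OF that] unfolding best_def by blast+
  \<comment> \<open>Types without any admissible placement are discarded before the best of the
    finitely many optimal placements is selected.\<close>
  define T' where "T' = {\<tau> \<in> T. F \<tau> \<noteq> {}}"
  have T': "finite T'" "T' \<noteq> {}" using finT reach[OF assms(7)] by (auto simp: T'_def)
  define \<tau> where "\<tau> = arg_min_on (\<lambda>\<tau>. system_cost \<alpha> I c \<tau> (best \<tau>)) T'"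
  have \<tau>: "\<tau> \<in> T'" "\<And>\<tau>'. \<tau>' \<in> T' \<Longrightarrow> system_cost \<alpha> I c \<tau> (best \<tau>) \<le> system_cost \<alpha> I c \<tau>' (best \<tau>')"
    using arg_min_if_finite[OF T', of "\<lambda>\<tau>. system_cost \<alpha> I c \<tau> (best \<tau>)"] unfolding \<tau>_def
    by (blast, force simp: not_less)
  show ?thesis
  proof (intro exI conjI allI impI)
    show "placed_system X I s t \<tau> (best \<tau>)" using best(1)[of \<tau>] \<tau>(1) by (simp add: T'_def F_def)
    fix P assume "curve_system X I s t P"
    from reach[OF this] obtain \<tau>' pos where \<tau>': "\<tau>' \<in> T" "pos \<in> F \<tau>'"
      "system_cost \<alpha> I c \<tau>' pos \<le> system_cost \<alpha> I c P (\<lambda>z. z)" by blast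
    then have "\<tau>' \<in> T'" by (auto simp: T'_def)
    with \<tau>(2)[OF this] best(2)[of \<tau>' pos] \<tau>' show "system_cost \<alpha> I c \<tau> (best \<tau>) \<le> system_cost \<alpha> I c P (\<lambda>z. z)"
      by (fastforce simp: T'_def)
  qed
qed

section \<open>Transport paths and rigid chains\<close>

lemma path_chain_eq:
  assumes "finite (edges G)"
  shows "path_chain G e = (if e \<in> edges G then wt G e else 0) -
    (if prod.swap e \<in> edges G then wt G (prod.swap e) else 0)"
proof -
  have "path_chain G e = (\<Sum>e'\<in>edges G. (if e = e' then wt G e' else 0) - (if prod.swap e = e' then wt G e' else 0))"
    unfolding path_chain_def
  proof (intro sum.cong refl)
    fix e'
    have "e = prod.swap e' \<longleftrightarrow> prod.swap e = e'" by (metis swap_swap)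
    then show "wt G e' * segment_chain e' e = (if e = e' then wt G e' else 0) - (if prod.swap e = e' then wt G e' else 0)"
      by (simp only: segment_chain_def) simp
  qed
  then show ?thesis using assms by (simp add: sum_subtractf sum.delta')
qed

lemma steps_last: "p \<noteq> [] \<Longrightarrow> (last p, u) \<in> steps (p @ [u])"
  by (induction p rule: induct_list012) auto

section \<open>Directed cycles, circulations and undirected cycles\<close>

text \<open>A shortest closed walk repeats no vertex, since a repetition would cut off a shorter
  one; asymmetry excludes lengths one and two.\<close>

lemma not_acyclic_cycle:
  assumes "\<not> acyclic D" "\<And>u v. (u, v) \<in> D \<Longrightarrow> (v, u) \<notin> D"
  obtains vs where "distinct vs" "3 \<le> length vs" "steps vs \<subseteq> D" "(last vs, hd vs) \<in> D"
proof -
  let ?c = "\<lambda>vs. vs \<noteq> [] \<and> steps vs \<subseteq> D \<and> (last vs, hd vs) \<in> D"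
  obtain u where "(u, u) \<in> D\<^sup>+" using assms(1) unfolding acyclic_def by blast
  then obtain v where uv: "(u, v) \<in> D" "(v, u) \<in> D\<^sup>*" using tranclD by metis
  obtain p where "walk D p" "hd p = v" "last p = u" using rtrancl_walk[OF uv(2)] by blast
  then have "?c p" using uv(1) by (simp add: walk_def)
  then obtain vs where vs: "?c vs" "\<And>q. ?c q \<Longrightarrow> length vs \<le> length q"
    using ex_has_least_nat[of ?c p length] by blast
  have d: "distinct vs"
  proof (rule ccontr)
    assume "\<not> distinct vs"
    then obtain a z b c where split: "vs = a @ [z] @ b @ [z] @ c" using not_distinct_decomp by blast
    have "steps ((z # b) @ [z]) \<subseteq> steps vs"
      using steps_infix[of "(z # b) @ [z]" a c] unfolding split by simp
    then have sub: "steps ((z # b) @ [z]) \<subseteq> D" using vs(1) by blast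
    have "steps (z # b) \<subseteq> steps ((z # b) @ [z])"
      using steps_infix[of "z # b" "[]" "[z]"] by simp
    moreover have "(last (z # b), z) \<in> steps ((z # b) @ [z])"
      by (rule steps_last) simp
    ultimately have "?c (z # b)" using sub by auto
    from vs(2)[OF this] show False unfolding split by simp
  qed
  have "length vs \<noteq> 1"
  proof
    assume "length vs = 1"
    then obtain z where "vs = [z]" by (auto simp: length_Suc_conv)
    with vs(1) assms(2) show False by auto
  qed
  moreover have "length vs \<noteq> 2"
  proof
    assume "length vs = 2"
    then obtain z w where "vs = [z, w]" by (auto simp: length_Suc_conv numeral_2_eq_2)
    with vs(1) assms(2) show False by auto
  qed
  moreover have "length vs \<noteq> 0" using vs(1) by simp
  ultimately have "3 \<le> length vs" by linarith
  with that d vs(1) show thesis by blast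
qed

text \<open>A nonzero finite acyclic flow ends at a vertex that receives but does not send, and the
  outflow there is negative.\<close>

lemma circulation_not_acyclic:
  assumes "flow_chain X C" "\<And>v. outflow C v = 0" "C e \<noteq> 0"
  shows "\<not> acyclic (flow_rel C)"
proof
  assume "acyclic (flow_rel C)"
  then have wf: "wf ((flow_rel C)\<inverse>)" by (rule finite_acyclic_wf_converse[OF flow_rel_finite[OF assms(1)]])
  obtain u v where e: "e = (u, v)" by force
  have "C (u, v) > 0 \<or> C (v, u) > 0"
    using assms(3) flow_chainD(3)[OF assms(1), of v u] unfolding e by linarith
  then obtain w0 where w0: "w0 \<in> {w. \<exists>z. (z, w) \<in> flow_rel C}" by (auto simp: flow_rel_def)
  obtain w where w1: "w \<in> {w. \<exists>z. (z, w) \<in> flow_rel C}"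
    "\<And>r. (r, w) \<in> (flow_rel C)\<inverse> \<Longrightarrow> r \<notin> {w. \<exists>z. (z, w) \<in> flow_rel C}"
    by (rule wfE_min[OF wf w0]) (rule that)
  then obtain z where z: "(z, w) \<in> flow_rel C" by blast
  have "(w, r) \<notin> flow_rel C" for r using w1(2)[of r] by blast
  then have le: "C (w, r) \<le> 0" for r by (simp add: flow_rel_def not_less)
  have neg: "C (w, z) < 0" using z flow_chainD(3)[OF assms(1), of w z] by (simp add: flow_rel_def)
  have "0 < (\<Sum>r | C (w, r) \<noteq> 0. - C (w, r))"
    using neg le by (intro sum_pos2[OF flow_chain_finite_row[OF assms(1)], of z]) auto
  then show False using assms(2)[of w] by (simp add: outflow_def sum_negf)
qed

text \<open>A nonzero circulation contains a directed cycle, which is an undirected cycle of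
  \<open>G\<close>.\<close>

lemma no_cycles_rigid:
  assumes "no_cycles G" "\<And>e. \<phi> e \<noteq> 0 \<Longrightarrow> joined G (fst e) (snd e)"
  shows "rigid_on {} \<phi>"
  unfolding rigid_on_def
proof (intro allI impI, rule ccontr)
  fix C e
  assume C: "flow_chain UNIV C" "\<forall>e. C e \<noteq> 0 \<longrightarrow> \<phi> e \<noteq> 0" "\<forall>v. v \<notin> {} \<longrightarrow> outflow C v = 0" "C e \<noteq> 0"
  have "\<not> acyclic (flow_rel C)" using circulation_not_acyclic[OF C(1) _ C(4)] C(3) by simp
  moreover have "\<And>u v. (u, v) \<in> flow_rel C \<Longrightarrow> (v, u) \<notin> flow_rel C"
    using flow_rel_swap[OF C(1)] by fastforce
  ultimately obtain vs where vs: "distinct vs" "3 \<le> length vs" "steps vs \<subseteq> flow_rel C"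
    "(last vs, hd vs) \<in> flow_rel C"
    using not_acyclic_cycle by metis
  have jn: "joined G u v" if "(u, v) \<in> flow_rel C" for u v
    using that C(2) assms(2)[of "(u, v)"] by (auto simp: flow_rel_def)
  have "joined G (vs ! t) (vs ! (Suc t mod length vs))" if t: "t < length vs" for t
  proof (cases "Suc t < length vs")
    case True
    have "successively (\<lambda>u v. (u, v) \<in> flow_rel C) vs" using vs(3) by (auto simp: successively_steps)
    then show ?thesis using successively_nth[OF _ True] True by (auto intro: jn)
  next
    case False
    then have "Suc t = length vs" using t by simp
    moreover from this have "t = length vs - 1" "vs \<noteq> []" by auto
    ultimately show ?thesis using jn[OF vs(4)] by (simp add: last_conv_nth hd_conv_nth)
  qed
  then show False using assms(1) vs(1,2) unfolding no_cycles_def by blast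
qed

lemma curve_chain_snoc:
  "p \<noteq> [] \<Longrightarrow> curve_chain (p @ [u]) e = curve_chain p e + segment_chain (last p, u) e"
  by (induction p rule: induct_list012) auto

text \<open>An undirected cycle, traversed once around, carries a circulation on the support of
  \<phi>; rigidity makes it zero although its first step has coefficient 1.\<close>

lemma rigid_no_cycles:
  assumes "flow_chain X \<phi>" "rigid_on {} \<phi>" "edges G = flow_rel \<phi>"
  shows "no_cycles G"
  unfolding no_cycles_def
proof (intro conjI allI impI notI)
  show False if "(v, v) \<in> edges G" for v
    using that assms(3) flow_chainD(4)[OF assms(1), of v] by (simp add: flow_rel_def)
  show False if "(u, v) \<in> edges G" "(v, u) \<in> edges G" for u v
    using that assms(3) flow_rel_swap[OF assms(1), of "(u, v)"] by simp
  assume "\<exists>vs. length vs \<ge> 3 \<and> distinct vs \<and>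
          (\<forall>t<length vs. joined G (vs ! t) (vs ! (Suc t mod length vs)))"
  then obtain vs where vs: "length vs \<ge> 3" "distinct vs"
    "\<And>t. t < length vs \<Longrightarrow> joined G (vs ! t) (vs ! (Suc t mod length vs))" by blast
  have ne: "vs \<noteq> []" using vs(1) by auto
  have "successively (joined G) vs"
    unfolding successively_conv_nth
  proof (intro allI impI)
    fix t assume t: "Suc t < length vs"
    then show "joined G (vs ! t) (vs ! Suc t)" using vs(3)[of t] by simp
  qed
  moreover have "joined G (last vs) (hd vs)"
    using vs(3)[of "length vs - 1"] ne by (simp add: last_conv_nth hd_conv_nth)
  ultimately have succ: "successively (joined G) (vs @ [hd vs])"
    using ne by (simp add: successively_append_iff)
  let ?C = "curve_chain (vs @ [hd vs])"
  have "?C e = 0" for e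
  proof (rule rigid_onD[OF assms(2)])
    show "flow_chain UNIV ?C" by (simp add: curve_chain_flow_chain)
    show "outflow ?C v = 0" for v
      using outflow_curve_chain[of "vs @ [hd vs]" v] ne by simp
    fix e assume "?C e \<noteq> 0"
    then have "joined G (fst e) (snd e) \<or> joined G (snd e) (fst e)"
      using curve_chain_support[of "vs @ [hd vs]" e] succ unfolding successively_steps
      by (cases e) auto
    then have "0 < \<phi> e \<or> 0 < \<phi> (prod.swap e)"
      using assms(3) by (cases e) (auto simp: joined_def flow_rel_def)
    then show "\<phi> e \<noteq> 0" using flow_chainD(3)[OF assms(1), of "fst e" "snd e"] by (cases e) auto
  qed
  moreover obtain u v w r where vsr: "vs = u # v # w # r"
    using vs(1) by (metis One_nat_def Suc_1 length_Cons list.exhaust list.size(3) not_less_eq_eq numeral_3_eq_3 zero_le)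
  \<comment> \<open>With at least three vertices the closing step from \<open>last vs\<close> to
    \<open>hd vs\<close> is neither the first step nor its reverse, so it does not cancel that
    step.\<close>
  have "?C (u, v) = 1"
  proof -
    have "(v, u) \<notin> steps vs" "(u, v) \<in> steps vs"
      using vs(2) steps_head_notin[of u "v # w # r" v] unfolding vsr by auto
    then have "curve_chain vs (u, v) = 1" using curve_chain_distinct[OF vs(2), of "(u, v)"] by simp
    moreover have "last vs \<noteq> u" "last vs \<noteq> v" using vs(2) unfolding vsr by auto
    then have "segment_chain (last vs, hd vs) (u, v) = 0"
      by (auto simp: segment_chain_def vsr)
    ultimately show ?thesis using curve_chain_snoc[OF ne, of "hd vs" "(u, v)"] by simp
  qed
  ultimately show False by simp
qed

section \<open>Passing between graphs and chains\<close>

lemma sum_edges_at: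
  fixes f :: "'a \<times> 'a \<Rightarrow> real"
  assumes "finite V" "E \<subseteq> V \<times> V"
  shows "(\<Sum>e | e \<in> E \<and> fst e = v. f e) = (\<Sum>u\<in>V. if (v, u) \<in> E then f (v, u) else 0)"
    and "(\<Sum>e | e \<in> E \<and> snd e = v. f e) = (\<Sum>u\<in>V. if (u, v) \<in> E then f (u, v) else 0)"
proof -
  have "{e. e \<in> E \<and> fst e = v} = Pair v ` {u \<in> V. (v, u) \<in> E}"
    "{e. e \<in> E \<and> snd e = v} = (\<lambda>u. (u, v)) ` {u \<in> V. (u, v) \<in> E}"
    using assms(2) by force+
  then have "(\<Sum>e | e \<in> E \<and> fst e = v. f e) = (\<Sum>u\<in>{u \<in> V. (v, u) \<in> E}. f (v, u))"
    "(\<Sum>e | e \<in> E \<and> snd e = v. f e) = (\<Sum>u\<in>{u \<in> V. (u, v) \<in> E}. f (u, v))"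
    by (simp_all add: sum.reindex inj_on_def)
  then show "(\<Sum>e | e \<in> E \<and> fst e = v. f e) = (\<Sum>u\<in>V. if (v, u) \<in> E then f (v, u) else 0)"
    "(\<Sum>e | e \<in> E \<and> snd e = v. f e) = (\<Sum>u\<in>V. if (u, v) \<in> E then f (u, v) else 0)"
    using assms(1) by (simp_all add: sum.inter_filter)
qed

text \<open>The absence of opposite edges rules out cancellation, so the chain remembers the edges
  and weights of the graph.\<close>

lemma transport_path_chain:
  assumes "G \<in> transport_paths X a b"
  shows "flow_chain X (path_chain G)" "flow_rel (path_chain G) = edges G"
    "rigid_on {} (path_chain G)" "outflow (path_chain G) v = a v - b v"
    "chain_cost \<alpha> (path_chain G) = path_cost \<alpha> G"
proof -
  let ?\<phi> = "path_chain G"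
  have G: "finite (verts G)" "verts G \<subseteq> X" "{p. a p \<noteq> 0} \<subseteq> verts G" "{p. b p \<noteq> 0} \<subseteq> verts G"
    "edges G \<subseteq> verts G \<times> verts G" "\<And>e. e \<in> edges G \<Longrightarrow> 0 < wt G e"
    "\<And>v. v \<in> verts G \<Longrightarrow> (\<Sum>e | e \<in> edges G \<and> fst e = v. wt G e) =
            (\<Sum>e | e \<in> edges G \<and> snd e = v. wt G e) + a v - b v" "no_cycles G"
    using assms unfolding transport_paths_def by blast+
  have fin: "finite (edges G)" by (rule finite_subset[OF G(5)]) (simp add: G(1))
  note eq = path_chain_eq[OF fin]
  have nz: "e \<in> edges G \<or> prod.swap e \<in> edges G" if "?\<phi> e \<noteq> 0" for e
    using that eq[of e] by (auto split: if_splits)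
  have onV: "e \<in> verts G \<times> verts G" if "?\<phi> e \<noteq> 0" for e
    using nz[OF that] G(5) by (cases e) auto
  show fc: "flow_chain X ?\<phi>"
    unfolding flow_chain_def
  proof (intro conjI allI)
    show "finite {e. ?\<phi> e \<noteq> 0}"
      by (rule finite_subset[of _ "verts G \<times> verts G"]) (use onV G(1) in auto)
    show "{e. ?\<phi> e \<noteq> 0} \<subseteq> X \<times> X" using onV G(2) by blast
    show "?\<phi> (v, u) = - ?\<phi> (u, v)" for u v unfolding eq by simp
  qed
  have no2: "prod.swap e \<notin> edges G" if "e \<in> edges G" for e
    using that G(8) unfolding no_cycles_def by (cases e) auto
  have on: "?\<phi> e = wt G e" if "e \<in> edges G" for e
    unfolding eq using that no2[OF that] by simp
  show rel: "flow_rel ?\<phi> = edges G"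
  proof
    show "edges G \<subseteq> flow_rel ?\<phi>" using on G(6) by (auto simp: flow_rel_def)
    show "flow_rel ?\<phi> \<subseteq> edges G"
    proof
      fix e assume e: "e \<in> flow_rel ?\<phi>"
      show "e \<in> edges G"
      proof (rule ccontr)
        assume ne: "e \<notin> edges G"
        then have "prod.swap e \<in> edges G" using nz[of e] e by (auto simp: flow_rel_def)
        then have "?\<phi> e < 0" unfolding eq using G(6)[of "prod.swap e"] ne by simp
        with e show False by (simp add: flow_rel_def)
      qed
    qed
  qed
  show "rigid_on {} ?\<phi>"
  proof (rule no_cycles_rigid[OF G(8)])
    show "joined G (fst e) (snd e)" if "?\<phi> e \<noteq> 0" for e
      using nz[OF that] by (cases e) (auto simp: joined_def)
  qed
  show "outflow ?\<phi> v = a v - b v"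
  proof (cases "v \<in> verts G")
    case True
    have "outflow ?\<phi> v = (\<Sum>u\<in>verts G. ?\<phi> (v, u))"
      by (rule outflow_eq_sum[OF G(1)]) (use onV in blast)
    also have "\<dots> = (\<Sum>u\<in>verts G. if (v, u) \<in> edges G then wt G (v, u) else 0) -
        (\<Sum>u\<in>verts G. if (u, v) \<in> edges G then wt G (u, v) else 0)"
      unfolding eq swap_simp by (simp add: sum_subtractf)
    also have "\<dots> = a v - b v" using G(7)[OF True] unfolding sum_edges_at[OF G(1,5)] by simp
    finally show ?thesis .
  next
    case False
    have "?\<phi> (v, u) = 0" for u using onV[of "(v, u)"] False by auto
    then have "outflow ?\<phi> v = 0" by (rule outflow_outside)
    moreover have "a v = 0" "b v = 0" using False G(3,4) by blast+
    ultimately show ?thesis by simp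
  qed
  show "chain_cost \<alpha> ?\<phi> = path_cost \<alpha> G"
    unfolding chain_cost_def path_cost_def
  proof (rule sum.cong)
    show "{e. 0 < ?\<phi> e} = edges G" using rel by (simp add: flow_rel_def)
  qed (simp add: on)
qed

text \<open>The set \<open>V\<close> makes room for points that supply or demand mass without
  touching an edge, where a curve consists of a single vertex.\<close>

lemma rigid_chain_transport_path:
  assumes "flow_chain X \<phi>" "rigid_on {} \<phi>" "\<And>v. outflow \<phi> v = a v - b v"
    and "finite V" "V \<subseteq> X" "{p. a p \<noteq> 0} \<subseteq> V" "{p. b p \<noteq> 0} \<subseteq> V"
  shows "\<exists>G. G \<in> transport_paths X a b \<and> path_chain G = \<phi> \<and> V \<subseteq> verts G"
proof -
  obtain W where W: "finite W" "W \<subseteq> X" "\<And>e. \<phi> e \<noteq> 0 \<Longrightarrow> e \<in> W \<times> W"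
    using flow_chain_verts[OF assms(1)] by metis
  define G where "G = \<lparr>verts = V \<union> W, edges = flow_rel \<phi>, wt = \<phi>\<rparr>"
  have G: "verts G = V \<union> W" "edges G = flow_rel \<phi>" "wt G = \<phi>" by (simp_all add: G_def)
  have fin: "finite (edges G)" unfolding G by (rule flow_rel_finite[OF assms(1)])
  have chain: "path_chain G e = \<phi> e" for e
  proof -
    obtain u v where e: "e = (u, v)" by force
    show ?thesis
      unfolding path_chain_eq[OF fin] unfolding G(2,3)
      using flow_chainD(3)[OF assms(1), of v u] by (auto simp: flow_rel_def e)
  qed
  have edges: "edges G \<subseteq> verts G \<times> verts G"
  proof
    fix e assume "e \<in> edges G"
    then have "e \<in> W \<times> W" using W(3)[of e] by (simp add: G flow_rel_def)
    then show "e \<in> verts G \<times> verts G" unfolding G by blast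
  qed
  have finV: "finite (verts G)" using assms(4) W(1) G by simp
  have bal: "(\<Sum>e | e \<in> edges G \<and> fst e = v. wt G e) = (\<Sum>e | e \<in> edges G \<and> snd e = v. wt G e) + a v - b v" for v
  proof -
    have "outflow \<phi> v = (\<Sum>u\<in>verts G. path_chain G (v, u))"
      unfolding chain
    proof (rule outflow_eq_sum[OF finV])
      show "u \<in> verts G" if "\<phi> (v, u) \<noteq> 0" for u using W(3)[OF that] G(1) by simp
    qed
    also have "\<dots> = (\<Sum>e | e \<in> edges G \<and> fst e = v. wt G e) - (\<Sum>e | e \<in> edges G \<and> snd e = v. wt G e)"
      unfolding path_chain_eq[OF fin] swap_simp sum_edges_at[OF finV edges] by (simp add: sum_subtractf)
    finally show ?thesis using assms(3)[of v] by simp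
  qed
  have "no_cycles G" by (rule rigid_no_cycles[OF assms(1,2) G(2)])
  moreover have "\<forall>e\<in>edges G. 0 < wt G e" unfolding G by (simp add: flow_rel_def)
  moreover have "verts G \<subseteq> X" "{p. a p \<noteq> 0} \<subseteq> verts G" "{p. b p \<noteq> 0} \<subseteq> verts G"
    using assms(5-7) W(2) unfolding G by blast+
  ultimately have "G \<in> transport_paths X a b"
    using finV edges bal unfolding transport_paths_def by blast
  moreover have "path_chain G = \<phi>" by (rule ext) (rule chain)
  moreover have "V \<subseteq> verts G" using G by blast
  ultimately show ?thesis by blast
qed

section \<open>Existence of minimal chains\<close>

lemma walk_subset:
  assumes "flow_chain X \<phi>" "walk (flow_rel \<phi>) p" "hd p \<in> X"
  shows "set p \<subseteq> X"
proof
  fix v assume "v \<in> set p"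
  then have "(hd p, v) \<in> (flow_rel \<phi>)\<^sup>*" using walk_rtrancl[OF assms(2)] by blast
  then show "v \<in> X"
  proof (cases rule: rtranclE)
    case (step w)
    then have "\<phi> (w, v) \<noteq> 0" by (simp add: flow_rel_def)
    from flow_chainD(2)[OF assms(1) this] show ?thesis by simp
  qed (use assms(3) in simp)
qed

lemma system_chain_allocation:
  assumes "\<And>i. i \<in> I \<Longrightarrow> 0 \<le> c i" "\<And>i. i \<in> I \<Longrightarrow> P i \<noteq> []" "\<And>i. i \<in> I \<Longrightarrow> set (P i) \<subseteq> X"
    and "\<And>i. i \<in> I \<Longrightarrow> hd (P i) \<in> R" "\<And>i. i \<in> I \<Longrightarrow> last (P i) = t i"
  shows "system_chain I c P \<in> allocation_chains X R (atoms I c t)"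
    and "outflow (system_chain I c P) v + atoms I c t v = atoms I c (\<lambda>i. hd (P i)) v"
proof -
  have "atoms I c (\<lambda>i. last (P i)) = atoms I c t" using assms(5) by (intro atoms_cong) auto
  then have out: "outflow (system_chain I c P) v + atoms I c t v = atoms I c (\<lambda>i. hd (P i)) v" for v
    using outflow_system_chain[of I P c v] assms(2) by simp
  then show "outflow (system_chain I c P) v + atoms I c t v = atoms I c (\<lambda>i. hd (P i)) v" .
  have "atoms I c (\<lambda>i. hd (P i)) v = 0" if "v \<notin> R" for v
    using that assms(4) by (intro atoms_outside) auto
  moreover have "0 \<le> atoms I c (\<lambda>i. hd (P i)) v" for v by (rule atoms_nonneg[OF assms(1)])
  ultimately show "system_chain I c P \<in> allocation_chains X R (atoms I c t)"
    unfolding allocation_chains_def using out system_chain_flow_chain[of I P X c] assms(3) by simp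
qed

text \<open>For fixed sources of the target points there is an optimal placement. There are finitely
  many choices of sources, and rigid chains, to which every chain reduces, are curve systems for one
  of them.\<close>

lemma minimal_chain_exists:
  fixes X :: "'a::real_normed_vector set"
  assumes "compact X" "finite R" "R \<noteq> {}" "R \<subseteq> X" "finite J" "\<And>j. j \<in> J \<Longrightarrow> 0 < n j"
    "y ` J \<subseteq> X" "0 \<le> \<alpha>" "\<alpha> < 1"
  shows "\<exists>\<phi>. minimal_chain \<alpha> X R (atoms J n y) \<phi>"
proof -
  let ?A = "allocation_chains X R (atoms J n y)"
  have n: "\<And>j. j \<in> J \<Longrightarrow> 0 \<le> n j" using assms(6) less_imp_le by blast
  obtain x0 where x0: "x0 \<in> R" using assms(3) by blast
  have ne: "system_chain J n (\<lambda>j. [x0, y j]) \<in> ?A"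
    by (rule system_chain_allocation) (use n x0 assms(4,7) in auto)
  have "\<exists>\<psi>. \<psi> \<in> ?A \<and> (\<forall>P. curve_system X J \<sigma> y P \<longrightarrow> chain_cost \<alpha> \<psi> \<le> system_cost \<alpha> J n P (\<lambda>z. z))"
    if \<sigma>: "\<And>j. j \<in> J \<Longrightarrow> \<sigma> j \<in> R" for \<sigma>
  proof (cases "\<exists>P. curve_system X J \<sigma> y P")
    \<comment> \<open>No curve system has these end points, so the bound is vacuous and any
      allocation will do.\<close>
    case False
    then show ?thesis using ne by blast
  next
    case True
    then obtain P0 where P0: "curve_system X J \<sigma> y P0" by blast
    have "X \<noteq> {}" using x0 assms(4) by blast
    from optimal_placement_exists[where c = n, OF assms(1,5,6,8,9) this P0]
    obtain \<tau> pos where tp: "placed_system X J \<sigma> y \<tau> pos"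
      "\<forall>P. curve_system X J \<sigma> y P \<longrightarrow> system_cost \<alpha> J n \<tau> pos \<le> system_cost \<alpha> J n P (\<lambda>z. z)"
      by auto
    let ?\<psi> = "system_chain J n (\<lambda>j. map pos (\<tau> j))"
    have "?\<psi> \<in> ?A"
      by (rule system_chain_allocation) (use tp(1) n \<sigma> in \<open>auto simp: placed_system_def hd_map last_map\<close>)
    moreover have "chain_cost \<alpha> ?\<psi> \<le> system_cost \<alpha> J n \<tau> pos"
      by (rule placed_system_cost(1)[OF assms(5,6) _ assms(8,9)]) (use tp(1) in \<open>auto simp: placed_system_def\<close>)
    ultimately show ?thesis using tp(2) by (meson order_trans)
  qed
  then obtain f where f: "\<And>\<sigma>. (\<And>j. j \<in> J \<Longrightarrow> \<sigma> j \<in> R) \<Longrightarrow> f \<sigma> \<in> ?A"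
    "\<And>\<sigma> P. (\<And>j. j \<in> J \<Longrightarrow> \<sigma> j \<in> R) \<Longrightarrow> curve_system X J \<sigma> y P \<Longrightarrow>
      chain_cost \<alpha> (f \<sigma>) \<le> system_cost \<alpha> J n P (\<lambda>z. z)" by metis
  define \<Sigma> where "\<Sigma> = PiE J (\<lambda>_. R)"
  have \<Sigma>: "finite \<Sigma>" "\<Sigma> \<noteq> {}"
    using assms(2,3,5) by (auto simp: \<Sigma>_def PiE_eq_empty_iff intro: finite_PiE)
  obtain \<sigma> where \<sigma>: "\<sigma> \<in> \<Sigma>" "\<And>\<sigma>'. \<sigma>' \<in> \<Sigma> \<Longrightarrow> chain_cost \<alpha> (f \<sigma>) \<le> chain_cost \<alpha> (f \<sigma>')"
    using arg_min_if_finite[OF \<Sigma>, of "\<lambda>\<sigma>. chain_cost \<alpha> (f \<sigma>)"] by (metis not_less)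
  have "minimal_chain \<alpha> X R (atoms J n y) (f \<sigma>)"
    unfolding minimal_chain_def
  proof (intro conjI ballI)
    show "f \<sigma> \<in> ?A" using f(1) \<sigma>(1) by (auto simp: \<Sigma>_def)
    fix \<phi> assume "\<phi> \<in> ?A"
    from reduce_to_rigid[OF this assms(2,8,9)] obtain \<psi> where \<psi>: "\<psi> \<in> ?A"
      "chain_cost \<alpha> \<psi> \<le> chain_cost \<alpha> \<phi>" "rigid_on (sources (atoms J n y) \<psi>) \<psi>" by blast
    have fc: "flow_chain X \<psi>" using allocation_chainsD(1)[OF \<psi>(1)] .
    have rig: "rigid_on {} \<psi>" by (rule rigid_on_mono[OF \<psi>(3)]) simp
    obtain P where P: "\<And>j. j \<in> J \<Longrightarrow> walk (flow_rel \<psi>) (P j)"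
      "\<And>j. j \<in> J \<Longrightarrow> hd (P j) \<in> sources (atoms J n y) \<psi>" "\<And>j. j \<in> J \<Longrightarrow> last (P j) = y j"
      "\<psi> = system_chain J n P"
      using rigid_decomposition[OF \<psi>(1,3) assms(5,6)] by metis
    define \<sigma>' where "\<sigma>' = restrict (\<lambda>j. hd (P j)) J"
    have hdR: "hd (P j) \<in> R" if "j \<in> J" for j using P(2)[OF that] allocation_chainsD(4)[OF \<psi>(1)] by blast
    have \<sigma>': "\<sigma>' \<in> \<Sigma>" using hdR by (auto simp: \<sigma>'_def \<Sigma>_def)
    have "curve_system X J \<sigma>' y P"
      by (rule walks_curve_system[OF fc rig P(1) walk_subset[OF fc P(1)]])
        (use P(3) hdR assms(4) in \<open>auto simp: \<sigma>'_def\<close>)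
    then have "chain_cost \<alpha> (f \<sigma>') \<le> system_cost \<alpha> J n P (\<lambda>z. z)"
      using f(2)[of \<sigma>'] \<sigma>' by (auto simp: \<Sigma>_def)
    also have "\<dots> = chain_cost \<alpha> \<psi>"
      by (rule system_cost_walks[OF fc P(4) assms(5) P(1)]) (auto intro: walk_distinct[OF rigid_acyclic[OF fc rig] P(1)])
    finally show "chain_cost \<alpha> (f \<sigma>) \<le> chain_cost \<alpha> \<phi>" using \<sigma>(2)[OF \<sigma>'] \<psi>(2) by linarith
  qed
  then show ?thesis by blast
qed

section \<open>Sums of chains and of atomic measures\<close>

lemma sum_atoms:
  assumes "finite W" "z ` I \<subseteq> W"
  shows "(\<Sum>v\<in>W. atoms I c z v) = (\<Sum>i\<in>I. c i)"
proof -
  have "(\<Sum>v\<in>W. atoms I c z v) = (\<Sum>i\<in>I. \<Sum>v\<in>W. if z i = v then c i else 0)"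
    unfolding atoms_def by (rule sum.swap)
  also have "\<dots> = (\<Sum>i\<in>I. c i)"
    by (intro sum.cong refl) (use assms in \<open>auto simp: sum.delta\<close>)
  finally show ?thesis .
qed

lemma atoms_inj:
  assumes "finite I" "inj_on z I" "i \<in> I"
  shows "atoms I c z (z i) = c i"
proof -
  have "atoms I c z (z i) = (\<Sum>j\<in>I. if j = i then c j else 0)"
    unfolding atoms_def using assms by (intro sum.cong refl) (auto dest: inj_onD)
  then show ?thesis using assms by simp
qed

lemma atoms_group:
  assumes "finite J" "finite I" "S ` J \<subseteq> I"
  shows "(\<Sum>i\<in>I. atoms {j \<in> J. S j = i} c z v) = atoms J c z v"
  unfolding atoms_def by (rule sum.group[OF assms])

lemma supply_total:
  assumes "\<phi> \<in> allocation_chains X R (atoms J n y)" "finite R" "finite J"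
  shows "(\<Sum>v\<in>R. outflow \<phi> v + atoms J n y v) = (\<Sum>j\<in>J. n j)"
proof -
  obtain V where V: "finite V" "\<And>e. \<phi> e \<noteq> 0 \<Longrightarrow> e \<in> V \<times> V"
    using flow_chain_verts[OF allocation_chainsD(1)[OF assms(1)]] by metis
  let ?W = "R \<union> V \<union> y ` J"
  have W: "finite ?W" using V(1) assms by simp
  have "(\<Sum>v\<in>R. outflow \<phi> v + atoms J n y v) = (\<Sum>v\<in>?W. outflow \<phi> v + atoms J n y v)"
    using W allocation_chainsD(3)[OF assms(1)] by (intro sum.mono_neutral_left) auto
  also have "\<dots> = (\<Sum>v\<in>?W. outflow \<phi> v) + (\<Sum>v\<in>?W. atoms J n y v)" by (rule sum.distrib)
  also have "(\<Sum>v\<in>?W. outflow \<phi> v) = 0"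
  proof (rule sum_outflow[OF allocation_chainsD(1)[OF assms(1)] W])
    show "e \<in> ?W \<times> ?W" if "\<phi> e \<noteq> 0" for e using V(2)[OF that] by auto
  qed
  also have "(\<Sum>v\<in>?W. atoms J n y v) = (\<Sum>j\<in>J. n j)" by (rule sum_atoms[OF W]) auto
  finally show ?thesis by simp
qed

lemma chain_cost_sum_disjoint:
  assumes "finite I" "\<And>i. i \<in> I \<Longrightarrow> flow_chain X (\<phi> i)"
    and "\<And>i j e. i \<in> I \<Longrightarrow> j \<in> I \<Longrightarrow> \<phi> i e \<noteq> 0 \<Longrightarrow> \<phi> j e \<noteq> 0 \<Longrightarrow> i = j"
  shows "chain_cost \<alpha> (\<lambda>e. \<Sum>i\<in>I. \<phi> i e) = (\<Sum>i\<in>I. chain_cost \<alpha> (\<phi> i))"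
proof -
  let ?E = "\<Union>i\<in>I. {e. \<phi> i e \<noteq> 0}"
  have f: "finite ?E" using assms(1) flow_chainD(1)[OF assms(2)] by simp
  have split: "max 0 (\<Sum>i\<in>I. \<phi> i e) powr \<alpha> = (\<Sum>i\<in>I. max 0 (\<phi> i e) powr \<alpha>)" if "e \<in> ?E" for e
  proof -
    obtain i where i: "i \<in> I" "\<phi> i e \<noteq> 0" using \<open>e \<in> ?E\<close> by blast
    have z: "\<phi> j e = 0" if "j \<in> I" "j \<noteq> i" for j using assms(3)[of j i e] that i by blast
    have "(\<Sum>j\<in>I. \<phi> j e) = (\<Sum>j\<in>I. if j = i then \<phi> i e else 0)"
      by (intro sum.cong refl) (use z in auto)
    moreover have "(\<Sum>j\<in>I. max 0 (\<phi> j e) powr \<alpha>) = (\<Sum>j\<in>I. if j = i then max 0 (\<phi> i e) powr \<alpha> else 0)"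
      by (intro sum.cong refl) (use z in auto)
    ultimately show ?thesis using assms(1) i(1) by simp
  qed
  have "chain_cost \<alpha> (\<lambda>e. \<Sum>i\<in>I. \<phi> i e) = (\<Sum>e\<in>?E. max 0 (\<Sum>i\<in>I. \<phi> i e) powr \<alpha> * dist (fst e) (snd e))"
  proof (rule chain_cost_eq_sum[OF f])
    fix e assume "0 < (\<Sum>i\<in>I. \<phi> i e)"
    then obtain i where "i \<in> I" "\<phi> i e \<noteq> 0" using sum.neutral[of I "\<lambda>i. \<phi> i e"] by fastforce
    then show "e \<in> ?E" by auto
  qed
  also have "\<dots> = (\<Sum>e\<in>?E. \<Sum>i\<in>I. max 0 (\<phi> i e) powr \<alpha> * dist (fst e) (snd e))"
    by (intro sum.cong refl) (simp add: split sum_distrib_right)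
  also have "\<dots> = (\<Sum>i\<in>I. \<Sum>e\<in>?E. max 0 (\<phi> i e) powr \<alpha> * dist (fst e) (snd e))"
    by (rule sum.swap)
  also have "\<dots> = (\<Sum>i\<in>I. chain_cost \<alpha> (\<phi> i))"
    by (intro sum.cong refl chain_cost_eq_sum[symmetric] f) (force simp: less_le)
  finally show ?thesis .
qed

lemma system_cost_partition_le:
  assumes "finite J" "finite I" "S ` J \<subseteq> I" "\<And>j. j \<in> J \<Longrightarrow> 0 \<le> c j" "0 \<le> \<alpha>" "\<alpha> < 1"
  shows "system_cost \<alpha> J c P pos \<le> (\<Sum>i\<in>I. system_cost \<alpha> {j \<in> J. S j = i} c P pos)"
proof -
  let ?E = "\<Union>j\<in>J. steps (P j)"
  let ?L = "\<lambda>i. load {j \<in> J. S j = i} c P"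
  have fin: "finite ?E" using assms(1) by simp
  have "system_cost \<alpha> J c P pos = (\<Sum>e\<in>?E. (\<Sum>i\<in>I. ?L i e) powr \<alpha> * dist (pos (fst e)) (pos (snd e)))"
    unfolding system_cost_def load_def by (simp only: sum.group[OF assms(1-3)])
  also have "\<dots> \<le> (\<Sum>e\<in>?E. (\<Sum>i\<in>I. ?L i e powr \<alpha>) * dist (pos (fst e)) (pos (snd e)))"
    using assms(4-6) by (intro sum_mono mult_right_mono powr_sum_subadditive load_nonneg) auto
  also have "\<dots> = (\<Sum>i\<in>I. \<Sum>e\<in>?E. ?L i e powr \<alpha> * dist (pos (fst e)) (pos (snd e)))"
    by (simp add: sum_distrib_right sum.swap[of _ _ I])
  also have "\<dots> = (\<Sum>i\<in>I. system_cost \<alpha> {j \<in> J. S j = i} c P pos)"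
    by (intro sum.cong refl system_cost_eq_sum[symmetric] fin) auto
  finally show ?thesis .
qed

lemma system_chain_group:
  assumes "finite J" "finite I" "S ` J \<subseteq> I"
  shows "(\<Sum>i\<in>I. system_chain {j \<in> J. S j = i} c P e) = system_chain J c P e"
  unfolding system_chain_def by (rule sum.group[OF assms])

lemma minimal_chain_strongly_rigid:
  assumes "minimal_chain \<alpha> X R b \<phi>" "finite R" "0 \<le> \<alpha>" "\<alpha> < 1" "\<And>v. 0 \<le> b v"
  shows "rigid_on (sources b \<phi>) \<phi>"
  using unique_sources_rigid[OF _ minimal_chain_rigid[OF assms(1-4)] minimal_chain_unique_sources[OF assms] assms(5)]
    assms(1) unfolding minimal_chain_def by blast

text \<open>Neighbouring labels placed at the same point produce steps from a point to itself; these
  are skipped.\<close>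

lemma steps_rtrancl:
  assumes "p \<noteq> []" "\<And>u v. (u, v) \<in> steps p \<Longrightarrow> u \<noteq> v \<Longrightarrow> (u, v) \<in> D"
  shows "(hd p, last p) \<in> D\<^sup>*"
  using assms
proof (induction p rule: induct_list012)
  case (3 u v p)
  have "(u, v) \<in> D\<^sup>*" using 3(4)[of u v] by (cases "u = v") auto
  moreover have "(v, last (v # p)) \<in> D\<^sup>*" using 3(2) 3(4) by simp
  ultimately show ?case by simp
qed simp_all

lemma directed_curve_walk:
  assumes "edges G = D"
  shows "directed_curve G u v vs \<longleftrightarrow> walk D vs \<and> hd vs = u \<and> last vs = v \<and> distinct vs \<and> set vs \<subseteq> verts G"
proof -
  have "(\<forall>t. Suc t < length vs \<longrightarrow> (vs ! t, vs ! Suc t) \<in> edges G) \<longleftrightarrow> steps vs \<subseteq> D"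
    using successively_conv_nth[of "\<lambda>a b. (a, b) \<in> D" vs] assms unfolding successively_steps by auto
  then show ?thesis unfolding directed_curve_def walk_def by blast
qed

section \<open>Assignments and allocation paths\<close>

locale allocation_problem =
  fixes X :: "'a::real_normed_vector set" and k l :: nat and x y :: "nat \<Rightarrow> 'a" and n :: "nat \<Rightarrow> real"
    and \<alpha> :: real
  assumes compact_X: "compact X"
    and k_pos: "k \<ge> 1" and inj_x: "inj_on x {1..k}" and x_in: "x ` {1..k} \<subseteq> X"
    and inj_y: "inj_on y {1..l}" and y_in: "y ` {1..l} \<subseteq> X"
    and n_pos: "\<And>j. j \<in> {1..l} \<Longrightarrow> 0 < n j" and n_sum: "(\<Sum>j=1..l. n j) = 1"
    and alpha: "0 \<le> \<alpha>" "\<alpha> < 1"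
begin

abbreviation "target \<equiv> atoms {1..l} n y"
abbreviation "served S i \<equiv> {j \<in> {1..l}. S j = i}"
abbreviation "allocations \<equiv> allocation_chains X (x ` {1..k}) target"
abbreviation "part_allocations S i \<equiv> allocation_chains X {x i} (assigned_target l n y S i)"
abbreviation "minimal \<equiv> minimal_chain \<alpha> X (x ` {1..k}) target"
abbreviation "part_minimal S i \<equiv> minimal_chain \<alpha> X {x i} (assigned_target l n y S i)"
abbreviation "cost S \<equiv> assignment_cost X \<alpha> k x l n y S"

text \<open>The value shared by all three minima. It is taken over chains, which presuppose neither
  a plan nor an assignment; by \<open>minimal_exists\<close> it is attained.\<close>

definition min_cost :: real where
  "min_cost = (INF \<phi>\<in>allocations. chain_cost \<alpha> \<phi>)"

lemma n_nonneg: "j \<in> {1..l} \<Longrightarrow> 0 \<le> n j"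
  using n_pos less_imp_le by blast

lemma target_nonneg: "0 \<le> target v"
  by (rule atoms_nonneg) (rule n_nonneg)

lemma assigned_target_eq: "assigned_target l n y S i = atoms (served S i) n y"
  unfolding assigned_target_def ..

lemma assigned_target_nonneg: "0 \<le> assigned_target l n y S i v"
  unfolding assigned_target_eq by (rule atoms_nonneg) (use n_nonneg in blast)

lemma assigned_source_eq: "assigned_source x l n S i = atoms (served S i) n (\<lambda>j. x i)"
  by (rule ext) (simp add: assigned_source_def atoms_def)

lemma minimal_exists: "\<exists>\<phi>. minimal \<phi>"
proof -
  have "x ` {1..k} \<noteq> {}" using k_pos by simp
  from minimal_chain_exists[of X "x ` {1..k}" "{1..l}" n y \<alpha>, OF compact_X _ this x_in _ n_pos y_in alpha]
  show ?thesis by simp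
qed

lemma min_cost_le: "\<phi> \<in> allocations \<Longrightarrow> min_cost \<le> chain_cost \<alpha> \<phi>"
  unfolding min_cost_def by (rule cINF_lower) (auto intro!: bdd_belowI[of _ 0] chain_cost_nonneg)

lemma minimal_iff: "minimal \<phi> \<longleftrightarrow> \<phi> \<in> allocations \<and> chain_cost \<alpha> \<phi> = min_cost"
proof
  assume \<phi>: "minimal \<phi>"
  then have mem: "\<phi> \<in> allocations" and le: "\<forall>\<psi>\<in>allocations. chain_cost \<alpha> \<phi> \<le> chain_cost \<alpha> \<psi>"
    unfolding minimal_chain_def by blast+
  have "chain_cost \<alpha> \<phi> \<le> min_cost"
    unfolding min_cost_def using mem le by (intro cINF_greatest) auto
  with min_cost_le[OF mem] mem show "\<phi> \<in> allocations \<and> chain_cost \<alpha> \<phi> = min_cost" by simp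
next
  assume "\<phi> \<in> allocations \<and> chain_cost \<alpha> \<phi> = min_cost"
  then show "minimal \<phi>" unfolding minimal_chain_def using min_cost_le by auto
qed

lemma minimal_facts:
  assumes "minimal \<phi>"
  shows "\<phi> \<in> allocations" "flow_chain X \<phi>" "rigid_on {} \<phi>" "rigid_on (sources target \<phi>) \<phi>"
    "unique_sources target \<phi>"
proof -
  show mem: "\<phi> \<in> allocations" using assms by (simp add: minimal_chain_def)
  show "flow_chain X \<phi>" by (rule allocation_chainsD(1)[OF mem])
  have fin: "finite (x ` {1..k})" by simp
  show "rigid_on {} \<phi>" by (rule minimal_chain_rigid[OF assms fin alpha])
  show "rigid_on (sources target \<phi>) \<phi>"
    by (rule minimal_chain_strongly_rigid[OF assms fin alpha target_nonneg])
  show "unique_sources target \<phi>"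
    by (rule minimal_chain_unique_sources[OF assms fin alpha target_nonneg])
qed

section \<open>The subproblem of a single source\<close>

lemma part_minimal_exists:
  assumes "i \<in> {1..k}"
  shows "\<exists>\<phi>. part_minimal S i \<phi>"
proof -
  have "x i \<in> X" using assms x_in by blast
  then have "{x i} \<subseteq> X" by simp
  moreover have "y ` served S i \<subseteq> X" using y_in by blast
  moreover have "\<And>j. j \<in> served S i \<Longrightarrow> 0 < n j" using n_pos by blast
  ultimately show ?thesis
    unfolding assigned_target_eq
    using minimal_chain_exists[of X "{x i}" "served S i" n y \<alpha>] compact_X alpha by simp
qed

text \<open>With a single admissible source, conservation of mass determines its supply, so these
  chains transport exactly the assigned source to the assigned target.\<close>

lemma part_outflow:
  assumes "\<phi> \<in> part_allocations S i"
  shows "outflow \<phi> v = assigned_source x l n S i v - assigned_target l n y S i v"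
proof (cases "v = x i")
  case True
  have "outflow \<phi> (x i) + atoms (served S i) n y (x i) = (\<Sum>j\<in>served S i. n j)"
    using supply_total[of \<phi> X "{x i}" "served S i" n y] assms unfolding assigned_target_eq by simp
  then show ?thesis using True unfolding assigned_target_eq assigned_source_eq by (simp add: atoms_def)
next
  case False
  then have "outflow \<phi> v + assigned_target l n y S i v = 0"
    using allocation_chainsD(3)[OF assms, of v] by simp
  moreover have "assigned_source x l n S i v = 0"
    unfolding assigned_source_eq using False by (intro atoms_outside) auto
  ultimately show ?thesis by simp
qed

lemma part_path_chain:
  assumes "G \<in> transport_paths X (assigned_source x l n S i) (assigned_target l n y S i)"
  shows "path_chain G \<in> part_allocations S i"
proof -
  have "outflow (path_chain G) v + assigned_target l n y S i v = assigned_source x l n S i v" for v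
    using transport_path_chain(4)[OF assms, of v] by simp
  moreover have "0 \<le> assigned_source x l n S i v" for v
    unfolding assigned_source_eq by (rule atoms_nonneg) (use n_nonneg in blast)
  moreover have "assigned_source x l n S i v = 0" if "v \<notin> {x i}" for v
    unfolding assigned_source_eq using that by (intro atoms_outside) auto
  ultimately show ?thesis
    unfolding allocation_chains_def using transport_path_chain(1)[OF assms] by simp
qed

text \<open>Minimality forces rigidity, so a minimal chain is the chain of a transport path;
  admitting chains with cycles therefore does not lower the minimum.\<close>

lemma part_minimal_path:
  assumes "i \<in> {1..k}" "part_minimal S i \<phi>"
  shows "\<exists>G. optimal_transport_path X \<alpha> (assigned_source x l n S i) (assigned_target l n y S i) G \<and>
      path_chain G = \<phi>"
    and "transport_dist X \<alpha> (assigned_source x l n S i) (assigned_target l n y S i) = chain_cost \<alpha> \<phi>"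
proof -
  let ?T = "transport_paths X (assigned_source x l n S i) (assigned_target l n y S i)"
  have mem: "\<phi> \<in> part_allocations S i" using assms(2) by (simp add: minimal_chain_def)
  have rig: "rigid_on {} \<phi>" by (rule minimal_chain_rigid[OF assms(2) _ alpha]) simp
  have sub: "{p. assigned_source x l n S i p \<noteq> 0} \<subseteq> {x i}"
    unfolding assigned_source_eq using atoms_support[of "served S i" n "\<lambda>j. x i"] by auto
  have sub': "{p. assigned_target l n y S i p \<noteq> 0} \<subseteq> y ` {1..l}"
    unfolding assigned_target_eq using atoms_support[of "served S i" n y] by auto
  have V: "finite ({x i} \<union> y ` {1..l})" "{x i} \<union> y ` {1..l} \<subseteq> X" using x_in y_in assms(1) by auto
  obtain G where G: "G \<in> ?T" "path_chain G = \<phi>"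
    using rigid_chain_transport_path[OF allocation_chainsD(1)[OF mem] rig part_outflow[OF mem] V] sub sub'
    by (metis le_supI1 le_supI2)
  have cost: "path_cost \<alpha> G = chain_cost \<alpha> \<phi>" using transport_path_chain(5)[OF G(1), of \<alpha>] G(2) by simp
  have le: "path_cost \<alpha> G \<le> path_cost \<alpha> H" if "H \<in> ?T" for H
    using assms(2) part_path_chain[OF that] transport_path_chain(5)[OF that, of \<alpha>] cost
    unfolding minimal_chain_def by fastforce
  show "\<exists>G. optimal_transport_path X \<alpha> (assigned_source x l n S i) (assigned_target l n y S i) G \<and> path_chain G = \<phi>"
    unfolding optimal_transport_path_def is_arg_min_linorder using G le by blast
  show "transport_dist X \<alpha> (assigned_source x l n S i) (assigned_target l n y S i) = chain_cost \<alpha> \<phi>"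
    unfolding transport_dist_def cost[symmetric] using G(1) le by (intro cInf_eq_minimum) auto
qed

text \<open>An optimal path is no dearer than a path carrying a minimal chain, so its chain is
  minimal even among chains with cycles.\<close>

lemma optimal_part_path:
  assumes "i \<in> {1..k}" "optimal_transport_path X \<alpha> (assigned_source x l n S i) (assigned_target l n y S i) G"
  shows "part_minimal S i (path_chain G)"
proof -
  obtain \<phi> where \<phi>: "part_minimal S i \<phi>" using part_minimal_exists[OF assms(1)] by blast
  obtain H where H: "optimal_transport_path X \<alpha> (assigned_source x l n S i) (assigned_target l n y S i) H"
    "path_chain H = \<phi>" using part_minimal_path(1)[OF assms(1) \<phi>] by blast
  have mem: "G \<in> transport_paths X (assigned_source x l n S i) (assigned_target l n y S i)"
    "H \<in> transport_paths X (assigned_source x l n S i) (assigned_target l n y S i)"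
    and le: "path_cost \<alpha> G \<le> path_cost \<alpha> H"
    using assms(2) H(1) unfolding optimal_transport_path_def is_arg_min_linorder by blast+
  have "chain_cost \<alpha> (path_chain G) \<le> chain_cost \<alpha> \<phi>"
    using le transport_path_chain(5)[OF mem(1), of \<alpha>] transport_path_chain(5)[OF mem(2), of \<alpha>] H(2) by simp
  then show ?thesis
    using \<phi> part_path_chain[OF mem(1)] unfolding minimal_chain_def by (meson order_trans)
qed

lemma assignment_image: "S \<in> assignment_maps l k \<Longrightarrow> S ` {1..l} \<subseteq> {1..k}"
  unfolding assignment_maps_def by auto

lemma sum_part_allocations:
  assumes "S \<in> assignment_maps l k" "\<forall>i\<in>{1..k}. \<Phi> i \<in> part_allocations S i"
  shows "(\<lambda>e. \<Sum>i=1..k. \<Phi> i e) \<in> allocations"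
    and "outflow (\<lambda>e. \<Sum>i=1..k. \<Phi> i e) v + target v = atoms {1..l} n (\<lambda>j. x (S j)) v"
proof -
  have fc: "\<And>i. i \<in> {1..k} \<Longrightarrow> flow_chain X (\<Phi> i)"
    using allocation_chainsD(1) assms(2) by blast
  have out: "outflow (\<lambda>e. \<Sum>i=1..k. \<Phi> i e) v + target v = atoms {1..l} n (\<lambda>j. x (S j)) v" for v
  proof -
    have "outflow (\<lambda>e. \<Sum>i=1..k. \<Phi> i e) v = (\<Sum>i=1..k. outflow (\<Phi> i) v)"
      using outflow_sum[of "{1..k}" X \<Phi> "\<lambda>i. 1" v] fc by simp
    also have "\<dots> = (\<Sum>i=1..k. assigned_source x l n S i v - assigned_target l n y S i v)"
      by (intro sum.cong refl part_outflow) (use assms(2) in blast)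
    also have "\<dots> = (\<Sum>i=1..k. atoms (served S i) n (\<lambda>j. x (S j)) v) - (\<Sum>i=1..k. atoms (served S i) n y v)"
    proof -
      have "assigned_source x l n S i = atoms (served S i) n (\<lambda>j. x (S j))" for i
        unfolding assigned_source_eq by (rule atoms_cong) auto
      then show ?thesis by (simp add: sum_subtractf assigned_target_eq)
    qed
    also have "\<dots> = atoms {1..l} n (\<lambda>j. x (S j)) v - target v"
      using assignment_image[OF assms(1)] by (simp only: atoms_group finite_atLeastAtMost)
    finally show ?thesis by simp
  qed
  then show "outflow (\<lambda>e. \<Sum>i=1..k. \<Phi> i e) v + target v = atoms {1..l} n (\<lambda>j. x (S j)) v" .
  have "flow_chain X (\<lambda>e. \<Sum>i=1..k. \<Phi> i e)"
    using flow_chain_sum[of "{1..k}" X \<Phi> "\<lambda>i. 1"] fc by simp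
  moreover have "0 \<le> atoms {1..l} n (\<lambda>j. x (S j)) v" for v by (rule atoms_nonneg) (rule n_nonneg)
  moreover have "atoms {1..l} n (\<lambda>j. x (S j)) v = 0" if "v \<notin> x ` {1..k}" for v
    using that assignment_image[OF assms(1)] by (intro atoms_outside) auto
  ultimately show "(\<lambda>e. \<Sum>i=1..k. \<Phi> i e) \<in> allocations"
    unfolding allocation_chains_def using out by simp
qed

lemma cost_eq_sum:
  assumes "\<forall>i\<in>{1..k}. part_minimal S i (\<Phi> i)"
  shows "cost S = (\<Sum>i=1..k. chain_cost \<alpha> (\<Phi> i))"
  unfolding assignment_cost_def by (intro sum.cong refl part_minimal_path(2)) (use assms in blast)+

lemma min_cost_le_sum:
  assumes "S \<in> assignment_maps l k" "\<forall>i\<in>{1..k}. \<Phi> i \<in> part_allocations S i"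
  shows "min_cost \<le> chain_cost \<alpha> (\<lambda>e. \<Sum>i=1..k. \<Phi> i e)"
    and "chain_cost \<alpha> (\<lambda>e. \<Sum>i=1..k. \<Phi> i e) \<le> (\<Sum>i=1..k. chain_cost \<alpha> (\<Phi> i))"
proof -
  show "min_cost \<le> chain_cost \<alpha> (\<lambda>e. \<Sum>i=1..k. \<Phi> i e)"
    by (rule min_cost_le[OF sum_part_allocations(1)[OF assms]])
  show "chain_cost \<alpha> (\<lambda>e. \<Sum>i=1..k. \<Phi> i e) \<le> (\<Sum>i=1..k. chain_cost \<alpha> (\<Phi> i))"
    by (rule chain_cost_sum_le[OF _ allocation_chainsD(1) alpha]) (use assms(2) in auto)
qed

lemma part_minimals_exist: "\<exists>\<Phi>. \<forall>i\<in>{1..k}. part_minimal S i (\<Phi> i)"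
  by (intro bchoice ballI part_minimal_exists)

lemma min_cost_le_cost:
  assumes "S \<in> assignment_maps l k"
  shows "min_cost \<le> cost S"
proof -
  obtain \<Phi> where \<Phi>: "\<forall>i\<in>{1..k}. part_minimal S i (\<Phi> i)" using part_minimals_exist[of S] by blast
  then have "\<forall>i\<in>{1..k}. \<Phi> i \<in> part_allocations S i" by (simp add: minimal_chain_def)
  from min_cost_le_sum[OF assms this] show ?thesis unfolding cost_eq_sum[OF \<Phi>] by linarith
qed

section \<open>Assignments read off from minimal chains\<close>

text \<open>Phrased by reachability rather than by chosen curves, so that \<open>S\<close> can be
  matched with any decomposition of \<phi>.\<close>

definition serves :: "('a \<times> 'a \<Rightarrow> real) \<Rightarrow> (nat \<Rightarrow> nat) \<Rightarrow> bool" where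
  "serves \<phi> S \<longleftrightarrow> (\<forall>j\<in>{1..l}. x (S j) \<in> sources target \<phi> \<and> (x (S j), y j) \<in> (flow_rel \<phi>)\<^sup>*)"

text \<open>The trees of a minimal chain that hang on different sources are disjoint, so its cost splits.\<close>

lemma minimal_split:
  assumes "minimal \<phi>" "S \<in> assignment_maps l k" "serves \<phi> S"
  shows "cost S = min_cost"
    and "\<exists>\<Phi>. (\<forall>i\<in>{1..k}. part_minimal S i (\<Phi> i)) \<and> \<phi> = (\<lambda>e. \<Sum>i=1..k. \<Phi> i e)"
proof -
  note \<phi> = minimal_facts[OF assms(1)]
  obtain P where P: "\<And>j. j \<in> {1..l} \<Longrightarrow> walk (flow_rel \<phi>) (P j)"
    "\<And>j. j \<in> {1..l} \<Longrightarrow> hd (P j) \<in> sources target \<phi>" "\<And>j. j \<in> {1..l} \<Longrightarrow> last (P j) = y j"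
    "\<phi> = system_chain {1..l} n P"
    using rigid_decomposition[of \<phi> X "x ` {1..k}" "{1..l}" n y, OF \<phi>(1,4) _ n_pos] by (metis finite_atLeastAtMost)
  \<comment> \<open>Both points are sources upstream of \<open>y j\<close>, and a minimal chain
    allows only one.\<close>
  have hd: "hd (P j) = x (S j)" if j: "j \<in> {1..l}" for j
  proof (rule unique_sourcesD[OF \<phi>(5) P(2)[OF j]])
    show "x (S j) \<in> sources target \<phi>" "(x (S j), y j) \<in> (flow_rel \<phi>)\<^sup>*"
      using assms(3) j unfolding serves_def by blast+
    have "last (P j) \<in> set (P j)" using P(1)[OF j] by (simp add: walk_def)
    then show "(hd (P j), y j) \<in> (flow_rel \<phi>)\<^sup>*" using walk_rtrancl[OF P(1)[OF j]] P(3)[OF j] by metis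
  qed
  have S: "S j \<in> {1..k}" if "j \<in> {1..l}" for j using assignment_image[OF assms(2)] that by blast
  have PX: "set (P j) \<subseteq> X" if "j \<in> {1..l}" for j
  proof (rule walk_subset[OF \<phi>(2) P(1)[OF that]])
    show "hd (P j) \<in> X" unfolding hd[OF that] using S[OF that] x_in by blast
  qed
  define \<Phi> where "\<Phi> i = system_chain (served S i) n P" for i
  have mem: "\<Phi> i \<in> part_allocations S i" for i
    unfolding \<Phi>_def assigned_target_eq
    using n_nonneg P(1,3) PX hd by (intro system_chain_allocation) (auto simp: walk_def)
  have sum: "\<phi> = (\<lambda>e. \<Sum>i=1..k. \<Phi> i e)"
    unfolding P(4) \<Phi>_def using system_chain_group[of "{1..l}" "{1..k}" S n P] assignment_image[OF assms(2)] by auto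
  \<comment> \<open>Every edge of a part lies downstream of its source, so parts with different
    sources cannot share an edge.\<close>
  have touch: "x i \<in> sources target \<phi> \<and> (x i, fst e) \<in> (flow_rel \<phi>)\<^sup>*" if "\<Phi> i e \<noteq> 0" for i e
  proof -
    obtain j where j: "j \<in> served S i" "curve_chain (P j) e \<noteq> 0"
      using system_chain_nonzero[of "served S i" n P e] \<open>\<Phi> i e \<noteq> 0\<close> unfolding \<Phi>_def by blast
    then have jl: "j \<in> {1..l}" "S j = i" by auto
    have "fst e \<in> set (P j)"
      using curve_chain_support[OF j(2)] steps_subset[of "P j"] by (cases e) auto
    then show ?thesis using walk_rtrancl[OF P(1)[OF jl(1)]] hd[OF jl(1)] P(2)[OF jl(1)] jl(2) by metis
  qed
  have disj: "i = i'" if "i \<in> {1..k}" "i' \<in> {1..k}" "\<Phi> i e \<noteq> 0" "\<Phi> i' e \<noteq> 0" for i i' e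
    using touch[OF that(3)] touch[OF that(4)] unique_sourcesD[OF \<phi>(5)] inj_onD[OF inj_x _ that(1,2)] by blast
  have "chain_cost \<alpha> \<phi> = (\<Sum>i=1..k. chain_cost \<alpha> (\<Phi> i))"
    unfolding sum by (rule chain_cost_sum_disjoint[OF _ allocation_chainsD(1)[OF mem] disj]) auto
  then have tot: "(\<Sum>i=1..k. chain_cost \<alpha> (\<Phi> i)) = min_cost" using assms(1) minimal_iff by simp
  \<comment> \<open>The parts of \<phi> are compared with independently chosen minimal chains. Since
    \<open>min_cost \<le> cost S\<close>, no part can be improved, so each part is itself
    minimal.\<close>
  obtain \<Psi> where \<Psi>: "\<forall>i\<in>{1..k}. part_minimal S i (\<Psi> i)" using part_minimals_exist[of S] by blast
  have le: "chain_cost \<alpha> (\<Psi> i) \<le> chain_cost \<alpha> (\<Phi> i)" if "i \<in> {1..k}" for i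
    using bspec[OF \<Psi> that] mem[of i] unfolding minimal_chain_def by blast
  have "cost S \<le> (\<Sum>i=1..k. chain_cost \<alpha> (\<Phi> i))"
    unfolding cost_eq_sum[OF \<Psi>] by (intro sum_mono le)
  then show eq: "cost S = min_cost" using tot min_cost_le_cost[OF assms(2)] by simp
  have "chain_cost \<alpha> (\<Psi> i) = chain_cost \<alpha> (\<Phi> i)" if "i \<in> {1..k}" for i
    using sum_mono_inv[of "\<lambda>i. chain_cost \<alpha> (\<Psi> i)" "{1..k}" "\<lambda>i. chain_cost \<alpha> (\<Phi> i)" i] le that tot eq
      cost_eq_sum[OF \<Psi>] by simp
  then have "part_minimal S i (\<Phi> i)" if "i \<in> {1..k}" for i
    using bspec[OF \<Psi> that] mem[of i] that unfolding minimal_chain_def by auto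
  then show "\<exists>\<Phi>. (\<forall>i\<in>{1..k}. part_minimal S i (\<Phi> i)) \<and> \<phi> = (\<lambda>e. \<Sum>i=1..k. \<Phi> i e)"
    using sum by blast
qed

lemma minimal_serves:
  assumes "minimal \<phi>"
  shows "\<exists>S\<in>assignment_maps l k. serves \<phi> S"
proof -
  note \<phi> = minimal_facts[OF assms]
  obtain P where P: "\<And>j. j \<in> {1..l} \<Longrightarrow> walk (flow_rel \<phi>) (P j)"
    "\<And>j. j \<in> {1..l} \<Longrightarrow> hd (P j) \<in> sources target \<phi>" "\<And>j. j \<in> {1..l} \<Longrightarrow> last (P j) = y j"
    using rigid_decomposition[of \<phi> X "x ` {1..k}" "{1..l}" n y, OF \<phi>(1,4) _ n_pos] by (metis finite_atLeastAtMost)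
  have "\<exists>i\<in>{1..k}. hd (P j) = x i" if "j \<in> {1..l}" for j
    using P(2)[OF that] allocation_chainsD(4)[OF \<phi>(1)] by blast
  then obtain s where s: "\<And>j. j \<in> {1..l} \<Longrightarrow> s j \<in> {1..k} \<and> hd (P j) = x (s j)" by metis
  show ?thesis
  proof (rule bexI[of _ "restrict s {1..l}"])
    show "restrict s {1..l} \<in> assignment_maps l k" using s unfolding assignment_maps_def by auto
    show "serves \<phi> (restrict s {1..l})"
      unfolding serves_def
    proof
      fix j assume j: "j \<in> {1..l}"
      have "last (P j) \<in> set (P j)" using P(1)[OF j] by (simp add: walk_def)
      then have "(hd (P j), y j) \<in> (flow_rel \<phi>)\<^sup>*" using walk_rtrancl[OF P(1)[OF j]] P(3)[OF j] by metis
      then show "x (restrict s {1..l} j) \<in> sources target \<phi> \<and> (x (restrict s {1..l} j), y j) \<in> (flow_rel \<phi>)\<^sup>*"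
        using s[OF j] P(2)[OF j] j by simp
    qed
  qed
qed

lemma optimal_assignment_iff:
  assumes "S \<in> assignment_maps l k"
  shows "optimal_assignment X \<alpha> k x l n y S \<longleftrightarrow> cost S = min_cost"
proof
  assume S: "optimal_assignment X \<alpha> k x l n y S"
  obtain \<phi> where \<phi>: "minimal \<phi>" using minimal_exists by blast
  obtain S' where S': "S' \<in> assignment_maps l k" "serves \<phi> S'" using minimal_serves[OF \<phi>] by blast
  have "cost S \<le> cost S'" using S S'(1) unfolding optimal_assignment_def is_arg_min_linorder by blast
  then show "cost S = min_cost" using minimal_split(1)[OF \<phi> S'] min_cost_le_cost[OF assms] by simp
next
  assume "cost S = min_cost"
  then show "optimal_assignment X \<alpha> k x l n y S"
    unfolding optimal_assignment_def is_arg_min_linorder using assms min_cost_le_cost by auto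
qed

section \<open>Allocation paths and minimal chains\<close>

lemma allocation_path_chain:
  assumes "G \<in> allocation_paths X k x target"
  shows "path_chain G \<in> allocations" "chain_cost \<alpha> (path_chain G) = path_cost \<alpha> G"
proof -
  obtain m where m: "\<And>i. i \<in> {1..k} \<Longrightarrow> 0 \<le> m i" "G \<in> transport_paths X (atoms {1..k} m x) target"
    using assms unfolding allocation_paths_def by blast
  show "chain_cost \<alpha> (path_chain G) = path_cost \<alpha> G" by (rule transport_path_chain(5)[OF m(2)])
  have "outflow (path_chain G) v + target v = atoms {1..k} m x v" for v
    using transport_path_chain(4)[OF m(2), of v] by simp
  moreover have "0 \<le> atoms {1..k} m x v" for v by (rule atoms_nonneg[OF m(1)])
  moreover have "atoms {1..k} m x v = 0" if "v \<notin> x ` {1..k}" for v by (rule atoms_outside[OF that])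
  ultimately show "path_chain G \<in> allocations"
    unfolding allocation_chains_def using transport_path_chain(1)[OF m(2)] by simp
qed

lemma minimal_path:
  assumes "minimal \<phi>"
  obtains G where "G \<in> allocation_paths X k x target" "path_chain G = \<phi>"
proof -
  note \<phi> = minimal_facts[OF assms]
  define m where "m i = outflow \<phi> (x i) + target (x i)" for i
  have eq: "atoms {1..k} m x v = outflow \<phi> v + target v" for v
  proof (cases "v \<in> x ` {1..k}")
    case True
    then show ?thesis using atoms_inj[of "{1..k}" x _ m] inj_x by (auto simp: m_def)
  next
    case False
    then show ?thesis using allocation_chainsD(3)[OF \<phi>(1) False] by (simp add: atoms_outside)
  qed
  have V: "finite (x ` {1..k} \<union> y ` {1..l})" "x ` {1..k} \<union> y ` {1..l} \<subseteq> X" using x_in y_in by auto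
  have "{p. atoms {1..k} m x p \<noteq> 0} \<subseteq> x ` {1..k} \<union> y ` {1..l}"
    "{p. target p \<noteq> 0} \<subseteq> x ` {1..k} \<union> y ` {1..l}"
    using atoms_support[of "{1..k}" m x] atoms_support[of "{1..l}" n y] by blast+
  moreover have "outflow \<phi> v = atoms {1..k} m x v - target v" for v using eq by simp
  ultimately obtain G where G: "G \<in> transport_paths X (atoms {1..k} m x) target" "path_chain G = \<phi>"
    using rigid_chain_transport_path[where a = "atoms {1..k} m x" and b = target, OF \<phi>(2,3) _ V] by blast
  have "(\<Sum>i=1..k. m i) = (\<Sum>v\<in>x ` {1..k}. outflow \<phi> v + target v)"
    unfolding m_def by (rule sum.reindex[OF inj_x, unfolded o_def, symmetric])
  also have "\<dots> = 1" using supply_total[OF \<phi>(1)] n_sum by simp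
  finally have "(\<Sum>i=1..k. m i) = 1" .
  moreover have "0 \<le> m i" for i unfolding m_def by (rule allocation_chainsD(2)[OF \<phi>(1)])
  ultimately have "G \<in> allocation_paths X k x target" using G(1) unfolding allocation_paths_def by blast
  with that G(2) show thesis by blast
qed

lemma optimal_path_iff:
  assumes "G \<in> allocation_paths X k x target"
  shows "optimal_allocation_path X \<alpha> k x target G \<longleftrightarrow> path_cost \<alpha> G = min_cost"
proof
  assume G: "optimal_allocation_path X \<alpha> k x target G"
  obtain \<phi> where \<phi>: "minimal \<phi>" using minimal_exists by blast
  obtain H where H: "H \<in> allocation_paths X k x target" "path_chain H = \<phi>" using minimal_path[OF \<phi>] by blast
  have "path_cost \<alpha> G \<le> path_cost \<alpha> H"
    using G H(1) unfolding optimal_allocation_path_def is_arg_min_linorder by blast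
  then show "path_cost \<alpha> G = min_cost"
    using allocation_path_chain[OF H(1)] allocation_path_chain[OF assms] \<phi> H(2) min_cost_le
    unfolding minimal_iff by fastforce
next
  assume "path_cost \<alpha> G = min_cost"
  then show "optimal_allocation_path X \<alpha> k x target G"
    unfolding optimal_allocation_path_def is_arg_min_linorder
    using assms allocation_path_chain min_cost_le by metis
qed

lemma optimal_path_associated:
  assumes "G \<in> allocation_paths X k x target"
  shows "optimal_allocation_path X \<alpha> k x target G \<longleftrightarrow>
    (\<exists>S\<in>assignment_maps l k. optimal_assignment X \<alpha> k x l n y S \<and> associated_path X \<alpha> k x l n y S G)"
proof
  assume "optimal_allocation_path X \<alpha> k x target G"
  then have min: "minimal (path_chain G)"
    using optimal_path_iff[OF assms] allocation_path_chain[OF assms] unfolding minimal_iff by simp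
  obtain S where S: "S \<in> assignment_maps l k" "serves (path_chain G) S" using minimal_serves[OF min] by blast
  obtain \<Phi> where \<Phi>: "\<forall>i\<in>{1..k}. part_minimal S i (\<Phi> i)" "path_chain G = (\<lambda>e. \<Sum>i=1..k. \<Phi> i e)"
    using minimal_split(2)[OF min S] by blast
  have "\<exists>Gs. \<forall>i\<in>{1..k}. optimal_transport_path X \<alpha> (assigned_source x l n S i)
     (assigned_target l n y S i) (Gs i) \<and> path_chain (Gs i) = \<Phi> i"
  proof (rule bchoice, rule ballI)
    fix i assume i: "i \<in> {1..k}"
    show "\<exists>H. optimal_transport_path X \<alpha> (assigned_source x l n S i) (assigned_target l n y S i) H \<and>
        path_chain H = \<Phi> i"
      by (rule part_minimal_path(1)[OF i bspec[OF \<Phi>(1) i]])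
  qed
  then obtain Gs where Gs: "\<forall>i\<in>{1..k}. optimal_transport_path X \<alpha> (assigned_source x l n S i)
     (assigned_target l n y S i) (Gs i) \<and> path_chain (Gs i) = \<Phi> i" by (rule exE)
  have eq: "\<Phi> i = path_chain (Gs i)" if "i \<in> {1..k}" for i
    by (rule conjunct2[OF bspec[OF Gs that], symmetric])
  have "path_chain G = (\<lambda>p. \<Sum>i=1..k. path_chain (Gs i) p)"
    unfolding \<Phi>(2) by (intro ext sum.cong refl) (simp only: eq)
  moreover have "\<forall>i\<in>{1..k}. optimal_transport_path X \<alpha> (assigned_source x l n S i)
     (assigned_target l n y S i) (Gs i)" using Gs by blast
  ultimately have "associated_path X \<alpha> k x l n y S G"
    unfolding associated_path_def by (intro exI[of _ Gs] conjI)
  moreover have "optimal_assignment X \<alpha> k x l n y S"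
    using minimal_split(1)[OF min S] optimal_assignment_iff[OF S(1)] by simp
  ultimately show "\<exists>S\<in>assignment_maps l k. optimal_assignment X \<alpha> k x l n y S \<and> associated_path X \<alpha> k x l n y S G"
    using S(1) by blast
next
  assume "\<exists>S\<in>assignment_maps l k. optimal_assignment X \<alpha> k x l n y S \<and> associated_path X \<alpha> k x l n y S G"
  then obtain S Gs where S: "S \<in> assignment_maps l k" "optimal_assignment X \<alpha> k x l n y S"
    and Gs: "\<forall>i\<in>{1..k}. optimal_transport_path X \<alpha> (assigned_source x l n S i) (assigned_target l n y S i) (Gs i)"
    "path_chain G = (\<lambda>p. \<Sum>i=1..k. path_chain (Gs i) p)"
    unfolding associated_path_def by (elim bexE exE conjE)
  have min: "\<forall>i\<in>{1..k}. part_minimal S i (path_chain (Gs i))"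
    using optimal_part_path Gs(1) by blast
  then have "\<forall>i\<in>{1..k}. path_chain (Gs i) \<in> part_allocations S i" by (simp add: minimal_chain_def)
  \<comment> \<open>The cost of the sum lies between \<open>min_cost\<close> and the sum of the
    costs, and for an optimal \<open>S\<close> these agree.\<close>
  from min_cost_le_sum[OF S(1) this] have "chain_cost \<alpha> (path_chain G) = min_cost"
    using cost_eq_sum[OF min] S(2) optimal_assignment_iff[OF S(1)] unfolding Gs(2) by simp
  then show "optimal_allocation_path X \<alpha> k x target G"
    using optimal_path_iff[OF assms] allocation_path_chain(2)[OF assms] by simp
qed

end

section \<open>Allocation plans\<close>

context allocation_problem
begin

abbreviation "plans \<equiv> allocation_plans k x l n y"
abbreviation "plan_mass q \<equiv> \<lambda>ij. q (x (fst ij), y (snd ij))"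
text \<open>Pairs without mass are left out: the placement lemmas want positive weights, and
  compatibility provides curves only where there is mass.\<close>

abbreviation "plan_pairs q \<equiv> {ij \<in> {1..k} \<times> {1..l}. 0 < plan_mass q ij}"
abbreviation "qcost \<equiv> plan_cost X \<alpha> k x l n y"

lemma inj_pairs: "inj_on (\<lambda>(i, j). (x i, y j)) ({1..k} \<times> {1..l})"
proof (rule inj_onI)
  fix p p' assume "p \<in> {1..k} \<times> {1..l}" "p' \<in> {1..k} \<times> {1..l}"
    and eq: "(\<lambda>(i, j). (x i, y j)) p = (\<lambda>(i, j). (x i, y j)) p'"
  then have mem: "fst p \<in> {1..k}" "fst p' \<in> {1..k}" "snd p \<in> {1..l}" "snd p' \<in> {1..l}"
    by (simp_all only: mem_Times_iff)
  have "x (fst p) = x (fst p')" "y (snd p) = y (snd p')" using eq by (simp_all add: case_prod_beta)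
  then show "p = p'"
    using inj_onD[OF inj_x _ mem(1,2)] inj_onD[OF inj_y _ mem(3,4)] by (simp add: prod_eq_iff)
qed

lemma planD:
  assumes "q \<in> plans"
  shows "q = atoms ({1..k} \<times> {1..l}) (\<lambda>(i, j). q (x i, y j)) (\<lambda>(i, j). (x i, y j))"
    and "i \<in> {1..k} \<Longrightarrow> j \<in> {1..l} \<Longrightarrow> 0 \<le> q (x i, y j)"
    and "j \<in> {1..l} \<Longrightarrow> (\<Sum>i=1..k. q (x i, y j)) = n j"
proof -
  obtain Q where Q: "q = atoms ({1..k} \<times> {1..l}) (\<lambda>(i, j). Q i j) (\<lambda>(i, j). (x i, y j))"
    "\<forall>i\<in>{1..k}. \<forall>j\<in>{1..l}. 0 \<le> Q i j" "\<forall>j\<in>{1..l}. (\<Sum>i=1..k. Q i j) = n j"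
    using assms unfolding allocation_plans_def by blast
  have val: "q (x i, y j) = Q i j" if "i \<in> {1..k}" "j \<in> {1..l}" for i j
    using atoms_inj[OF _ inj_pairs, of "(i, j)" "\<lambda>(i, j). Q i j"] that unfolding Q(1) by simp
  show "0 \<le> q (x i, y j)" if "i \<in> {1..k}" "j \<in> {1..l}" using val[OF that] Q(2) that by metis
  show "(\<Sum>i=1..k. q (x i, y j)) = n j" if j: "j \<in> {1..l}"
  proof -
    have "(\<Sum>i=1..k. q (x i, y j)) = (\<Sum>i=1..k. Q i j)" by (intro sum.cong refl val j)
    then show ?thesis using Q(3) j by metis
  qed
  have "atoms ({1..k} \<times> {1..l}) (\<lambda>(i, j). Q i j) (\<lambda>(i, j). (x i, y j)) =
     atoms ({1..k} \<times> {1..l}) (\<lambda>(i, j). q (x i, y j)) (\<lambda>(i, j). (x i, y j))"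
    by (rule atoms_cong) (use val in \<open>auto simp del: One_nat_def\<close>)
  then show "q = atoms ({1..k} \<times> {1..l}) (\<lambda>(i, j). q (x i, y j)) (\<lambda>(i, j). (x i, y j))"
    using Q(1) by simp
qed

lemma plan_eqI:
  assumes "q \<in> plans" "q' \<in> plans" "\<And>i j. i \<in> {1..k} \<Longrightarrow> j \<in> {1..l} \<Longrightarrow> q (x i, y j) = q' (x i, y j)"
  shows "q = q'"
proof -
  have "atoms ({1..k} \<times> {1..l}) (\<lambda>(i, j). q (x i, y j)) (\<lambda>(i, j). (x i, y j)) =
     atoms ({1..k} \<times> {1..l}) (\<lambda>(i, j). q' (x i, y j)) (\<lambda>(i, j). (x i, y j))"
    by (rule atoms_cong) (use assms(3) in \<open>auto simp del: One_nat_def\<close>)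
  then show ?thesis using planD(1)[OF assms(1)] planD(1)[OF assms(2)] by metis
qed

lemma assignment_plan_value:
  assumes "S \<in> assignment_maps l k" "i \<in> {1..k}" "j \<in> {1..l}"
  shows "assignment_plan x l n y S (x i, y j) = (if S j = i then n j else 0)"
proof -
  have "assignment_plan x l n y S (x i, y j) = (\<Sum>j'=1..l. if j' = j then (if S j = i then n j else 0) else 0)"
    unfolding assignment_plan_def atoms_def
  proof (intro sum.cong refl)
    fix j' assume j': "j' \<in> {1..l}"
    have Sj: "S j' \<in> {1..k}" using assignment_image[OF assms(1)] j' by blast
    have "(x (S j'), y j') = (x i, y j) \<longleftrightarrow> S j' = i \<and> j' = j"
      using inj_onD[OF inj_x _ Sj assms(2)] inj_onD[OF inj_y _ j' assms(3)] by blast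
    then show "(if (x (S j'), y j') = (x i, y j) then n j' else 0) = (if j' = j then if S j = i then n j else 0 else 0)"
      by simp
  qed
  then show ?thesis using assms(3) by simp
qed

lemma assignment_plan_mem:
  assumes "S \<in> assignment_maps l k"
  shows "assignment_plan x l n y S \<in> plans"
proof -
  define Q where "Q i j = (if S j = i then n j else 0)" for i j
  have S: "S j \<in> {1..k}" if "j \<in> {1..l}" for j using assignment_image[OF assms] that by blast
  have "atoms ({1..k} \<times> {1..l}) (\<lambda>(i, j). Q i j) (\<lambda>(i, j). (x i, y j)) p = assignment_plan x l n y S p" for p
  proof -
    have "atoms ({1..k} \<times> {1..l}) (\<lambda>(i, j). Q i j) (\<lambda>(i, j). (x i, y j)) p =
        (\<Sum>(i, j)\<in>{1..k} \<times> {1..l}. if (x i, y j) = p then Q i j else 0)"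
      unfolding atoms_def by (intro sum.cong refl) auto
    also have "\<dots> = (\<Sum>i=1..k. \<Sum>j=1..l. if (x i, y j) = p then Q i j else 0)"
      by (rule sum.cartesian_product[symmetric])
    also have "\<dots> = (\<Sum>j=1..l. \<Sum>i=1..k. if (x i, y j) = p then Q i j else 0)"
      by (rule sum.swap)
    also have "\<dots> = (\<Sum>j=1..l. if (x (S j), y j) = p then n j else 0)"
    proof (intro sum.cong refl)
      fix j assume "j \<in> {1..l}"
      have "(\<Sum>i=1..k. if (x i, y j) = p then Q i j else 0) =
          (\<Sum>i=1..k. if i = S j then (if (x (S j), y j) = p then n j else 0) else 0)"
        by (intro sum.cong refl) (simp add: Q_def)
      then show "(\<Sum>i=1..k. if (x i, y j) = p then Q i j else 0) = (if (x (S j), y j) = p then n j else 0)"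
        using S[OF \<open>j \<in> {1..l}\<close>] by simp
    qed
    finally show ?thesis by (simp add: assignment_plan_def atoms_def)
  qed
  then have "assignment_plan x l n y S = atoms ({1..k} \<times> {1..l}) (\<lambda>(i, j). Q i j) (\<lambda>(i, j). (x i, y j))"
    by (simp add: fun_eq_iff)
  moreover have "\<forall>i\<in>{1..k}. \<forall>j\<in>{1..l}. 0 \<le> Q i j" using n_nonneg by (simp add: Q_def)
  moreover have "\<forall>j\<in>{1..l}. (\<Sum>i=1..k. Q i j) = n j" unfolding Q_def using S by simp
  ultimately show ?thesis unfolding allocation_plans_def by blast
qed

lemma finite_plan_pairs: "finite (plan_pairs q)"
  by (rule finite_subset[OF Collect_restrict]) (intro finite_cartesian_product finite_atLeastAtMost)

lemma plan_pairs_mass: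
  assumes "q \<in> plans" "ij \<in> {1..k} \<times> {1..l}" "ij \<notin> plan_pairs q"
  shows "plan_mass q ij = 0"
proof -
  have "0 \<le> plan_mass q ij" using planD(2)[OF assms(1)] assms(2) by (simp only: mem_Times_iff)
  moreover have "\<not> 0 < plan_mass q ij" using assms(2,3) by blast
  ultimately show ?thesis by linarith
qed

lemma sum_plan_pairs:
  fixes f :: "nat \<times> nat \<Rightarrow> real"
  assumes "q \<in> plans" "\<And>ij. plan_mass q ij = 0 \<Longrightarrow> f ij = 0"
  shows "(\<Sum>ij\<in>plan_pairs q. f ij) = (\<Sum>i=1..k. \<Sum>j=1..l. f (i, j))"
proof -
  have "(\<Sum>ij\<in>plan_pairs q. f ij) = (\<Sum>ij\<in>{1..k} \<times> {1..l}. f ij)"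
  proof (rule sum.mono_neutral_left)
    show "\<forall>ij\<in>{1..k} \<times> {1..l} - plan_pairs q. f ij = 0"
      using assms(2) plan_pairs_mass[OF assms(1)] by blast
  qed (intro finite_cartesian_product finite_atLeastAtMost, rule Collect_restrict)
  then show ?thesis by (simp add: sum.cartesian_product)
qed

lemma plan_atoms:
  assumes "q \<in> plans"
  shows "atoms (plan_pairs q) (plan_mass q) (\<lambda>ij. x (fst ij)) = plan_source k x l y q"
    and "atoms (plan_pairs q) (plan_mass q) (\<lambda>ij. y (snd ij)) = target"
proof -
  show "atoms (plan_pairs q) (plan_mass q) (\<lambda>ij. x (fst ij)) = plan_source k x l y q"
  proof
    fix v
    have "atoms (plan_pairs q) (plan_mass q) (\<lambda>ij. x (fst ij)) v =
        (\<Sum>i=1..k. \<Sum>j=1..l. if x i = v then q (x i, y j) else 0)"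
      unfolding atoms_def
      using sum_plan_pairs[OF assms, of "\<lambda>ij. if x (fst ij) = v then plan_mass q ij else 0"]
      by (simp only: fst_conv snd_conv if_cancel simp_thms)
    also have "\<dots> = (\<Sum>i=1..k. if x i = v then (\<Sum>j=1..l. q (x i, y j)) else 0)"
      by (intro sum.cong refl) auto
    finally show "atoms (plan_pairs q) (plan_mass q) (\<lambda>ij. x (fst ij)) v = plan_source k x l y q v"
      unfolding plan_source_def atoms_def .
  qed
  show "atoms (plan_pairs q) (plan_mass q) (\<lambda>ij. y (snd ij)) = target"
  proof
    fix v
    have "atoms (plan_pairs q) (plan_mass q) (\<lambda>ij. y (snd ij)) v =
        (\<Sum>i=1..k. \<Sum>j=1..l. if y j = v then q (x i, y j) else 0)"
      unfolding atoms_def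
      using sum_plan_pairs[OF assms, of "\<lambda>ij. if y (snd ij) = v then plan_mass q ij else 0"]
      by (simp only: fst_conv snd_conv if_cancel simp_thms)
    also have "\<dots> = (\<Sum>j=1..l. \<Sum>i=1..k. if y j = v then q (x i, y j) else 0)"
      by (rule sum.swap)
    also have "\<dots> = (\<Sum>j=1..l. if y j = v then n j else 0)"
    proof (intro sum.cong refl)
      fix j assume "j \<in> {1..l}"
      then show "(\<Sum>i=1..k. if y j = v then q (x i, y j) else 0) = (if y j = v then n j else 0)"
        using planD(3)[OF assms, of j] by (cases "y j = v") simp_all
    qed
    finally show "atoms (plan_pairs q) (plan_mass q) (\<lambda>ij. y (snd ij)) v = target v"
      unfolding atoms_def .
  qed
qed

lemma plan_path_allocation:
  assumes "q \<in> plans" "G \<in> transport_paths X (plan_source k x l y q) target"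
  shows "G \<in> allocation_paths X k x target"
proof -
  let ?m = "\<lambda>i. \<Sum>j=1..l. q (x i, y j)"
  have "0 \<le> ?m i" if "i \<in> {1..k}" for i using planD(2)[OF assms(1) that] by (intro sum_nonneg)
  moreover have "(\<Sum>i=1..k. ?m i) = 1"
  proof -
    have "(\<Sum>i=1..k. ?m i) = (\<Sum>j=1..l. \<Sum>i=1..k. q (x i, y j))" by (rule sum.swap)
    also have "\<dots> = (\<Sum>j=1..l. n j)" by (intro sum.cong refl planD(3)[OF assms(1)])
    finally show ?thesis using n_sum by simp
  qed
  moreover have "G \<in> transport_paths X (atoms {1..k} ?m x) target"
    using assms(2) unfolding plan_source_def .
  ultimately show ?thesis unfolding allocation_paths_def by blast
qed

lemma min_cost_le_plan:
  assumes "q \<in> plans"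
  shows "ereal min_cost \<le> qcost q"
  unfolding plan_cost_def
proof (rule INF_greatest)
  fix G assume "G \<in> {G \<in> transport_paths X (plan_source k x l y q) target. compatible k x l y G q}"
  then have "G \<in> allocation_paths X k x target" using plan_path_allocation[OF assms] by blast
  from allocation_path_chain[OF this] min_cost_le show "ereal min_cost \<le> ereal (path_cost \<alpha> G)"
    by fastforce
qed

section \<open>Cheap plans come from assignments\<close>

text \<open>Rigidity makes directed curves unique, so the definite description picks out any curve
  at hand.\<close>

lemma directed_curve_unique:
  assumes "G \<in> transport_paths X a b" "directed_curve G u v p"
  shows "(THE vs. directed_curve G u v vs) = p" "joining_chain G u v = curve_chain p"
proof -
  note T = transport_path_chain[OF assms(1)]
  note dc = directed_curve_walk[OF T(2)[symmetric]]
  show the: "(THE vs. directed_curve G u v vs) = p"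
  proof (rule the_equality)
    show "directed_curve G u v p" by (rule assms(2))
    fix vs assume vs: "directed_curve G u v vs"
    have "walk (flow_rel (path_chain G)) vs" "hd vs = u" "last vs = v"
      using vs unfolding dc by blast+
    moreover have "walk (flow_rel (path_chain G)) p" "hd p = u" "last p = v"
      using assms(2) unfolding dc by blast+
    ultimately show "vs = p" by (intro rigid_walk_unique[OF T(1,3)]) simp_all
  qed
  have "\<exists>vs. directed_curve G u v vs" using assms(2) by blast
  then show "joining_chain G u v = curve_chain p"
    unfolding joining_chain_def the by (rule if_P)
qed

text \<open>Compatibility writes \<open>G\<close> as a system of directed curves; in a forest they
  meet in segments and do not cancel, so nothing is lost between \<open>path_cost\<close> and the
  labelled cost.\<close>

lemma compatible_system:
  assumes "q \<in> plans" "G \<in> transport_paths X (plan_source k x l y q) target" "compatible k x l y G q"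
  shows "\<exists>P. curve_system X (plan_pairs q) (\<lambda>ij. x (fst ij)) (\<lambda>ij. y (snd ij)) P \<and>
    system_cost \<alpha> (plan_pairs q) (plan_mass q) P (\<lambda>z. z) = path_cost \<alpha> G"
proof -
  let ?\<phi> = "path_chain G" and ?I = "plan_pairs q"
  note T = transport_path_chain[OF assms(2)]
  note dc = directed_curve_walk[OF T(2)[symmetric]]
  have fin: "finite ?I" by (rule finite_plan_pairs)
  have "\<exists>P. \<forall>ij\<in>?I. directed_curve G (x (fst ij)) (y (snd ij)) (P ij)"
  proof (rule bchoice, rule ballI)
    fix ij assume ij: "ij \<in> ?I"
    have sep: "\<forall>i\<in>{1..k}. \<forall>j\<in>{1..l}. (\<nexists>vs. directed_curve G (x i) (y j) vs) \<longrightarrow> q (x i, y j) = 0"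
      using assms(3) unfolding compatible_def by (rule conjunct1)
    show "\<exists>vs. directed_curve G (x (fst ij)) (y (snd ij)) vs"
    proof (rule ccontr)
      assume "\<nexists>vs. directed_curve G (x (fst ij)) (y (snd ij)) vs"
      moreover have "fst ij \<in> {1..k}" "snd ij \<in> {1..l}" using ij by (simp_all only: mem_Collect_eq mem_Times_iff)
      ultimately have "plan_mass q ij = 0" using sep by blast
      with ij show False by simp
    qed
  qed
  then obtain P where P: "\<forall>ij\<in>?I. directed_curve G (x (fst ij)) (y (snd ij)) (P ij)" by (rule exE)
  have W: "walk (flow_rel ?\<phi>) (P ij)" "hd (P ij) = x (fst ij)" "last (P ij) = y (snd ij)"
    "distinct (P ij)" "set (P ij) \<subseteq> X" if "ij \<in> ?I" for ij
  proof -
    have "directed_curve G (x (fst ij)) (y (snd ij)) (P ij)" by (rule bspec[OF P that])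
    moreover have "verts G \<subseteq> X" using assms(2) unfolding transport_paths_def by blast
    ultimately show "walk (flow_rel ?\<phi>) (P ij)" "hd (P ij) = x (fst ij)" "last (P ij) = y (snd ij)"
      "distinct (P ij)" "set (P ij) \<subseteq> X" unfolding dc by blast+
  qed
  have "?\<phi> = system_chain ?I (plan_mass q) P"
  proof
    fix e
    have "?\<phi> = (\<lambda>p. \<Sum>i=1..k. \<Sum>j=1..l. q (x i, y j) * joining_chain G (x i) (y j) p)"
      using assms(3) unfolding compatible_def by (rule conjunct2)
    then have "?\<phi> e = (\<Sum>i=1..k. \<Sum>j=1..l. q (x i, y j) * joining_chain G (x i) (y j) e)"
      by (rule fun_cong)
    also have "\<dots> = (\<Sum>ij\<in>?I. plan_mass q ij * joining_chain G (x (fst ij)) (y (snd ij)) e)"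
      by (subst sum_plan_pairs[OF assms(1)]) simp_all
    also have "\<dots> = system_chain ?I (plan_mass q) P e"
      unfolding system_chain_def
    proof (intro sum.cong refl)
      fix ij assume "ij \<in> ?I"
      from directed_curve_unique(2)[OF assms(2) bspec[OF P this]]
      show "plan_mass q ij * joining_chain G (x (fst ij)) (y (snd ij)) e = plan_mass q ij * curve_chain (P ij) e"
        by simp
    qed
    finally show "?\<phi> e = system_chain ?I (plan_mass q) P e" .
  qed
  from system_cost_walks[OF T(1) this fin W(1) W(4)]
  have "system_cost \<alpha> ?I (plan_mass q) P (\<lambda>z. z) = path_cost \<alpha> G" using T(5)[of \<alpha>] by simp
  moreover have "curve_system X ?I (\<lambda>ij. x (fst ij)) (\<lambda>ij. y (snd ij)) P"
    by (rule walks_curve_system[OF T(1,3) W(1) W(5) W(2) W(3)])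
  ultimately show ?thesis by blast
qed

text \<open>
  It is not necessary to know that the infimum defining the cost of a plan is attained: a system of curves
  \<open>\<tau>, pos\<close> that is at least as cheap as every compatible path is enough, because the chain it
  carries is minimal and hence sends only one source to each \<open>y j\<close>.
\<close>

lemma cheap_plan_is_assignment:
  assumes "q \<in> plans" "qcost q \<le> ereal min_cost"
  shows "\<exists>S\<in>assignment_maps l k. cost S = min_cost \<and> q = assignment_plan x l n y S"
proof -
  let ?I = "plan_pairs q" and ?c = "plan_mass q"
  let ?s = "\<lambda>ij. x (fst ij)" and ?t = "\<lambda>ij. y (snd ij)"
  let ?T = "{G \<in> transport_paths X (plan_source k x l y q) target. compatible k x l y G q}"
  have fin: "finite ?I" by (rule finite_plan_pairs)
  have cpos: "\<And>ij. ij \<in> ?I \<Longrightarrow> 0 < ?c ij" by blast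
  \<comment> \<open>A finite cost requires a compatible path: the infimum over the empty set is
    \<infinity>.\<close>
  have "?T \<noteq> {}"
  proof
    assume "?T = {}"
    then have "qcost q = \<infinity>" unfolding plan_cost_def by (simp only: image_empty Inf_empty top_ereal_def)
    with assms(2) show False by simp
  qed
  then obtain G0 where "G0 \<in> ?T" by blast
  then obtain P0 where P0: "curve_system X ?I ?s ?t P0" using compatible_system[OF assms(1)] by blast
  have "X \<noteq> {}" using x_in k_pos by auto
  from optimal_placement_exists[where c = ?c, OF compact_X fin cpos alpha this P0]
  have "\<exists>\<tau> pos. placed_system X ?I ?s ?t \<tau> pos \<and>
    (\<forall>P. curve_system X ?I ?s ?t P \<longrightarrow> system_cost \<alpha> ?I ?c \<tau> pos \<le> system_cost \<alpha> ?I ?c P (\<lambda>z. z))"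
    by blast
  then obtain \<tau> pos where \<tau>: "placed_system X ?I ?s ?t \<tau> pos"
    "\<forall>P. curve_system X ?I ?s ?t P \<longrightarrow> system_cost \<alpha> ?I ?c \<tau> pos \<le> system_cost \<alpha> ?I ?c P (\<lambda>z. z)"
    by (elim exE conjE)
  have "ereal (system_cost \<alpha> ?I ?c \<tau> pos) \<le> qcost q"
    unfolding plan_cost_def
  proof (rule INF_greatest)
    fix G assume "G \<in> ?T"
    then obtain P where "curve_system X ?I ?s ?t P" "system_cost \<alpha> ?I ?c P (\<lambda>z. z) = path_cost \<alpha> G"
      using compatible_system[OF assms(1)] by blast
    then show "ereal (system_cost \<alpha> ?I ?c \<tau> pos) \<le> ereal (path_cost \<alpha> G)"
      using spec[OF \<tau>(2), of P] by simp
  qed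
  then have "ereal (system_cost \<alpha> ?I ?c \<tau> pos) \<le> ereal min_cost" using assms(2) by (rule order_trans)
  then have cheap: "system_cost \<alpha> ?I ?c \<tau> pos \<le> min_cost" by simp
  define P where "P ij = map pos (\<tau> ij)" for ij
  define \<phi> where "\<phi> = system_chain ?I ?c P"
  have P: "P ij \<noteq> []" "set (P ij) \<subseteq> X" "hd (P ij) = ?s ij" "last (P ij) = ?t ij" "distinct (\<tau> ij)"
    if "ij \<in> ?I" for ij
    using \<tau>(1) that unfolding placed_system_def P_def by (auto simp: hd_map last_map simp del: One_nat_def)
  have sR: "?s ij \<in> x ` {1..k}" if "ij \<in> ?I" for ij using that by (intro imageI) (simp only: mem_Collect_eq mem_Times_iff)
  have mem: "\<phi> \<in> allocations" "outflow \<phi> v + target v = atoms ?I ?c (\<lambda>ij. hd (P ij)) v" for v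
  proof -
    have c: "\<And>ij. ij \<in> ?I \<Longrightarrow> 0 \<le> ?c ij" using cpos less_imp_le by blast
    have hdR: "hd (P ij) \<in> x ` {1..k}" if "ij \<in> ?I" for ij unfolding P(3)[OF that] by (rule sR[OF that])
    have "\<phi> \<in> allocation_chains X (x ` {1..k}) (atoms ?I ?c ?t)"
      unfolding \<phi>_def by (rule system_chain_allocation(1)[where t = ?t, OF c P(1,2) hdR P(4)])
    then show "\<phi> \<in> allocations" unfolding plan_atoms(2)[OF assms(1)] .
    have "outflow \<phi> v + atoms ?I ?c ?t v = atoms ?I ?c (\<lambda>ij. hd (P ij)) v" for v
      unfolding \<phi>_def by (rule system_chain_allocation(2)[where t = ?t, OF c P(1,2) hdR P(4)])
    then show "outflow \<phi> v + target v = atoms ?I ?c (\<lambda>ij. hd (P ij)) v" for v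
      unfolding plan_atoms(2)[OF assms(1)] .
  qed
  have le: "chain_cost \<alpha> \<phi> \<le> system_cost \<alpha> ?I ?c \<tau> pos"
    unfolding \<phi>_def P_def by (rule placed_system_cost(1)[OF fin cpos P(5) alpha])
  \<comment> \<open>\<open>min_cost\<close>, the cost of \<phi>, the cost of the placed system and
    \<open>min_cost\<close> again form a closed chain of inequalities.\<close>
  then have "chain_cost \<alpha> \<phi> = min_cost" using cheap min_cost_le[OF mem(1)] by simp
  then have min: "minimal \<phi>" and ge: "system_cost \<alpha> ?I ?c \<tau> pos \<le> chain_cost \<alpha> \<phi>"
    using mem(1) cheap unfolding minimal_iff by simp_all
  have reach: "?s ij \<in> sources target \<phi> \<and> (?s ij, ?t ij) \<in> (flow_rel \<phi>)\<^sup>*" if ij: "ij \<in> ?I" for ij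
  proof
    have "0 < atoms ?I ?c (\<lambda>ij. hd (P ij)) (hd (P ij))"
      using atoms_pos[of ?I ?c ij "\<lambda>ij. hd (P ij)"] fin cpos ij less_imp_le by blast
    then show "?s ij \<in> sources target \<phi>" unfolding sources_def mem_Collect_eq mem(2) P(3)[OF ij] .
    \<comment> \<open>Equality of the two costs excludes cancellation, so each placed curve follows
      the flow of \<phi> from its source to its target.\<close>
    have "(hd (P ij), last (P ij)) \<in> (flow_rel \<phi>)\<^sup>*"
    proof (rule steps_rtrancl[OF P(1)[OF ij]])
      fix u v assume uv: "(u, v) \<in> steps (P ij)" "u \<noteq> v"
      have "0 < system_chain ?I ?c (\<lambda>ij. map pos (\<tau> ij)) (u, v)"
        by (rule placed_system_cost(2)[OF fin cpos P(5) alpha _ ij _ uv(2)])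
          (use uv(1) ge in \<open>unfold \<phi>_def P_def\<close>)
      then show "(u, v) \<in> flow_rel \<phi>" unfolding flow_rel_def \<phi>_def P_def by simp
    qed
    then show "(?s ij, ?t ij) \<in> (flow_rel \<phi>)\<^sup>*" unfolding P(3,4)[OF ij] .
  qed
  have ex: "\<exists>i\<in>{1..k}. (i, j) \<in> ?I" if j: "j \<in> {1..l}" for j
  proof (rule ccontr)
    assume none: "\<not> ?thesis"
    have "q (x i, y j) = 0" if "i \<in> {1..k}" for i
      using plan_pairs_mass[OF assms(1), of "(i, j)"] none that j by auto
    then have "(\<Sum>i=1..k. q (x i, y j)) = 0" by simp
    then show False using planD(3)[OF assms(1) j] n_pos[OF j] by simp
  qed
  have "\<exists>s. \<forall>j\<in>{1..l}. s j \<in> {1..k} \<and> (s j, j) \<in> ?I"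
  proof (rule bchoice, rule ballI)
    fix j assume "j \<in> {1..l}"
    from ex[OF this] show "\<exists>i. i \<in> {1..k} \<and> (i, j) \<in> ?I" by (rule bexE) (intro exI conjI)
  qed
  then obtain s where s: "\<forall>j\<in>{1..l}. s j \<in> {1..k} \<and> (s j, j) \<in> ?I" by (rule exE)
  define S where "S = restrict s {1..l}"
  have Ss: "S j = s j" if "j \<in> {1..l}" for j unfolding S_def by (rule restrict_apply'[OF that])
  have S: "S \<in> assignment_maps l k"
    unfolding S_def assignment_maps_def
  proof (rule restrict_PiE_iff[THEN iffD2], rule ballI)
    show "s j \<in> {1..k}" if "j \<in> {1..l}" for j by (rule conjunct1[OF bspec[OF s that]])
  qed
  have SI: "(S j, j) \<in> ?I" if "j \<in> {1..l}" for j
    unfolding Ss[OF that] by (rule conjunct2[OF bspec[OF s that]])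
  have "serves \<phi> S"
    unfolding serves_def
  proof
    fix j assume "j \<in> {1..l}"
    from reach[OF SI[OF this]]
    show "x (S j) \<in> sources target \<phi> \<and> (x (S j), y j) \<in> (flow_rel \<phi>)\<^sup>*" by (simp only: fst_conv snd_conv)
  qed
  then have "cost S = min_cost" by (rule minimal_split(1)[OF min S])
  moreover have "q = assignment_plan x l n y S"
  proof (rule plan_eqI[OF assms(1) assignment_plan_mem[OF S]])
    fix i j assume ij: "i \<in> {1..k}" "j \<in> {1..l}"
    \<comment> \<open>Another point sending mass to \<open>y j\<close> would be a second source
      upstream of it in \<phi>, which a minimal chain does not allow.\<close>
    have zero: "q (x i', y j) = 0" if i': "i' \<in> {1..k}" "i' \<noteq> S j" for i'
    proof (rule ccontr)
      assume "q (x i', y j) \<noteq> 0"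
      then have I': "(i', j) \<in> ?I"
        using plan_pairs_mass[OF assms(1), of "(i', j)"] i'(1) ij(2)
        by (metis SigmaI fst_conv snd_conv)
      have "x i' = x (S j)"
        using unique_sourcesD[OF minimal_facts(5)[OF min]] reach[OF I'] reach[OF SI[OF ij(2)]]
        by (metis fst_conv snd_conv)
      moreover have "S j \<in> {1..k}" using assignment_image[OF S] ij(2) by blast
      ultimately show False using inj_onD[OF inj_x _ i'(1)] i'(2) by blast
    qed
    have "n j = (\<Sum>i'=1..k. q (x i', y j))" using planD(3)[OF assms(1) ij(2)] by simp
    also have "\<dots> = (\<Sum>i'=1..k. if i' = S j then q (x (S j), y j) else 0)"
      by (intro sum.cong refl) (use zero in auto)
    also have "\<dots> = q (x (S j), y j)"
    proof -
      have "S j \<in> {1..k}" using assignment_image[OF S] ij(2) by blast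
      then show ?thesis by (simp only: sum.delta finite_atLeastAtMost if_True)
    qed
    finally show "q (x i, y j) = assignment_plan x l n y S (x i, y j)"
      unfolding assignment_plan_value[OF S ij] using zero[OF ij(1)] by auto
  qed
  ultimately show ?thesis using S by blast
qed

section \<open>Optimal assignments yield cheap plans\<close>

text \<open>Uniqueness of walks lets the second part start from arbitrary curves along the flow:
  they must be those of the decomposition.\<close>

lemma part_decomposition:
  assumes "i \<in> {1..k}" "part_minimal S i \<psi>"
  shows "\<exists>P. \<forall>j\<in>served S i. walk (flow_rel \<psi>) (P j) \<and> hd (P j) = x i \<and> last (P j) = y j \<and> distinct (P j)"
    and "(\<And>j. j \<in> served S i \<Longrightarrow> walk (flow_rel \<psi>) (P j) \<and> hd (P j) = x i \<and> last (P j) = y j) \<Longrightarrow>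
      \<psi> = system_chain (served S i) n P"
proof -
  have mem: "\<psi> \<in> part_allocations S i" using assms(2) by (simp add: minimal_chain_def)
  have fc: "flow_chain X \<psi>" by (rule allocation_chainsD(1)[OF mem])
  have rig: "rigid_on {} \<psi>" by (rule minimal_chain_rigid[OF assms(2) _ alpha]) simp
  have strong: "rigid_on (sources (assigned_target l n y S i) \<psi>) \<psi>"
    by (rule minimal_chain_strongly_rigid[OF assms(2) _ alpha assigned_target_nonneg]) simp
  obtain Q where Q: "\<And>j. j \<in> served S i \<Longrightarrow> walk (flow_rel \<psi>) (Q j)"
    "\<And>j. j \<in> served S i \<Longrightarrow> hd (Q j) \<in> sources (assigned_target l n y S i) \<psi>"
    "\<And>j. j \<in> served S i \<Longrightarrow> last (Q j) = y j" "\<psi> = system_chain (served S i) n Q"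
  proof -
    define J where "J = served S i"
    have "finite J" "\<And>j. j \<in> J \<Longrightarrow> 0 < n j" using n_pos unfolding J_def by auto
    from rigid_decomposition[of \<psi> X "{x i}" J n y, OF _ _ this] that mem strong show thesis
      unfolding assigned_target_eq J_def[symmetric] by blast
  qed
  have hd: "hd (Q j) = x i" if "j \<in> served S i" for j
    using Q(2)[OF that] allocation_chainsD(4)[OF mem] by blast
  have "distinct (Q j)" if "j \<in> served S i" for j
    by (rule walk_distinct[OF rigid_acyclic[OF fc rig] Q(1)[OF that]])
  then show "\<exists>P. \<forall>j\<in>served S i. walk (flow_rel \<psi>) (P j) \<and> hd (P j) = x i \<and> last (P j) = y j \<and> distinct (P j)"
    using Q(1,3) hd by blast
  assume P: "\<And>j. j \<in> served S i \<Longrightarrow> walk (flow_rel \<psi>) (P j) \<and> hd (P j) = x i \<and> last (P j) = y j"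
  have "P j = Q j" if "j \<in> served S i" for j
    using rigid_walk_unique[OF fc rig, of "P j" "Q j"] P[OF that] Q(1,3)[OF that] hd[OF that] by simp
  then have "system_chain (served S i) n Q = system_chain (served S i) n P"
    unfolding system_chain_def by (intro ext sum.cong refl) simp
  then show "\<psi> = system_chain (served S i) n P" using Q(4) by simp
qed

text \<open>
  The optimal paths for the individual sources add up to a minimal chain without cancellation, so
  their curves remain directed curves of a path that is compatible with the assignment plan.
\<close>

lemma assignment_plan_cost:
  assumes "S \<in> assignment_maps l k" "cost S = min_cost"
  shows "qcost (assignment_plan x l n y S) = ereal min_cost"
proof -
  let ?q = "assignment_plan x l n y S"
  have q: "?q \<in> plans" by (rule assignment_plan_mem[OF assms(1)])
  have S: "S j \<in> {1..k}" if "j \<in> {1..l}" for j using assignment_image[OF assms(1)] that by blast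
  obtain \<Phi> where \<Phi>: "\<forall>i\<in>{1..k}. part_minimal S i (\<Phi> i)" using part_minimals_exist[of S] by blast
  have mem: "\<forall>i\<in>{1..k}. \<Phi> i \<in> part_allocations S i" using \<Phi> by (simp add: minimal_chain_def)
  define \<phi> where "\<phi> = (\<lambda>e. \<Sum>i=1..k. \<Phi> i e)"
  have tot: "(\<Sum>i=1..k. chain_cost \<alpha> (\<Phi> i)) = min_cost" using cost_eq_sum[OF \<Phi>] assms(2) by simp
  have min: "minimal \<phi>"
    unfolding minimal_iff \<phi>_def
    using sum_part_allocations(1)[OF assms(1) mem] min_cost_le_sum[OF assms(1) mem] tot by simp
  note \<phi> = minimal_facts[OF min]
  have "\<exists>P. \<forall>i\<in>{1..k}. \<forall>j\<in>served S i. walk (flow_rel (\<Phi> i)) (P i j) \<and> hd (P i j) = x i \<and>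
      last (P i j) = y j \<and> distinct (P i j)"
    by (rule bchoice, rule ballI, rule part_decomposition(1)) (use \<Phi> in blast)+
  then obtain P0 where P0: "\<forall>i\<in>{1..k}. \<forall>j\<in>served S i. walk (flow_rel (\<Phi> i)) (P0 i j) \<and> hd (P0 i j) = x i \<and>
      last (P0 i j) = y j \<and> distinct (P0 i j)" by (rule exE)
  define P where "P j = P0 (S j) j" for j
  have Pi: "walk (flow_rel (\<Phi> i)) (P j)" "hd (P j) = x i" "last (P j) = y j" "distinct (P j)"
    if "i \<in> {1..k}" "j \<in> served S i" for i j
  proof -
    have "S j = i" using that(2) by blast
    then show "walk (flow_rel (\<Phi> i)) (P j)" "hd (P j) = x i" "last (P j) = y j" "distinct (P j)"
      using bspec[OF bspec[OF P0 that(1)] that(2)] unfolding P_def by simp_all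
  qed
  have P: "P j \<noteq> []" "hd (P j) = x (S j)" "last (P j) = y j" "distinct (P j)" if "j \<in> {1..l}" for j
    using Pi[OF S[OF that], of j] that by (simp_all add: walk_def)
  have \<Phi>P: "\<Phi> i = system_chain (served S i) n P" if "i \<in> {1..k}" for i
  proof (rule part_decomposition(2)[OF that])
    show "part_minimal S i (\<Phi> i)" using \<Phi> that by blast
  qed (use Pi[OF that] in blast)
  have \<phi>P: "\<phi> = system_chain {1..l} n P"
  proof
    fix e
    have "\<phi> e = (\<Sum>i=1..k. system_chain (served S i) n P e)"
      unfolding \<phi>_def by (intro sum.cong refl) (simp only: \<Phi>P)
    then show "\<phi> e = system_chain {1..l} n P e"
      using system_chain_group[of "{1..l}" "{1..k}" S n P e] assignment_image[OF assms(1)] by simp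
  qed
  \<comment> \<open>The labelled cost of all curves is at most the sum over the sources, that is
    \<open>min_cost\<close>, the cost of \<phi>. So there is no gap, which rules out cancellation
    between the parts.\<close>
  have "system_cost \<alpha> {1..l} n P (\<lambda>z. z) \<le> (\<Sum>i=1..k. system_cost \<alpha> (served S i) n P (\<lambda>z. z))"
    by (rule system_cost_partition_le[OF _ _ assignment_image[OF assms(1)] n_nonneg alpha]) simp_all
  also have "\<dots> = (\<Sum>i=1..k. chain_cost \<alpha> (\<Phi> i))"
  proof (intro sum.cong refl)
    fix i assume i: "i \<in> {1..k}"
    have fc: "flow_chain X (\<Phi> i)" using allocation_chainsD(1) mem i by blast
    have fin: "finite (served S i)" by simp
    show "system_cost \<alpha> (served S i) n P (\<lambda>z. z) = chain_cost \<alpha> (\<Phi> i)"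
      by (rule system_cost_walks[OF fc \<Phi>P[OF i] fin Pi(1)[OF i] Pi(4)[OF i]])
  qed
  also have "\<dots> = chain_cost \<alpha> \<phi>" using tot min minimal_iff by simp
  finally have le: "system_cost \<alpha> {1..l} n P (\<lambda>z. z) \<le> chain_cost \<alpha> \<phi>" .
  have walk: "walk (flow_rel \<phi>) (P j)" if j: "j \<in> {1..l}" for j
  proof -
    \<comment> \<open>\<open>placed_system_cost\<close> is applied with every vertex placed at
      itself.\<close>
    have id: "map (\<lambda>z. z) p = p" for p :: "'a list" by simp
    have "(u, v) \<in> flow_rel \<phi>" if uv: "(u, v) \<in> steps (P j)" for u v
    proof -
      have "u \<noteq> v"
      proof
        assume "u = v"
        have "(u, v) \<in> flow_rel (\<Phi> (S j))" using Pi(1)[OF S[OF j], of j] j uv unfolding walk_def by blast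
        moreover have "\<Phi> (S j) (u, u) = 0"
          by (rule flow_chainD(4)[OF allocation_chainsD(1)[OF bspec[OF mem S[OF j]]]])
        ultimately show False using \<open>u = v\<close> by (simp add: flow_rel_def)
      qed
      then have "0 < system_chain {1..l} n (\<lambda>i. map (\<lambda>z. z) (P i)) (u, v)"
        using placed_system_cost(2)[of "{1..l}" n P \<alpha> "\<lambda>z. z" j u v] n_pos P(4) alpha j uv le
        unfolding \<phi>P id by simp
      then show ?thesis unfolding \<phi>P id flow_rel_def by simp
    qed
    then show ?thesis using P(1)[OF j] unfolding walk_def by auto
  qed
  \<comment> \<open>All points \<open>x i\<close> and \<open>y j\<close> become vertices, since a
    curve of a single vertex needs that vertex in \<open>G\<close>.\<close>
  let ?V = "x ` {1..k} \<union> y ` {1..l}"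
  have source: "plan_source k x l y ?q = atoms {1..l} n (\<lambda>j. x (S j))"
  proof
    fix v
    have val: "(\<Sum>j=1..l. ?q (x i, y j)) = (\<Sum>j=1..l. if S j = i then n j else 0)" if "i \<in> {1..k}" for i
      by (intro sum.cong refl assignment_plan_value[OF assms(1) that])
    have "plan_source k x l y ?q v = (\<Sum>i=1..k. if x i = v then (\<Sum>j=1..l. if S j = i then n j else 0) else 0)"
      unfolding plan_source_def atoms_def by (intro sum.cong refl) (simp only: val)
    also have "\<dots> = (\<Sum>i=1..k. atoms (served S i) n (\<lambda>j. x (S j)) v)"
    proof (intro sum.cong refl)
      fix i
      have "atoms (served S i) n (\<lambda>j. x (S j)) v = (\<Sum>j\<in>served S i. if x i = v then n j else 0)"
        unfolding atoms_def by (intro sum.cong) auto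
      moreover have "(\<Sum>j\<in>served S i. n j) = (\<Sum>j=1..l. if S j = i then n j else 0)"
        by (rule sum.inter_filter) simp
      ultimately show "(if x i = v then (\<Sum>j=1..l. if S j = i then n j else 0) else 0) = atoms (served S i) n (\<lambda>j. x (S j)) v"
        by (cases "x i = v") (simp_all only: refl if_True if_False sum.neutral_const)
    qed
    also have "\<dots> = atoms {1..l} n (\<lambda>j. x (S j)) v"
      by (rule atoms_group[OF _ _ assignment_image[OF assms(1)]]) simp_all
    finally show "plan_source k x l y ?q v = atoms {1..l} n (\<lambda>j. x (S j)) v" .
  qed
  have "outflow \<phi> v = plan_source k x l y ?q v - target v" for v
    using sum_part_allocations(2)[OF assms(1) mem, of v] unfolding source \<phi>_def by simp
  moreover have V: "finite ?V" "?V \<subseteq> X" using x_in y_in by auto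
  moreover have "{p. plan_source k x l y ?q p \<noteq> 0} \<subseteq> ?V"
    unfolding plan_source_def using atoms_support[of "{1..k}" _ x] by blast
  moreover have "{p. target p \<noteq> 0} \<subseteq> ?V" using atoms_support[of "{1..l}" n y] by blast
  ultimately obtain G where G: "G \<in> transport_paths X (plan_source k x l y ?q) target" "path_chain G = \<phi>" "?V \<subseteq> verts G"
    using rigid_chain_transport_path[where V = ?V and a = "plan_source k x l y ?q" and b = target, OF \<phi>(2,3)]
    by blast
  \<comment> \<open>Reading \<open>G\<close> as a path in its own vertex set confines its curves to
    \<open>verts G\<close>.\<close>
  have GV: "G \<in> transport_paths (verts G) (plan_source k x l y ?q) target"
    using G(1) unfolding transport_paths_def by blast
  note T = transport_path_chain[OF G(1)]
  have curve: "directed_curve G (x (S j)) (y j) (P j)" if j: "j \<in> {1..l}" for j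
  proof -
    have "set (P j) \<subseteq> verts G"
    proof (rule walk_subset[OF transport_path_chain(1)[OF GV]])
      show "walk (flow_rel (path_chain G)) (P j)" unfolding G(2) by (rule walk[OF j])
      show "hd (P j) \<in> verts G" unfolding P(2)[OF j] using S[OF j] G(3) by blast
    qed
    then show ?thesis
      unfolding directed_curve_walk[OF T(2)[symmetric]] G(2) using walk[OF j] P(2-4)[OF j] by blast
  qed
  have "compatible k x l y G ?q"
    unfolding compatible_def
  proof (intro conjI ballI impI ext)
    fix i j assume ij: "i \<in> {1..k}" "j \<in> {1..l}" "\<nexists>vs. directed_curve G (x i) (y j) vs"
    then have "S j \<noteq> i" using curve[OF ij(2)] by blast
    then show "?q (x i, y j) = 0" unfolding assignment_plan_value[OF assms(1) ij(1,2)] by simp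
  next
    fix e
    have "(\<Sum>i=1..k. \<Sum>j=1..l. ?q (x i, y j) * joining_chain G (x i) (y j) e) =
        (\<Sum>j=1..l. \<Sum>i=1..k. ?q (x i, y j) * joining_chain G (x i) (y j) e)"
      by (rule sum.swap)
    also have "\<dots> = (\<Sum>j=1..l. n j * curve_chain (P j) e)"
    proof (intro sum.cong refl)
      fix j assume j: "j \<in> {1..l}"
      have "(\<Sum>i=1..k. ?q (x i, y j) * joining_chain G (x i) (y j) e) =
          (\<Sum>i=1..k. if i = S j then n j * joining_chain G (x (S j)) (y j) e else 0)"
      proof (intro sum.cong refl)
        fix i assume "i \<in> {1..k}"
        from assignment_plan_value[OF assms(1) this j]
        show "?q (x i, y j) * joining_chain G (x i) (y j) e =
            (if i = S j then n j * joining_chain G (x (S j)) (y j) e else 0)"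
          by auto
      qed
      also have "\<dots> = n j * joining_chain G (x (S j)) (y j) e"
        using S[OF j] by (simp only: sum.delta finite_atLeastAtMost if_True)
      also have "\<dots> = n j * curve_chain (P j) e"
        by (simp only: directed_curve_unique(2)[OF G(1) curve[OF j]])
      finally show "(\<Sum>i=1..k. ?q (x i, y j) * joining_chain G (x i) (y j) e) = n j * curve_chain (P j) e" .
    qed
    finally show "path_chain G e = (\<Sum>i=1..k. \<Sum>j=1..l. ?q (x i, y j) * joining_chain G (x i) (y j) e)"
      unfolding G(2) \<phi>P system_chain_def by simp
  qed
  then have "G \<in> {G \<in> transport_paths X (plan_source k x l y ?q) target. compatible k x l y G ?q}"
    using G(1) by blast
  then have "qcost ?q \<le> ereal (path_cost \<alpha> G)" unfolding plan_cost_def by (rule INF_lower)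
  also have "path_cost \<alpha> G = min_cost" using T(5)[of \<alpha>] min unfolding G(2) minimal_iff by simp
  finally show ?thesis using min_cost_le_plan[OF q] by (rule antisym)
qed

section \<open>The equivalence for plans and the common minimum\<close>

lemma optimal_assignment_exists:
  obtains S where "S \<in> assignment_maps l k" "cost S = min_cost"
proof -
  obtain \<phi> where \<phi>: "minimal \<phi>" using minimal_exists by blast
  obtain S where S: "S \<in> assignment_maps l k" "serves \<phi> S" using minimal_serves[OF \<phi>] by blast
  show thesis by (rule that[OF S(1) minimal_split(1)[OF \<phi> S]])
qed

lemma optimal_plan_iff:
  assumes "q \<in> plans"
  shows "optimal_plan X \<alpha> k x l n y q \<longleftrightarrow> qcost q = ereal min_cost"
proof
  assume opt: "optimal_plan X \<alpha> k x l n y q"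
  obtain S where S: "S \<in> assignment_maps l k" "cost S = min_cost" by (rule optimal_assignment_exists)
  have "qcost q \<le> qcost (assignment_plan x l n y S)"
    using opt assignment_plan_mem[OF S(1)] unfolding optimal_plan_def is_arg_min_linorder by blast
  then show "qcost q = ereal min_cost"
    unfolding assignment_plan_cost[OF S] using min_cost_le_plan[OF assms] by (rule antisym)
next
  assume "qcost q = ereal min_cost"
  then show "optimal_plan X \<alpha> k x l n y q"
    unfolding optimal_plan_def is_arg_min_linorder using assms min_cost_le_plan by simp
qed

lemma optimal_plan_assignment:
  assumes "q \<in> plans"
  shows "optimal_plan X \<alpha> k x l n y q \<longleftrightarrow>
    (\<exists>S\<in>assignment_maps l k. optimal_assignment X \<alpha> k x l n y S \<and> q = assignment_plan x l n y S)"
proof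
  assume "optimal_plan X \<alpha> k x l n y q"
  then have "qcost q \<le> ereal min_cost" using optimal_plan_iff[OF assms] by simp
  from cheap_plan_is_assignment[OF assms this]
  show "\<exists>S\<in>assignment_maps l k. optimal_assignment X \<alpha> k x l n y S \<and> q = assignment_plan x l n y S"
    using optimal_assignment_iff by blast
next
  assume "\<exists>S\<in>assignment_maps l k. optimal_assignment X \<alpha> k x l n y S \<and> q = assignment_plan x l n y S"
  then obtain S where S: "S \<in> assignment_maps l k" "cost S = min_cost" "q = assignment_plan x l n y S"
    using optimal_assignment_iff by blast
  show "optimal_plan X \<alpha> k x l n y q"
    unfolding optimal_plan_iff[OF assms] unfolding S(3) by (rule assignment_plan_cost[OF S(1,2)])
qed

lemma common_minimum:
  "\<exists>c. (\<exists>q. optimal_plan X \<alpha> k x l n y q \<and> qcost q = ereal c)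
     \<and> (\<exists>S. optimal_assignment X \<alpha> k x l n y S \<and> cost S = c)
     \<and> (\<exists>G. optimal_allocation_path X \<alpha> k x target G \<and> path_cost \<alpha> G = c)"
proof (intro exI[of _ min_cost] conjI)
  obtain S where S: "S \<in> assignment_maps l k" "cost S = min_cost" by (rule optimal_assignment_exists)
  show "\<exists>S. optimal_assignment X \<alpha> k x l n y S \<and> cost S = min_cost"
    using S optimal_assignment_iff[OF S(1)] by blast
  show "\<exists>q. optimal_plan X \<alpha> k x l n y q \<and> qcost q = ereal min_cost"
    using assignment_plan_cost[OF S] optimal_plan_iff[OF assignment_plan_mem[OF S(1)]] by blast
  obtain \<phi> where \<phi>: "minimal \<phi>" using minimal_exists by blast
  obtain G where G: "G \<in> allocation_paths X k x target" "path_chain G = \<phi>" using minimal_path[OF \<phi>] by blast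
  have "path_cost \<alpha> G = min_cost" using allocation_path_chain(2)[OF G(1)] \<phi> unfolding G(2) minimal_iff by simp
  then show "\<exists>G. optimal_allocation_path X \<alpha> k x target G \<and> path_cost \<alpha> G = min_cost"
    using optimal_path_iff[OF G(1)] by blast
qed

end

theorem theorem1:
  fixes X :: "(real ^ 'm) set"
    and k l :: nat
    and x y :: "nat \<Rightarrow> real ^ 'm"
    and n :: "nat \<Rightarrow> real"
    and \<alpha> :: real
  assumes "compact X" and "convex X"
    and "k \<ge> 1" and "inj_on x {1..k}" and "x ` {1..k} \<subseteq> X"
    and "inj_on y {1..l}" and "y ` {1..l} \<subseteq> X"
    and "\<And>j. j \<in> {1..l} \<Longrightarrow> 0 < n j" and "(\<Sum>j=1..l. n j) = 1"
    and "0 \<le> \<alpha>" and "\<alpha> < 1"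
  shows
    "(\<forall>q \<in> allocation_plans k x l n y.
        optimal_plan X \<alpha> k x l n y q \<longleftrightarrow>
        (\<exists>S \<in> assignment_maps l k.
           optimal_assignment X \<alpha> k x l n y S \<and> q = assignment_plan x l n y S))
     \<and> (\<forall>G \<in> allocation_paths X k x (atoms {1..l} n y).
        optimal_allocation_path X \<alpha> k x (atoms {1..l} n y) G \<longleftrightarrow>
        (\<exists>S \<in> assignment_maps l k.
           optimal_assignment X \<alpha> k x l n y S \<and> associated_path X \<alpha> k x l n y S G))
     \<and> (\<exists>c. (\<exists>q. optimal_plan X \<alpha> k x l n y q \<and> plan_cost X \<alpha> k x l n y q = ereal c)
          \<and> (\<exists>S. optimal_assignment X \<alpha> k x l n y S \<and> assignment_cost X \<alpha> k x l n y S = c)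
          \<and> (\<exists>G. optimal_allocation_path X \<alpha> k x (atoms {1..l} n y) G \<and> path_cost \<alpha> G = c))"
proof -
  interpret allocation_problem X k l x y n \<alpha>
    using assms by unfold_locales
  show ?thesis
    by (intro conjI ballI optimal_plan_assignment optimal_path_associated common_minimum)
qed

end
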